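(* Let $D=\mathbb{R}^k$, let $g\in B_b(S,\mathbb{R}^k)$ be consistent, and suppose that $f(t,x,w)=a(t,x)+b(t,x)w$ for every $(t,x,w)\in[0,T]\times S\times\mathbb{R}^k$ and some $\mu$-dominated $a\in B([0,T]\times S,\mathbb{R}^k)$ and $b\in B([0,T]\times S,\mathbb{R}^{k\times k})$. Let $u_g$ be the unique non-extendible admissible solution to (M) and $I_g$ its maximal interval of existence. Then $I_g=[0,T]$ and $$u_g(r,x)=E_{r,x}[\Sigma_{r,T}\,g(X_T)]-E_{r,x}\bigg[\int_r^T\Sigma_{r,t}\,a(t,X_t)\,\mu(dt)\bigg]$$ for all $(r,x)\in[0,T]\times S$ and some map $\Sigma:[0,T]\times[0,T]\times\Omega\to\mathbb{R}^{k\times k}$, $(r,t,\omega)\mapsto\Sigma_{r,t}(\omega)$, with the following three properties: (i) $\Sigma_{r,t}$ is $\sigma(X_s:s\in[r,t])$-measurable, $|\Sigma_{r,t}|\le\sqrt{k}\,e^{\int_r^t|b(s,X_s)|\,\mu(ds)}$, and $\Sigma(\omega):[0,T]\times[0,T]\to\mathbb{R}^{k\times k}$ is continuous, for all $r,t\in[0,T]$ with $r\le t$ and each $\omega\in\Omega$. (ii) $\Sigma_{r,r}=\mathbb{I}_k$, $\Sigma_{r,s}\Sigma_{s,t}=\Sigma_{r,t}$, and $\Sigma_{r,t}(\omega)$ is an invertible matrix with $\Sigma_{r,t}(\omega)^{-1}=\Sigma_{t,r}(\omega)$, for all $r,s,t\in[0,T]$ and every $\omega\in\Omega$. (iii) If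 $b(r,x)b(s,y)=b(s,y)b(r,x)$ for all $(r,x),(s,y)\in[0,T]\times S$, then $\Sigma_{r,t}=e^{-\int_r^tb(s,X_s)\,\mu(ds)}$ for all $r,t\in[0,T]$ with $r\le t$.
   Context: **Spaces.** $S$ is a separable metrizable topological space, $T>0$, $\mu$ is an atomless Borel measure on $[0,T]$, $k\in\mathbb{N}$, $\mathbb{I}_k$ is the identity matrix in $\mathbb{R}^{k\times k}$, $|\cdot|$ is the Euclidean norm on $\mathbb{R}^k$ and the Frobenius norm on $\mathbb{R}^{k\times k}$. $[0,T]\times S$ carries a pseudometric $d_S$ whose topology is coarser than or equal to the product topology; $\mathcal{B}(I\times S)$ and Borel measurability on $I\times S$ ($I\subset[0,T]$ an interval) refer to $d_S$. A map $u$ on $I\times S$ is consistent if $u(r,x)=u(s,y)$ whenever $d_S((r,x),(s,y))=0$. A map $g$ on $S$ is consistent if $g(x)=g(y)$ whenever $d_S((T,x),(T,y))=0$. $B(S,D)$, $B(I\times S,D)$ are the sets of $D$-valued Borel measurable maps; $B_b$ denotes the bounded ones. **Markov process.** $\mathcal{X}=(X,(\mathcal{F}_t)_{t\in[0,T]},\mathbb{P})$ is a fixed consistent progressive Markov process on a measurable space $(\Omega,\mathcal{F})$ with state space $S$ and Borel measurable transition probabilities: $X:[0,T]\times\Omega\to S$ is a process adapted to the filtration $(\mathcal{F}_t)$, $\mathbb{P}=\{P_{r,x}\mid(r,x)\in[0,T]\times S\}$ is a set of probability measures on $(\Omega,\mathcal{F})$ (expectations $E_{r,x}$), and: (1) for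 each $(s,y)$, $P_{s,y}$-a.s. $d_S((r,X_r),(r,y))=0$ for all $r\in[0,s]$; (2) $[0,t]\times S\to[0,1]$, $(s,x)\mapsto P_{s,x}(X_t\in B)$ is consistent and Borel measurable for all $t\in[0,T]$, $B\in\mathcal{B}(S)$; (3) $P_{r,x}(X_t\in B\mid\mathcal{F}_s)=P_{s,X_s}(X_t\in B)$ $P_{r,x}$-a.s. for all $r\le s\le t$, $x\in S$, $B\in\mathcal{B}(S)$; (4) $X$ is progressively measurable with respect to its natural filtration and its natural backward filtration. **Domination.** A map $a\in B([0,T]\times S,E)$, $E$ a normed space, is $\mu$-dominated if there is a $\mu$-integrable $\overline a\in B([0,T],\mathbb{R}_+)$ such that, outside a $\mu$-null set of $s$, $\|a(s,y)\|\le\overline a(s)$ for all $y\in S$. **Problem (M).** An interval $I$ is admissible if $I=(t,T]$ or $I=[t,T]$ for some $t\in[0,T)$. A solution to (M) (with data $f,g$) on an admissible interval $I$ is a consistent $u\in B(I\times S,D)$ such that for all $r\le t$ in $I$ and $x\in S$, $|u(t,X_t)|$ and $\int_r^t|f(s,X_s,u(s,X_s))|\,\mu(ds)$ are finite and $P_{r,x}$-integrable, $E_{r,x}[u(t,X_t)]=u(r,x)+E_{r,x}[\int_r^tf(s,X_s,u(s,X_s))\,\mu(ds)]$, and $u(T,x)=g(x)$. A solution $u$ on $I$ is admissible if $u([r,T]\times S)$ is relatively compact in $D^\circ$ (its closure is a compact subset of $D^\circ$) for all $r\in I$. An admissible solution $u$ on $I$ is extendible if there is an admissible solution $\tilde u$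 on an admissible interval $\tilde I\supsetneq I$ with $u=\tilde u$ on $I\times S$; otherwise it is non-extendible and $I$ is a maximal interval of existence. For the data considered here there is a unique non-extendible admissible solution; it is denoted $u_g$ and its interval $I_g$.
   Formalization: The formal statement additionally assumes that the time coordinate (r,x)↦r is Borel for d_S, and that X is progressively measurable on every window [r,t] with respect to σ(X_s: s∈[r,t]); without these the claim can fail. *)

theory Defs
  imports "HOL-Probability.Probability"
begin

text \<open>
  Conventions. The state space \<open>S\<close> is a whole type of class metric space with a second countable
  topology, i.e. an arbitrary (nonempty) separable metrizable space; its metric is never used, only
  its topology. Maps on \<open>I \<times> S\<close>, \<open>I \<subseteq> [0,T]\<close>, are HOL functions on pairs of which only the values on
  \<open>I \<times> UNIV\<close> matter. The norm of \<^typ>\<open>real^'k^'k\<close> is the Frobenius norm.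
\<close>

section \<open>Pseudometric structure on \<open>[0,T] \<times> S\<close>\<close>

definition pseudometric_on :: "'a set \<Rightarrow> ('a \<Rightarrow> 'a \<Rightarrow> real) \<Rightarrow> bool" where
  "pseudometric_on A d \<longleftrightarrow>
     (\<forall>p\<in>A. d p p = 0) \<and>
     (\<forall>p\<in>A. \<forall>q\<in>A. 0 \<le> d p q \<and> d p q = d q p) \<and>
     (\<forall>p\<in>A. \<forall>q\<in>A. \<forall>z\<in>A. d p z \<le> d p q + d q z)"

definition pm_open :: "('a \<Rightarrow> 'a \<Rightarrow> real) \<Rightarrow> 'a set \<Rightarrow> 'a set \<Rightarrow> bool" where
  "pm_open d A U \<longleftrightarrow> U \<subseteq> A \<and> (\<forall>p\<in>U. \<exists>e>0. \<forall>q\<in>A. d p q < e \<longrightarrow> q \<in> U)"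

definition pm_borel :: "('a \<Rightarrow> 'a \<Rightarrow> real) \<Rightarrow> 'a set \<Rightarrow> 'a measure" where
  "pm_borel d A = sigma A {U. pm_open d A U}"

definition time_state_pseudometric ::
    "real \<Rightarrow> (real \<times> 's::topological_space \<Rightarrow> real \<times> 's \<Rightarrow> real) \<Rightarrow> bool" where
  "time_state_pseudometric T d \<longleftrightarrow>
     pseudometric_on ({0..T} \<times> UNIV) d \<and>
     (\<forall>U. pm_open d ({0..T} \<times> UNIV) U \<longrightarrow> openin (top_of_set ({0..T} \<times> UNIV)) U)"

definition consistent_on :: "('a \<Rightarrow> 'a \<Rightarrow> real) \<Rightarrow> 'a set \<Rightarrow> ('a \<Rightarrow> 'b) \<Rightarrow> bool" where
  "consistent_on d A u \<longleftrightarrow> (\<forall>p\<in>A. \<forall>q\<in>A. d p q = 0 \<longrightarrow> u p = u q)"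


section \<open>The measure \<open>\<mu>\<close> and domination\<close>

definition measure_atom :: "'a measure \<Rightarrow> 'a set \<Rightarrow> bool" where
  "measure_atom N A \<longleftrightarrow>
     A \<in> sets N \<and> 0 < emeasure N A \<and>
     (\<forall>B\<in>sets N. B \<subseteq> A \<longrightarrow> emeasure N B = 0 \<or> emeasure N (A - B) = 0)"

definition atomless :: "'a measure \<Rightarrow> bool" where
  "atomless N \<longleftrightarrow> (\<nexists>A. measure_atom N A)"

text \<open>A Borel measure on \<open>[0,T]\<close>; no finiteness is required.\<close>

definition borel_measure_on :: "real \<Rightarrow> real measure \<Rightarrow> bool" where
  "borel_measure_on T \<mu> \<longleftrightarrow> sets \<mu> = sets (restrict_space borel {0..T})"

definition dominated :: "real \<Rightarrow> real measure \<Rightarrow> (real \<times> 's \<Rightarrow> 'e::real_normed_vector) \<Rightarrow> bool" where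
  "dominated T \<mu> a \<longleftrightarrow>
     (\<exists>abar :: real \<Rightarrow> real.
        integrable \<mu> abar \<and> (\<forall>s\<in>{0..T}. 0 \<le> abar s) \<and>
        (AE s in \<mu>. \<forall>y. norm (a (s, y)) \<le> abar s))"


section \<open>Consistent progressive Markov processes\<close>

text \<open>The \<open>\<sigma>\<close>-field \<open>\<sigma>(X\<^sub>s : s \<in> [r,t])\<close> on the underlying set of \<open>M\<close>.\<close>

definition natural_sigma ::
    "'w measure \<Rightarrow> (real \<Rightarrow> 'w \<Rightarrow> 's::topological_space) \<Rightarrow> real \<Rightarrow> real \<Rightarrow> 'w measure" where
  "natural_sigma M X r t =
     sigma (space M) {X s -` B \<inter> space M | s B. s \<in> {r..t} \<and> B \<in> sets borel}"

text \<open>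
  For fixed \<open>r\<close>, the family \<open>(\<sigma>(X\<^sub>s : s \<in> [r,t]))\<^sub>t\<close> is the natural filtration of \<open>X\<close> started at \<open>r\<close>;
  for fixed \<open>t\<close>, the family in \<open>r\<close> is the natural backward filtration of \<open>X\<close> run back from \<open>t\<close>.
  Requiring progressive measurability with respect to these only for \<open>r = 0\<close> and \<open>t = T\<close>
  would not make \<open>\<integral>\<^sub>r\<^sup>t \<phi>(s, X\<^sub>s) \<mu>(ds)\<close> measurable with respect to \<open>\<sigma>(X\<^sub>s : s \<in> [r,t])\<close>.
\<close>

definition progressive ::
    "real \<Rightarrow> 'w measure \<Rightarrow> (real \<Rightarrow> 'w \<Rightarrow> 's::topological_space) \<Rightarrow> bool" where
  "progressive T M X \<longleftrightarrow>
     (\<forall>r t. 0 \<le> r \<and> r \<le> t \<and> t \<le> T \<longrightarrow>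
        (\<lambda>(s, \<omega>). X s \<omega>) \<in> restrict_space borel {r..t} \<Otimes>\<^sub>M natural_sigma M X r t \<rightarrow>\<^sub>M borel)"

text \<open>
  \<open>M\<close> only serves as the measurable space \<open>(\<Omega>, \<F>)\<close>; its own measure is irrelevant.
  \<open>P s x\<close> is \<open>P\<^sub>s\<^sub>,\<^sub>x\<close>.
\<close>

definition markov_process ::
    "real \<Rightarrow> (real \<times> 's::topological_space \<Rightarrow> real \<times> 's \<Rightarrow> real) \<Rightarrow> 'w measure \<Rightarrow>
     (real \<Rightarrow> 'w measure) \<Rightarrow> (real \<Rightarrow> 'w \<Rightarrow> 's) \<Rightarrow> (real \<Rightarrow> 's \<Rightarrow> 'w measure) \<Rightarrow> bool" where
  "markov_process T d M F X P \<longleftrightarrow>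
     (\<forall>t\<in>{0..T}. subalgebra M (F t)) \<and>
     (\<forall>s t. 0 \<le> s \<and> s \<le> t \<and> t \<le> T \<longrightarrow> sets (F s) \<subseteq> sets (F t)) \<and>
     (\<forall>t\<in>{0..T}. X t \<in> F t \<rightarrow>\<^sub>M borel) \<and>
     (\<forall>r\<in>{0..T}. \<forall>x. prob_space (P r x) \<and> sets (P r x) = sets M) \<and>
     (\<forall>s\<in>{0..T}. \<forall>y. AE \<omega> in P s y. \<forall>r\<in>{0..s}. d (r, X r \<omega>) (r, y) = 0) \<and>
     (\<forall>t\<in>{0..T}. \<forall>B\<in>sets borel.
        consistent_on d ({0..t} \<times> UNIV) (\<lambda>(s, x). measure (P s x) (X t -` B \<inter> space M)) \<and>
        (\<lambda>(s, x). measure (P s x) (X t -` B \<inter> space M))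
          \<in> borel_measurable (pm_borel d ({0..t} \<times> UNIV))) \<and>
     (\<forall>r s t x. \<forall>B\<in>sets borel. 0 \<le> r \<and> r \<le> s \<and> s \<le> t \<and> t \<le> T \<longrightarrow>
        (AE \<omega> in P r x.
           real_cond_exp (P r x) (F s) (indicator (X t -` B \<inter> space M)) \<omega>
             = measure (P s (X s \<omega>)) (X t -` B \<inter> space M)))"


section \<open>Solutions to problem (M)\<close>

definition admissible_interval :: "real \<Rightarrow> real set \<Rightarrow> bool" where
  "admissible_interval T I \<longleftrightarrow> (\<exists>t. 0 \<le> t \<and> t < T \<and> (I = {t<..T} \<or> I = {t..T}))"

definition solution_M ::
    "real \<Rightarrow> (real \<times> 's \<Rightarrow> real \<times> 's \<Rightarrow> real) \<Rightarrow> real measure \<Rightarrow> 'w measure \<Rightarrow>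
     (real \<Rightarrow> 'w \<Rightarrow> 's) \<Rightarrow> (real \<Rightarrow> 's \<Rightarrow> 'w measure) \<Rightarrow> (real^'k) set \<Rightarrow>
     (real \<Rightarrow> 's \<Rightarrow> real^'k \<Rightarrow> real^'k) \<Rightarrow> ('s \<Rightarrow> real^'k) \<Rightarrow>
     real set \<Rightarrow> (real \<times> 's \<Rightarrow> real^'k) \<Rightarrow> bool" where
  "solution_M T d \<mu> M X P D f g I u \<longleftrightarrow>
     admissible_interval T I \<and>
     consistent_on d (I \<times> UNIV) u \<and>
     u \<in> borel_measurable (pm_borel d (I \<times> UNIV)) \<and>
     u ` (I \<times> UNIV) \<subseteq> D \<and>
     (\<forall>r\<in>I. \<forall>t\<in>I. \<forall>x. r \<le> t \<longrightarrow>
        integrable (P r x) (\<lambda>\<omega>. norm (u (t, X t \<omega>))) \<and>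
        (\<forall>\<omega>\<in>space M. set_integrable \<mu> {r..t} (\<lambda>s. f s (X s \<omega>) (u (s, X s \<omega>)))) \<and>
        integrable (P r x) (\<lambda>\<omega>. LINT s:{r..t}|\<mu>. norm (f s (X s \<omega>) (u (s, X s \<omega>)))) \<and>
        (LINT \<omega>|P r x. u (t, X t \<omega>)) =
          u (r, x) + (LINT \<omega>|P r x. (LINT s:{r..t}|\<mu>. f s (X s \<omega>) (u (s, X s \<omega>))))) \<and>
     (\<forall>x. u (T, x) = g x)"

definition admissible_solution_M ::
    "real \<Rightarrow> (real \<times> 's \<Rightarrow> real \<times> 's \<Rightarrow> real) \<Rightarrow> real measure \<Rightarrow> 'w measure \<Rightarrow>
     (real \<Rightarrow> 'w \<Rightarrow> 's) \<Rightarrow> (real \<Rightarrow> 's \<Rightarrow> 'w measure) \<Rightarrow> (real^'k) set \<Rightarrow>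
     (real \<Rightarrow> 's \<Rightarrow> real^'k \<Rightarrow> real^'k) \<Rightarrow> ('s \<Rightarrow> real^'k) \<Rightarrow>
     real set \<Rightarrow> (real \<times> 's \<Rightarrow> real^'k) \<Rightarrow> bool" where
  "admissible_solution_M T d \<mu> M X P D f g I u \<longleftrightarrow>
     solution_M T d \<mu> M X P D f g I u \<and>
     (\<forall>r\<in>I. compact (closure (u ` ({r..T} \<times> UNIV))) \<and>
             closure (u ` ({r..T} \<times> UNIV)) \<subseteq> interior D)"

definition extendible_M ::
    "real \<Rightarrow> (real \<times> 's \<Rightarrow> real \<times> 's \<Rightarrow> real) \<Rightarrow> real measure \<Rightarrow> 'w measure \<Rightarrow>
     (real \<Rightarrow> 'w \<Rightarrow> 's) \<Rightarrow> (real \<Rightarrow> 's \<Rightarrow> 'w measure) \<Rightarrow> (real^'k) set \<Rightarrow>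
     (real \<Rightarrow> 's \<Rightarrow> real^'k \<Rightarrow> real^'k) \<Rightarrow> ('s \<Rightarrow> real^'k) \<Rightarrow>
     real set \<Rightarrow> (real \<times> 's \<Rightarrow> real^'k) \<Rightarrow> bool" where
  "extendible_M T d \<mu> M X P D f g I u \<longleftrightarrow>
     (\<exists>J v. I \<subset> J \<and> admissible_solution_M T d \<mu> M X P D f g J v \<and>
            (\<forall>p\<in>I \<times> UNIV. u p = v p))"

definition nonextendible_admissible_solution_M ::
    "real \<Rightarrow> (real \<times> 's \<Rightarrow> real \<times> 's \<Rightarrow> real) \<Rightarrow> real measure \<Rightarrow> 'w measure \<Rightarrow>
     (real \<Rightarrow> 'w \<Rightarrow> 's) \<Rightarrow> (real \<Rightarrow> 's \<Rightarrow> 'w measure) \<Rightarrow> (real^'k) set \<Rightarrow>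
     (real \<Rightarrow> 's \<Rightarrow> real^'k \<Rightarrow> real^'k) \<Rightarrow> ('s \<Rightarrow> real^'k) \<Rightarrow>
     real set \<Rightarrow> (real \<times> 's \<Rightarrow> real^'k) \<Rightarrow> bool" where
  "nonextendible_admissible_solution_M T d \<mu> M X P D f g I u \<longleftrightarrow>
     admissible_solution_M T d \<mu> M X P D f g I u \<and> \<not> extendible_M T d \<mu> M X P D f g I u"


section \<open>Matrix exponential\<close>

text \<open>
  The library's \<^const>\<open>exp\<close> does not apply: the ring multiplication on \<^typ>\<open>real^'k^'k\<close>
  is componentwise.
\<close>

definition matrix_exp :: "real^'k^'k \<Rightarrow> real^'k^'k" where
  "matrix_exp A = (\<Sum>n. (1 / fact n) *\<^sub>R ((\<lambda>B. A ** B) ^^ n) (mat 1))"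

end

theory Submission
  imports Defs
begin

text \<open>
  Weighting \<open>\<mu>\<close> with the sum of the two dominating functions gives a finite measure \<open>\<nu>\<close> for which
  \<open>a\<close> and \<open>b\<close> become bounded by \<open>1\<close>. Along each path, \<open>\<Sigma>\<^sub>r\<^sub>,\<^sub>t\<close> is the Picard series solving
  \<open>\<Sigma>\<^sub>r\<^sub>,\<^sub>t = I - \<integral>\<^sub>r\<^sup>t \<Sigma>\<^sub>r\<^sub>,\<^sub>s b(s, X\<^sub>s) \<nu>(ds)\<close>; its group law follows from the product rule for indefinite integrals,
  which holds since \<open>\<nu>\<close> has no atoms. By variation of constants
  \<open>Y\<^sub>t = \<Sigma>\<^sub>t\<^sub>,\<^sub>T g(X\<^sub>T) - \<integral>\<^sub>t\<^sup>T \<Sigma>\<^sub>t\<^sub>,\<^sub>s a(s, X\<^sub>s) \<nu>(ds)\<close> solves \<open>dY = (a + b Y) d\<nu>\<close> pathwise and depends on the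
  future of \<open>t\<close> only, so that the Markov property turns \<open>u(r, x) = E\<^sub>r\<^sub>,\<^sub>x[Y\<^sub>r]\<close> into a bounded global solution.
  Uniqueness among bounded solutions is Gronwall's inequality, and a bounded global solution leaves no room
  for other non-extendible ones.
\<close>

section \<open>Indefinite integrals against a diffuse finite measure\<close>

text \<open>The propagator is wanted in two forms that do not fit together at sight. The group law
  and continuity are immediate for a product of a function of r and a function of t, each driven by
  the whole path, whereas adaptedness to the path on [r,t] and the bound with a single factor sqrt k
  call for one series driven by that stretch of the path. Uniqueness for the linear equation
  identifies the two (\<open>Sig_eq_fund\<close>). Everything is done outcome by outcome: the
  rescaled coefficients are bounded Borel functions along the path of every point of Omega, so no
  exceptional null set spoils properties (i) to (iii). A second obstacle is measurability of u in
  time: Borel sets of [0,T] x S belong to the pseudometric, and the expectation of Y at time r under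
  \<open>P r x\<close> depends on r through the measure and through the integrand. The hypothesis
  \<open>time_borel\<close> is what allows r to be rounded to a grid. Finally, as D is the whole
  space, relative compactness of values means boundedness, which is exactly what the Gronwall
  argument consumes.\<close>

definition bdd_borel :: "(real \<Rightarrow> 'a::real_normed_vector) \<Rightarrow> bool" where
  "bdd_borel f \<longleftrightarrow> f \<in> borel_measurable borel \<and> bounded (range f)"

lemma bdd_borel_measurable [measurable_dest]: "bdd_borel f \<Longrightarrow> f \<in> borel_measurable borel"
  by (simp add: bdd_borel_def)

lemma bdd_borelI: "f \<in> borel_measurable borel \<Longrightarrow> (\<And>s. norm (f s) \<le> K) \<Longrightarrow> bdd_borel f"
  by (auto simp: bdd_borel_def bounded_iff)

lemma bdd_borelE:
  assumes "bdd_borel f"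
  obtains K where "0 \<le> K" "\<And>s. norm (f s) \<le> K"
proof -
  obtain K where K: "\<forall>s. norm (f s) \<le> K"
    using assms unfolding bdd_borel_def bounded_iff by blast
  then have "0 \<le> K"
    by (meson norm_ge_zero order_trans)
  with K that[of K] show thesis
    by simp
qed

lemma bdd_borel_const: "bdd_borel (\<lambda>_. c)"
  by (rule bdd_borelI[where K = "norm c"]) auto

lemma bdd_borel_if:
  fixes f :: "real \<Rightarrow> 'a::real_normed_vector"
  assumes "bdd_borel f" "Measurable.pred borel Q"
  shows "bdd_borel (\<lambda>s. if Q s then f s else 0)"
proof -
  obtain K where "0 \<le> K" "\<And>s. norm (f s) \<le> K"
    using assms(1) by (metis bdd_borelE)
  then show ?thesis
    using assms by (intro bdd_borelI[where K = K]) auto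
qed

lemma bdd_borel_bounded_linear:
  fixes f :: "real \<Rightarrow> 'a::{second_countable_topology, real_normed_vector}"
    and L :: "'a \<Rightarrow> 'b::{second_countable_topology, real_normed_vector}"
  assumes "bounded_linear L" "bdd_borel f"
  shows "bdd_borel (\<lambda>s. L (f s))"
  unfolding bdd_borel_def
proof
  have "continuous_on UNIV L"
    using assms(1) by (rule linear_continuous_on)
  then have "L \<in> borel_measurable borel"
    by (rule borel_measurable_continuous_onI)
  then show "(\<lambda>s. L (f s)) \<in> borel_measurable borel"
    using assms(2) by (auto simp: bdd_borel_def)
  show "bounded (range (\<lambda>s. L (f s)))"
    using bounded_linear_image[OF _ assms(1), of "range f"] assms(2)
    by (simp add: bdd_borel_def image_image)
qed

lemma bdd_borel_minus:
  fixes f :: "real \<Rightarrow> 'a::{second_countable_topology, real_normed_vector}"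
  shows "bdd_borel f \<Longrightarrow> bdd_borel (\<lambda>s. - f s)"
  by (rule bdd_borel_bounded_linear[OF bounded_linear_minus[OF bounded_linear_ident]])

lemma bdd_borel_norm:
  fixes f :: "real \<Rightarrow> 'a::{second_countable_topology, real_normed_vector}"
  shows "bdd_borel f \<Longrightarrow> bdd_borel (\<lambda>s. norm (f s))"
  by (auto simp: bdd_borel_def bounded_iff)

lemma bdd_borel_add:
  fixes f g :: "real \<Rightarrow> 'a::{second_countable_topology, real_normed_vector}"
  assumes "bdd_borel f" "bdd_borel g"
  shows "bdd_borel (\<lambda>s. f s + g s)"
proof -
  obtain K L where "\<And>s. norm (f s) \<le> K" "\<And>s. norm (g s) \<le> L"
    using assms by (metis bdd_borelE)
  then have "norm (f s + g s) \<le> K + L" for s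
    by (meson add_mono norm_triangle_ineq order_trans)
  then show ?thesis
    using assms by (intro bdd_borelI[where K = "K + L"]) auto
qed

lemmas LINT_cong = Bochner_Integration.integral_cong

text \<open>One product rule has to serve real multiplication, matrix products and matrix-vector
  products. Second countability makes products of measurable functions measurable through the pair
  map.\<close>

locale sc_bilinear = bounded_bilinear prod
  for prod :: "'a::{second_countable_topology, banach} \<Rightarrow> 'b::{second_countable_topology, banach}
    \<Rightarrow> 'c::{second_countable_topology, banach}"
begin

lemma borel_measurable_prod:
  assumes "f \<in> borel_measurable N" "g \<in> borel_measurable N"
  shows "(\<lambda>x. prod (f x) (g x)) \<in> borel_measurable N"
  using assms
  by (rule borel_measurable_continuous_Pair)
    (rule continuous_on[OF continuous_on_fst[OF continuous_on_id] continuous_on_snd[OF continuous_on_id]])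

lemma bdd_borel_prod:
  assumes "bdd_borel f" "bdd_borel g"
  shows "bdd_borel (\<lambda>x. prod (f x) (g x))"
proof -
  obtain K where K: "\<And>a b. norm (prod a b) \<le> norm a * norm b * K" "0 \<le> K"
    using nonneg_bounded by blast
  obtain A B where "\<And>s. norm (f s) \<le> A" "\<And>s. norm (g s) \<le> B" "0 \<le> A"
    using assms by (metis bdd_borelE)
  then have "norm (prod (f s) (g s)) \<le> A * B * K" for s
    by (meson K mult_mono mult_right_mono norm_ge_zero order_trans mult_nonneg_nonneg)
  then show ?thesis
    using assms by (intro bdd_borelI[where K = "A * B * K"] borel_measurable_prod) auto
qed

end

text \<open>Absence of atoms enters as null singletons: open and closed ends of an integration
  interval are interchangeable, and the product rule acquires no jump term. The line, rather than
  [0,T], carries the measure, which spares domain conditions.\<close>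

locale diffuse_measure = finite_measure \<nu> for \<nu> :: "real measure" +
  assumes sets_nu [measurable_cong]: "sets \<nu> = sets borel"
    and emeasure_singleton: "\<And>x. emeasure \<nu> {x} = 0"
begin

text \<open>The base point is minus infinity, so no initial time has to be carried along. The cutoff
  sits in the integrand, which keeps it jointly measurable in the variable and the endpoint.\<close>

definition prim :: "(real \<Rightarrow> 'a::{banach, second_countable_topology}) \<Rightarrow> real \<Rightarrow> 'a" where
  "prim f t = (\<integral>s. (if s \<le> t then f s else 0) \<partial>\<nu>)"

lemma space_nu: "space \<nu> = UNIV"
  using sets_eq_imp_space_eq[OF sets_nu] by simp

lemma AE_neq: "AE s in \<nu>. s \<noteq> x"
  by (rule AE_I[where N = "{x}"]) (auto simp: emeasure_singleton sets_nu)

lemma integrable_bdd: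
  fixes f :: "real \<Rightarrow> 'a::{banach, second_countable_topology}"
  assumes "bdd_borel f"
  shows "integrable \<nu> f"
proof -
  obtain K where "\<And>s. norm (f s) \<le> K"
    using assms by (metis bdd_borelE)
  then show ?thesis
    using assms by (intro integrable_const_bound[where B = K]) auto
qed

lemma integrable_prim:
  fixes f :: "real \<Rightarrow> 'a::{banach, second_countable_topology}"
  shows "bdd_borel f \<Longrightarrow> integrable \<nu> (\<lambda>s. if s \<le> t then f s else 0)"
  by (intro integrable_bdd bdd_borel_if) auto

lemma prim_measurable:
  assumes [measurable]: "(\<lambda>(s, \<omega>). \<phi> s \<omega>) \<in> borel_measurable (borel \<Otimes>\<^sub>M N)"
  shows "(\<lambda>(t, \<omega>). prim (\<lambda>s. \<phi> s \<omega>) t) \<in> borel_measurable (borel \<Otimes>\<^sub>M N)"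
  unfolding prim_def by measurable

lemma bdd_borel_prim:
  assumes f: "bdd_borel f"
  shows "bdd_borel (prim f)"
proof (rule bdd_borelI)
  have [measurable]: "f \<in> borel_measurable borel"
    using f by measurable
  show "prim f \<in> borel_measurable borel"
    unfolding prim_def[abs_def] by measurable
  fix t
  have "norm (prim f t) \<le> (\<integral>s. norm (if s \<le> t then f s else 0) \<partial>\<nu>)"
    unfolding prim_def by (rule integral_norm_bound)
  also have "\<dots> \<le> (\<integral>s. norm (f s) \<partial>\<nu>)"
    using f by (intro integral_mono integrable_norm integrable_prim integrable_bdd) auto
  finally show "norm (prim f t) \<le> (\<integral>s. norm (f s) \<partial>\<nu>)" .
qed

lemma prim_strict:
  assumes "bdd_borel f"
  shows "(\<integral>s. (if s < t then f s else 0) \<partial>\<nu>) = prim f t"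
  unfolding prim_def
  using assms AE_neq[of t]
  by (intro integral_cong_AE) (auto intro!: borel_measurable_if bdd_borel_measurable)

text \<open>Dominated convergence: for s different from the limit t, the cutoff
  \<open>s \<le> x n\<close> is eventually the cutoff \<open>s \<le> t\<close>, and the remaining
  point t is null.\<close>

lemma continuous_on_prim:
  assumes f: "bdd_borel f"
  shows "continuous_on A (prim f)"
proof (rule continuous_on_subset[OF _ subset_UNIV], clarsimp simp: continuous_on_sequentially)
  fix x :: "nat \<Rightarrow> real" and t assume x: "x \<longlonglongrightarrow> t"
  have "(\<lambda>n. prim f (x n)) \<longlonglongrightarrow> prim f t"
    unfolding prim_def
  proof (rule integral_dominated_convergence)
    show "integrable \<nu> (\<lambda>s. norm (f s))"
      using f by (intro integrable_norm integrable_bdd)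
    show "AE s in \<nu>. (\<lambda>n. if s \<le> x n then f s else 0) \<longlonglongrightarrow> (if s \<le> t then f s else 0)"
      using AE_neq[of t]
    proof eventually_elim
      fix s assume "s \<noteq> t"
      then consider "s < t" | "t < s" by linarith
      then have "eventually (\<lambda>n. (s \<le> x n) = (s \<le> t)) sequentially"
      proof cases
        case 1
        show ?thesis
          using order_tendstoD(1)[OF x 1] by eventually_elim (use 1 in auto)
      next
        case 2
        show ?thesis
          using order_tendstoD(2)[OF x 2] by eventually_elim (use 2 in auto)
      qed
      then have "eventually (\<lambda>n. (if s \<le> x n then f s else 0) = (if s \<le> t then f s else 0)) sequentially"
        by eventually_elim auto
      then show "(\<lambda>n. if s \<le> x n then f s else 0) \<longlonglongrightarrow> (if s \<le> t then f s else 0)"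
        by (rule tendsto_eventually)
    qed
  qed (use f in \<open>auto intro!: borel_measurable_if bdd_borel_measurable\<close>)
  then show "(prim f \<circ> x) \<longlonglongrightarrow> prim f t"
    by (simp add: o_def)
qed

lemma prim_cong: "(\<And>s. s \<le> t \<Longrightarrow> f s = g s) \<Longrightarrow> prim f t = prim g t"
  unfolding prim_def by (auto intro!: LINT_cong)

lemma prim_add:
  "bdd_borel f \<Longrightarrow> bdd_borel g \<Longrightarrow> prim (\<lambda>s. f s + g s) t = prim f t + prim g t"
  unfolding prim_def
  by (subst Bochner_Integration.integral_add[symmetric])
    (auto intro!: LINT_cong integrable_prim)

lemma prim_bounded_linear:
  assumes "bounded_linear L" "bdd_borel f"
  shows "prim (\<lambda>s. L (f s)) t = L (prim f t)"
proof -
  interpret bounded_linear L by fact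
  show ?thesis
    unfolding prim_def
    by (subst integral_bounded_linear[OF assms(1) integrable_prim[OF assms(2)], symmetric])
      (auto intro!: LINT_cong simp: zero)
qed

lemma prim_minus:
  "prim (\<lambda>s. - f s) t = - prim f t"
  unfolding prim_def
  by (subst integral_minus[symmetric], rule LINT_cong) auto

lemma prim_diff:
  assumes "bdd_borel f" "r \<le> t"
  shows "prim f t - prim f r = (\<integral>s. (if r < s \<and> s \<le> t then f s else 0) \<partial>\<nu>)"
  unfolding prim_def using assms
  by (subst Bochner_Integration.integral_diff[symmetric])
    (auto intro!: LINT_cong integrable_prim)

lemma prim_norm_le:
  assumes "bdd_borel f"
  shows "norm (prim f t) \<le> prim (\<lambda>s. norm (f s)) t"
proof -
  have "norm (prim f t) \<le> (\<integral>s. norm (if s \<le> t then f s else 0) \<partial>\<nu>)"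
    unfolding prim_def by (rule integral_norm_bound)
  also have "\<dots> = prim (\<lambda>s. norm (f s)) t"
    unfolding prim_def by (intro LINT_cong) auto
  finally show ?thesis .
qed

lemma prim_mono:
  fixes f g :: "real \<Rightarrow> real"
  assumes "bdd_borel f" "bdd_borel g" "\<And>s. s \<le> t \<Longrightarrow> f s \<le> g s"
  shows "prim f t \<le> prim g t"
  unfolding prim_def using assms by (intro integral_mono integrable_prim) auto

lemma prim_nonneg:
  fixes f :: "real \<Rightarrow> real"
  assumes "\<And>s. 0 \<le> f s"
  shows "0 \<le> prim f t"
  unfolding prim_def using assms by (intro integral_nonneg_AE) auto

text \<open>Fubini on the triangles below and above the diagonal, which is a null set.\<close>

lemma prim_prod0:
  assumes "sc_bilinear h" and f: "bdd_borel f" and g: "bdd_borel g"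
  shows "h (prim f t) (prim g t) =
    prim (\<lambda>s. h (prim f s) (g s)) t + prim (\<lambda>s. h (f s) (prim g s)) t"
proof -
  interpret h: sc_bilinear h by fact
  interpret P: pair_sigma_finite \<nu> \<nu> ..
  interpret PF: finite_measure "\<nu> \<Otimes>\<^sub>M \<nu>"
    by (rule finite_measure_pair_measure) unfold_locales
  \<comment> \<open>The integrand on the triangle q < p \<le> t. Integrating over p first produces
    the increment of \<open>prim f\<close> from q to t, integrating over q first produces
    \<open>prim g p\<close>.\<close>
  let ?k = "\<lambda>q p. if q < p \<and> p \<le> t then h (f p) (g q) else 0"
  have [measurable]: "f \<in> borel_measurable borel" "g \<in> borel_measurable borel"
    using f g by measurable
  obtain A B where AB: "\<And>s. norm (f s) \<le> A" "\<And>s. norm (g s) \<le> B" "0 \<le> A" "0 \<le> B"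
    using f g by (metis bdd_borelE)
  obtain K where K: "\<And>a b. norm (h a b) \<le> norm a * norm b * K" "0 \<le> K"
    using h.nonneg_bounded by blast
  have bd: "norm (h (f p) (g q)) \<le> A * B * K" for p q
    by (meson K AB mult_mono mult_right_mono norm_ge_zero order_trans mult_nonneg_nonneg)
  have [measurable]: "(\<lambda>x. h (f (snd x)) (g (fst x))) \<in> borel_measurable (borel \<Otimes>\<^sub>M borel)"
    by (intro h.borel_measurable_prod) measurable
  have int: "integrable (\<nu> \<Otimes>\<^sub>M \<nu>) (\<lambda>(q, p). ?k q p)"
  proof (rule PF.integrable_const_bound[where B = "A * B * K"])
    show "AE x in \<nu> \<Otimes>\<^sub>M \<nu>. norm (case x of (q, p) \<Rightarrow> ?k q p) \<le> A * B * K"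
      using bd AB K by auto
    have "(\<lambda>x. if fst x < snd x \<and> snd x \<le> t then h (f (snd x)) (g (fst x)) else 0)
      \<in> borel_measurable (borel \<Otimes>\<^sub>M borel)"
      by measurable
    then show "(\<lambda>(q, p). ?k q p) \<in> borel_measurable (\<nu> \<Otimes>\<^sub>M \<nu>)"
      by (simp add: case_prod_beta' measurable_cong_sets[OF sets_pair_measure_cong[OF sets_nu sets_nu] refl])
  qed
  have swap: "(\<integral>q. (\<integral>p. ?k q p \<partial>\<nu>) \<partial>\<nu>) = (\<integral>p. (\<integral>q. ?k q p \<partial>\<nu>) \<partial>\<nu>)"
    using P.Fubini_integral[of "\<lambda>q p. ?k q p"] int by simp
  have inner1: "(\<integral>p. ?k q p \<partial>\<nu>) = (if q \<le> t then h (prim f t - prim f q) (g q) else 0)" for q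
  proof (cases "q \<le> t")
    case True
    have "h (prim f t - prim f q) (g q) = (\<integral>p. h (if q < p \<and> p \<le> t then f p else 0) (g q) \<partial>\<nu>)"
      unfolding prim_diff[OF f True]
      by (rule integral_bounded_linear[OF h.bounded_linear_left, symmetric])
        (intro integrable_bdd bdd_borel_if f, measurable)
    also have "\<dots> = (\<integral>p. ?k q p \<partial>\<nu>)"
      by (intro LINT_cong) (auto simp: h.zero_left)
    finally show ?thesis using True by simp
  next
    case False
    then have "?k q p = 0" for p by auto
    then show ?thesis using False by simp
  qed
  have inner2: "(\<integral>q. ?k q p \<partial>\<nu>) = (if p \<le> t then h (f p) (prim g p) else 0)" for p
  proof -
    have "h (f p) (prim g p) = (\<integral>q. h (f p) (if q < p then g q else 0) \<partial>\<nu>)"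
      unfolding prim_strict[OF g, symmetric]
      by (rule integral_bounded_linear[OF h.bounded_linear_right, symmetric])
        (intro integrable_bdd bdd_borel_if g, measurable)
    also have "\<dots> = (\<integral>q. (if q < p then h (f p) (g q) else 0) \<partial>\<nu>)"
      by (intro LINT_cong) (auto simp: h.zero_right)
    finally show ?thesis by (auto intro!: LINT_cong)
  qed
  have bF: "bdd_borel (\<lambda>s. h (prim f s) (g s))" "bdd_borel (\<lambda>s. h (prim f t - prim f s) (g s))"
    using bdd_borel_add[OF bdd_borel_const bdd_borel_minus[OF bdd_borel_prim[OF f]], of "prim f t"]
    by (auto intro!: h.bdd_borel_prod bdd_borel_prim f g)
  have "h (prim f t) (prim g t) = prim (\<lambda>s. h (prim f t) (g s)) t"
    using prim_bounded_linear[OF h.bounded_linear_right g] by simp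
  \<comment> \<open>Splitting \<open>prim f t\<close> into its part up to s and its increment after
    s isolates the term that Fubini turns into the second summand.\<close>
  also have "\<dots> = prim (\<lambda>s. h (prim f s) (g s) + h (prim f t - prim f s) (g s)) t"
    by (intro prim_cong) (simp add: h.diff_left)
  also have "\<dots> = prim (\<lambda>s. h (prim f s) (g s)) t + prim (\<lambda>s. h (prim f t - prim f s) (g s)) t"
    by (rule prim_add[OF bF])
  also have "prim (\<lambda>s. h (prim f t - prim f s) (g s)) t = (\<integral>q. (\<integral>p. ?k q p \<partial>\<nu>) \<partial>\<nu>)"
    unfolding inner1 by (simp only: prim_def[where f = "\<lambda>s. h (prim f t - prim f s) (g s)"])
  also have "\<dots> = prim (\<lambda>s. h (f s) (prim g s)) t"
    unfolding swap inner2 by (simp only: prim_def[where f = "\<lambda>s. h (f s) (prim g s)"])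
  finally show ?thesis .
qed

section \<open>Differential calculus for indefinite integrals\<close>

definition primitive :: "(real \<Rightarrow> 'a::{banach, second_countable_topology}) \<Rightarrow> (real \<Rightarrow> 'a) \<Rightarrow> 'a \<Rightarrow> bool" where
  "primitive F f c \<longleftrightarrow> bdd_borel f \<and> (\<forall>t. F t = c + prim f t)"

lemma primitiveD:
  assumes "primitive F f c"
  shows "bdd_borel f" "F t = c + prim f t"
  using assms unfolding primitive_def by blast+

lemma primitive_diff: "primitive F f c \<Longrightarrow> F t - F r = prim f t - prim f r"
  using primitiveD(2)[of F f c t] primitiveD(2)[of F f c r] by simp

lemma primitive_bdd: "primitive F f c \<Longrightarrow> bdd_borel F"
proof -
  assume "primitive F f c"
  then have "F = (\<lambda>t. c + prim f t)" "bdd_borel f"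
    by (auto simp: primitive_def)
  then show ?thesis
    by (auto intro!: bdd_borel_add bdd_borel_const bdd_borel_prim)
qed

lemma primitive_continuous: "primitive F f c \<Longrightarrow> continuous_on A F"
proof -
  assume "primitive F f c"
  then have "F = (\<lambda>t. c + prim f t)" "bdd_borel f"
    by (auto simp: primitive_def)
  then show ?thesis
    by (auto intro!: continuous_intros continuous_on_prim)
qed

text \<open>Reading \<open>primitive F f c\<close> as dF = f d\<nu> with value c at minus infinity,
  this is the Leibniz rule. Expanding both factors around c and e leaves linear terms and a product
  of two pure indefinite integrals, which is \<open>prim_prod0\<close>.\<close>

lemma primitive_prod:
  assumes "sc_bilinear h" and F: "primitive F f c" and G: "primitive G g e"
  shows "primitive (\<lambda>t. h (F t) (G t)) (\<lambda>s. h (F s) (g s) + h (f s) (G s)) (h c e)"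
proof -
  interpret h: sc_bilinear h by fact
  have f: "bdd_borel f" and F': "\<And>t. F t = c + prim f t"
    and g: "bdd_borel g" and G': "\<And>t. G t = e + prim g t"
    using F G by (auto simp: primitive_def)
  note bdd = h.bdd_borel_prod[OF primitive_bdd[OF F] g] h.bdd_borel_prod[OF f primitive_bdd[OF G]]
  have "h (F t) (G t) = h c e + prim (\<lambda>s. h (F s) (g s) + h (f s) (G s)) t" for t
  proof -
    have "prim (\<lambda>s. h (F s) (g s)) t = prim (\<lambda>s. h c (g s) + h (prim f s) (g s)) t"
      unfolding F' by (simp add: h.add_left)
    also have "\<dots> = h c (prim g t) + prim (\<lambda>s. h (prim f s) (g s)) t"
      by (subst prim_add)
        (auto intro!: h.bdd_borel_prod bdd_borel_const bdd_borel_prim f g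
          prim_bounded_linear[OF h.bounded_linear_right])
    finally have 1: "prim (\<lambda>s. h (F s) (g s)) t = h c (prim g t) + prim (\<lambda>s. h (prim f s) (g s)) t" .
    have "prim (\<lambda>s. h (f s) (G s)) t = prim (\<lambda>s. h (f s) e + h (f s) (prim g s)) t"
      unfolding G' by (simp add: h.add_right)
    also have "\<dots> = h (prim f t) e + prim (\<lambda>s. h (f s) (prim g s)) t"
      by (subst prim_add)
        (auto intro!: h.bdd_borel_prod bdd_borel_const bdd_borel_prim f g
          prim_bounded_linear[OF h.bounded_linear_left])
    finally show ?thesis
      using 1 prim_prod0[OF assms(1) f g, of t]
      unfolding prim_add[OF bdd] unfolding F' G' by (simp add: h.add_left h.add_right)
  qed
  then show ?thesis
    by (simp add: primitive_def bdd bdd_borel_add)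
qed

text \<open>Without jump corrections, integrating F^n dF gives exactly F^(n+1)/(n+1); the factorials
  in the Picard and Gronwall bounds come from here.\<close>

lemma primitive_power:
  fixes F f :: "real \<Rightarrow> real"
  assumes F: "primitive F f c"
  shows "primitive (\<lambda>t. F t ^ Suc n) (\<lambda>s. real (Suc n) * (F s ^ n * f s)) (c ^ Suc n)"
proof (induction n)
  case 0
  then show ?case using F by simp
next
  case (Suc n)
  interpret sc_bilinear "(*) :: real \<Rightarrow> _"
    by (simp add: sc_bilinear_def bounded_bilinear_mult)
  have "primitive (\<lambda>t. F t * F t ^ Suc n)
     (\<lambda>s. F s * (real (Suc n) * (F s ^ n * f s)) + f s * F s ^ Suc n) (c * c ^ Suc n)"
    by (rule primitive_prod[OF sc_bilinear_axioms F Suc])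
  then show ?case
    by (simp add: algebra_simps)
qed

end

section \<open>Linear matrix equations\<close>

lemma norm_vec_square: "(norm x)\<^sup>2 = (\<Sum>i\<in>UNIV. (norm (x $ i))\<^sup>2)" for x :: "'a::real_normed_vector ^ 'n"
  by (simp add: norm_vec_def L2_set_def sum_nonneg)

text \<open>Cauchy-Schwarz in each row, then summation over the rows.\<close>

lemma norm_matrix_vector_mult_le: "norm (A *v x) \<le> norm A * norm x" for A :: "real^'n^'m"
proof (rule power2_le_imp_le)
  have "(norm (A *v x))\<^sup>2 = (\<Sum>i\<in>UNIV. (A $ i \<bullet> x)\<^sup>2)"
    by (simp add: norm_vec_square[of "A *v x"] matrix_vector_mul_component)
  also have "\<dots> \<le> (\<Sum>i\<in>UNIV. (norm (A $ i))\<^sup>2 * (norm x)\<^sup>2)"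
    by (intro sum_mono) (metis Cauchy_Schwarz_ineq power2_norm_eq_inner)
  also have "\<dots> = (norm A * norm x)\<^sup>2"
    by (simp add: norm_vec_square[of A] power_mult_distrib sum_distrib_right)
  finally show "(norm (A *v x))\<^sup>2 \<le> (norm A * norm x)\<^sup>2" .
qed auto

lemma norm_transpose: "norm (transpose A) = norm A" for A :: "real^'n^'m"
proof -
  have "(norm (transpose A))\<^sup>2 = (norm A)\<^sup>2"
    unfolding norm_vec_square[of A] norm_vec_square[of "transpose A"]
      norm_vec_square[of "A $ _"] norm_vec_square[of "transpose A $ _"]
    by (simp add: transpose_def) (rule sum.swap)
  then show ?thesis
    by (simp add: power2_eq_iff_nonneg)
qed

text \<open>The rows of the product are \<open>transpose B\<close> applied to the rows of A, so the
  matrix-vector bound applies row by row.\<close>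

lemma norm_matrix_mult_le: "norm (A ** B) \<le> norm A * norm B"
  for A :: "real^'n^'m" and B :: "real^'p^'n"
proof (rule power2_le_imp_le)
  have "(norm (A ** B))\<^sup>2 = (\<Sum>i\<in>UNIV. (norm (transpose B *v (A $ i)))\<^sup>2)"
    unfolding norm_vec_square[of "A ** B"]
    by (intro sum.cong refl arg_cong[where f = "\<lambda>v. (norm v)\<^sup>2"])
      (simp add: vec_eq_iff matrix_matrix_mult_def vector_matrix_mult_def mult.commute)
  also have "\<dots> \<le> (\<Sum>i\<in>UNIV. (norm B * norm (A $ i))\<^sup>2)"
    by (intro sum_mono power_mono order_trans[OF norm_matrix_vector_mult_le])
      (simp_all add: norm_transpose del: transpose_matrix_vector)
  also have "\<dots> = (norm A * norm B)\<^sup>2"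
    by (simp add: norm_vec_square[of A] power_mult_distrib sum_distrib_left mult.commute)
  finally show "(norm (A ** B))\<^sup>2 \<le> (norm A * norm B)\<^sup>2" .
qed auto

text \<open>The Frobenius norm of the identity is the origin of the factor sqrt k in the bound on
  the propagator.\<close>

lemma norm_mat_1: "norm (mat 1 :: real^'k^'k) = sqrt (real CARD('k))"
proof -
  have "(norm (mat 1 :: real^'k^'k))\<^sup>2 = (\<Sum>i::'k\<in>UNIV. \<Sum>j\<in>UNIV. if i = j then 1 else 0)"
    unfolding norm_vec_square[of "mat 1 :: real^'k^'k"] norm_vec_square[of "mat 1 $ _"]
    by (intro sum.cong refl) (simp add: mat_def)
  also have "\<dots> = real CARD('k)"
    by simp
  finally show ?thesis
    by (metis norm_ge_zero real_sqrt_unique)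
qed

lemma bounded_bilinear_matrix_mult: "bounded_bilinear ((**) :: real^'n^'m \<Rightarrow> real^'p^'n \<Rightarrow> real^'p^'m)"
proof
  show "\<exists>K. \<forall>A B. norm ((A :: real^'n^'m) ** (B :: real^'p^'n)) \<le> norm A * norm B * K"
    using norm_matrix_mult_le by (intro exI[of _ 1]) auto
qed (auto simp: matrix_matrix_mult_def vec_eq_iff sum_distrib_left algebra_simps sum.distrib)

lemma bounded_bilinear_matrix_vector_mult: "bounded_bilinear ((*v) :: real^'n^'m \<Rightarrow> real^'n \<Rightarrow> real^'m)"
proof
  show "\<exists>K. \<forall>A x. norm ((A :: real^'n^'m) *v x) \<le> norm A * norm x * K"
    using norm_matrix_vector_mult_le by (intro exI[of _ 1]) auto
qed (auto simp: algebra_simps scaleR_matrix_vector_assoc)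

interpretation mmul: sc_bilinear "(**) :: real^'n^'m \<Rightarrow> real^'p^'n \<Rightarrow> real^'p^'m"
  by (simp add: sc_bilinear_def bounded_bilinear_matrix_mult)

interpretation mvmul: sc_bilinear "(*v) :: real^'n^'m \<Rightarrow> real^'n \<Rightarrow> real^'m"
  by (simp add: sc_bilinear_def bounded_bilinear_matrix_vector_mult)

declare mmul.borel_measurable_prod [measurable (raw)] mvmul.borel_measurable_prod [measurable (raw)]

lemma bounded_linear_transpose: "bounded_linear (transpose :: real^'n^'m \<Rightarrow> real^'m^'n)"
  by (rule bounded_linear_intro[where K = 1])
    (auto simp: norm_transpose transpose_scalar, simp add: transpose_def vec_eq_iff)

lemma borel_measurable_transpose [measurable (raw)]:
  fixes f :: "'z \<Rightarrow> real^'n^'m"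
  shows "f \<in> borel_measurable N \<Longrightarrow> (\<lambda>x. transpose (f x)) \<in> borel_measurable N"
  by (rule measurable_compose[OF _ borel_measurable_continuous_onI])
    (auto intro: linear_continuous_on bounded_linear_transpose)

text \<open>Iterated left multiplication, exactly as in the terms of \<open>matrix_exp\<close>, so
  that the commuting case can be compared with the exponential term by term.\<close>

definition mpow :: "real^'k^'k \<Rightarrow> nat \<Rightarrow> real^'k^'k" where
  "mpow A n = ((\<lambda>B. A ** B) ^^ n) (mat 1)"

lemma mpow_0: "mpow A 0 = mat 1"
  and mpow_Suc: "mpow A (Suc n) = A ** mpow A n"
  by (simp_all add: mpow_def)

section \<open>The fundamental matrix as a Picard series\<close>

context diffuse_measure
begin

text \<open>The n-th term is (-1)^n times the time-ordered integral of \<beta>(s1) ... \<beta>(sn)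
  over s1 \<le> ... \<le> sn \<le> t: each new factor belongs to a later time and multiplies from
  the right.\<close>

primrec picard :: "(real \<Rightarrow> real^'k^'k) \<Rightarrow> nat \<Rightarrow> real \<Rightarrow> real^'k^'k" where
  "picard \<beta> 0 = (\<lambda>t. mat 1)"
| "picard \<beta> (Suc n) = (\<lambda>t. - prim (\<lambda>s. picard \<beta> n s ** \<beta> s) t)"

definition fund :: "(real \<Rightarrow> real^'k^'k) \<Rightarrow> real \<Rightarrow> real^'k^'k" where
  "fund \<beta> t = (\<Sum>n. picard \<beta> n t)"

lemma bdd_borel_picard: "bdd_borel \<beta> \<Longrightarrow> bdd_borel (picard \<beta> n)"
  by (induction n)
    (auto intro!: bdd_borel_const bdd_borel_minus bdd_borel_prim mmul.bdd_borel_prod)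

text \<open>With c(t) the integral of |\<beta>| up to t, the recursion integrates c^n/n! against dc,
  which is c^(n+1)/(n+1)! because c has no jumps; \<open>norm_mat_1\<close> supplies the leading
  factor.\<close>

lemma norm_picard_le:
  fixes \<beta> :: "real \<Rightarrow> real^'k^'k"
  assumes \<beta>: "bdd_borel \<beta>"
  shows "norm (picard \<beta> n t) \<le> sqrt (real CARD('k)) * (prim (\<lambda>s. norm (\<beta> s)) t ^ n / fact n)"
proof (induction n arbitrary: t)
  case 0
  then show ?case by (simp add: norm_mat_1)
next
  case (Suc n)
  let ?c = "prim (\<lambda>s. norm (\<beta> s))" and ?k = "sqrt (real CARD('k))"
  have b: "bdd_borel (\<lambda>s. norm (\<beta> s))"
    by (rule bdd_borel_norm[OF \<beta>])
  have c: "primitive ?c (\<lambda>s. norm (\<beta> s)) 0"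
    using b by (simp add: primitive_def)
  have i: "bdd_borel (\<lambda>s. real (Suc n) * (?c s ^ n * norm (\<beta> s)))"
    using primitive_power[OF c, of n] by (auto simp: primitive_def)
  have "norm (picard \<beta> (Suc n) t) \<le> prim (\<lambda>s. norm (picard \<beta> n s ** \<beta> s)) t"
    using prim_norm_le[OF mmul.bdd_borel_prod[OF bdd_borel_picard[OF \<beta>] \<beta>]] by simp
  \<comment> \<open>The constant is written over (n+1)! so that what remains is literally the
    density of c^(n+1) given by \<open>primitive_power\<close>.\<close>
  also have "\<dots> \<le> prim (\<lambda>s. ?k / fact (Suc n) * (real (Suc n) * (?c s ^ n * norm (\<beta> s)))) t"
  proof (rule prim_mono)
    show "bdd_borel (\<lambda>s. norm (picard \<beta> n s ** \<beta> s))"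
      by (intro bdd_borel_norm mmul.bdd_borel_prod bdd_borel_picard \<beta>)
    show "bdd_borel (\<lambda>s. ?k / fact (Suc n) * (real (Suc n) * (?c s ^ n * norm (\<beta> s))))"
      by (rule bdd_borel_bounded_linear[OF bounded_linear_mult_right i])
    fix s
    have "norm (picard \<beta> n s ** \<beta> s) \<le> norm (picard \<beta> n s) * norm (\<beta> s)"
      by (rule norm_matrix_mult_le)
    also have "\<dots> \<le> ?k * (?c s ^ n / fact n) * norm (\<beta> s)"
      by (intro mult_right_mono Suc) auto
    also have "\<dots> = ?k / fact (Suc n) * (real (Suc n) * (?c s ^ n * norm (\<beta> s)))"
      by (simp add: divide_simps del: of_nat_Suc)
    finally show "norm (picard \<beta> n s ** \<beta> s) \<le> \<dots>" .
  qed
  also have "\<dots> = ?k / fact (Suc n) * prim (\<lambda>s. real (Suc n) * (?c s ^ n * norm (\<beta> s))) t"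
    by (rule prim_bounded_linear[OF bounded_linear_mult_right i])
  also have "\<dots> = ?k * (?c t ^ Suc n / fact (Suc n))"
    using primitive_power[OF c, of n] by (simp add: primitive_def)
  finally show ?case .
qed

lemma exp_series_sums: "(\<lambda>n. k * (c ^ n / fact n)) sums (k * exp c)" for c k :: real
  using sums_mult[OF exp_converges[of c], of k] by (simp add: divide_inverse mult.commute)

lemma summable_norm_picard:
  fixes \<beta> :: "real \<Rightarrow> real^'k^'k"
  assumes "bdd_borel \<beta>"
  shows "summable (\<lambda>n. norm (picard \<beta> n t))"
proof (rule summable_comparison_test'[where N = 0])
  show "summable (\<lambda>n. sqrt (real CARD('k)) * (prim (\<lambda>s. norm (\<beta> s)) t ^ n / fact n))"
    by (rule sums_summable[OF exp_series_sums])
qed (simp only: real_norm_def abs_norm_cancel norm_picard_le[OF assms])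

lemma norm_fund_le:
  fixes \<beta> :: "real \<Rightarrow> real^'k^'k"
  assumes \<beta>: "bdd_borel \<beta>"
  shows "norm (fund \<beta> t) \<le> sqrt (real CARD('k)) * exp (prim (\<lambda>s. norm (\<beta> s)) t)"
proof -
  have "norm (fund \<beta> t) \<le> (\<Sum>n. norm (picard \<beta> n t))"
    unfolding fund_def by (rule summable_norm[OF summable_norm_picard[OF \<beta>]])
  also have "\<dots> \<le> (\<Sum>n. sqrt (real CARD('k)) * (prim (\<lambda>s. norm (\<beta> s)) t ^ n / fact n))"
    by (intro suminf_le norm_picard_le summable_norm_picard sums_summable[OF exp_series_sums] \<beta>)
  also have "\<dots> = sqrt (real CARD('k)) * exp (prim (\<lambda>s. norm (\<beta> s)) t)"
    by (rule sums_unique[OF exp_series_sums, symmetric])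
  finally show ?thesis .
qed

lemma picard_measurable:
  fixes \<beta> :: "'w \<Rightarrow> real \<Rightarrow> real^'k^'k"
  assumes [measurable]: "(\<lambda>(s, \<omega>). \<beta> \<omega> s) \<in> borel_measurable (borel \<Otimes>\<^sub>M N)"
  shows "(\<lambda>(t, \<omega>). picard (\<beta> \<omega>) n t) \<in> borel_measurable (borel \<Otimes>\<^sub>M N)"
proof (induction n)
  case (Suc n)
  note [measurable] = Suc
  have "(\<lambda>(t, \<omega>). prim (\<lambda>s. picard (\<beta> \<omega>) n s ** \<beta> \<omega> s) t) \<in> borel_measurable (borel \<Otimes>\<^sub>M N)"
    by (rule prim_measurable) measurable
  then show ?case
    by (simp add: case_prod_beta')
qed simp

text \<open>The explicit series is a limit of iterates that are jointly measurable in time and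
  parameter. The parameter space N will be a \<sigma>-field generated by a stretch of the
  path.\<close>

lemma fund_measurable:
  fixes \<beta> :: "'w \<Rightarrow> real \<Rightarrow> real^'k^'k"
  assumes "(\<lambda>(s, \<omega>). \<beta> \<omega> s) \<in> borel_measurable (borel \<Otimes>\<^sub>M N)"
  shows "(\<lambda>(t, \<omega>). fund (\<beta> \<omega>) t) \<in> borel_measurable (borel \<Otimes>\<^sub>M N)"
proof -
  note [measurable] = picard_measurable[OF assms]
  show ?thesis
    unfolding fund_def suminf_eq_lim by measurable
qed

text \<open>A bound that sees the coefficient only through its supremum, hence one that is common to
  all paths.\<close>

lemma norm_fund_le_uniform:
  fixes \<beta> :: "real \<Rightarrow> real^'k^'k"
  assumes \<beta>: "bdd_borel \<beta>" and B: "\<And>s. norm (\<beta> s) \<le> B"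
  shows "norm (fund \<beta> t) \<le> sqrt (real CARD('k)) * exp (B * measure \<nu> UNIV)"
proof -
  have "0 \<le> B"
    using B[of 0] norm_ge_zero order_trans by blast
  have "prim (\<lambda>s. norm (\<beta> s)) t \<le> (\<integral>s. B \<partial>\<nu>)"
    unfolding prim_def using B \<open>0 \<le> B\<close>
    by (intro integral_mono integrable_prim bdd_borel_norm \<beta>) auto
  then have "prim (\<lambda>s. norm (\<beta> s)) t \<le> B * measure \<nu> UNIV"
    by (simp add: space_nu mult.commute)
  then show ?thesis
    by (intro order_trans[OF norm_fund_le[OF \<beta>]] mult_left_mono) auto
qed

text \<open>The Picard recursion is summed term by term: the exponential bounds are summable
  uniformly in s, which justifies exchanging sum and integral.\<close>

lemma
  fixes \<beta> :: "real \<Rightarrow> real^'k^'k"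
  assumes \<beta>: "bdd_borel \<beta>"
  shows bdd_borel_fund: "bdd_borel (fund \<beta>)" and fund_eq: "fund \<beta> t = mat 1 - prim (\<lambda>s. fund \<beta> s ** \<beta> s) t"
proof -
  let ?k = "sqrt (real CARD('k))" and ?c = "prim (\<lambda>s. norm (\<beta> s))"
  obtain B where B: "0 \<le> B" "\<And>s. norm (\<beta> s) \<le> B"
    using \<beta> by (metis bdd_borelE)
  have [measurable]: "picard \<beta> n \<in> borel_measurable borel" for n
    by (rule bdd_borel_measurable[OF bdd_borel_picard[OF \<beta>]])
  have "fund \<beta> \<in> borel_measurable borel"
    unfolding fund_def[abs_def] suminf_eq_lim by measurable
  then show bZ: "bdd_borel (fund \<beta>)"
    using norm_fund_le_uniform[OF \<beta> B(2)] by (rule bdd_borelI)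
  \<comment> \<open>C bounds the cumulative norm at all times, so that the terms are dominated by
    multiples of C^n/n! that do not depend on s.\<close>
  obtain C where C: "0 \<le> C" "\<And>s. norm (?c s) \<le> C"
    using bdd_borel_prim[OF bdd_borel_norm[OF \<beta>]] by (metis bdd_borelE)
  have cC: "?c s \<le> C" for s
    using C(2)[of s] by simp
  let ?f = "\<lambda>n s. if s \<le> t then picard \<beta> n s ** \<beta> s else 0"
  have le: "norm (?f n s) \<le> (?k * B) * (C ^ n / fact n)" for n s
  proof (cases "s \<le> t")
    case True
    have "norm (picard \<beta> n s ** \<beta> s) \<le> norm (picard \<beta> n s) * norm (\<beta> s)"
      by (rule norm_matrix_mult_le)
    also have "\<dots> \<le> (?k * (?c s ^ n / fact n)) * B"
      using B by (intro mult_mono norm_picard_le \<beta>) (auto intro!: prim_nonneg divide_nonneg_nonneg mult_nonneg_nonneg zero_le_power)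
    also have "\<dots> \<le> (?k * (C ^ n / fact n)) * B"
      using B cC by (intro mult_right_mono mult_left_mono divide_right_mono power_mono)
        (auto intro!: prim_nonneg)
    finally show ?thesis using True by (simp add: mult_ac)
  qed (use B C in auto)
  have int: "integrable \<nu> (?f n)" for n
    by (intro integrable_prim mmul.bdd_borel_prod bdd_borel_picard \<beta>)
  have sm: "(\<lambda>n. - (\<integral>s. ?f n s \<partial>\<nu>)) sums - (\<integral>s. (\<Sum>n. ?f n s) \<partial>\<nu>)"
  proof (intro sums_minus sums_integral int)
    show "AE s in \<nu>. summable (\<lambda>n. norm (?f n s))"
      by (intro always_eventually allI summable_comparison_test'[where N = 0,
            OF sums_summable[OF exp_series_sums[of "?k * B" C]]])
        (simp only: real_norm_def abs_norm_cancel le)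
    have "norm (\<integral>s. norm (?f n s) \<partial>\<nu>) \<le> (?k * B * measure \<nu> UNIV) * (C ^ n / fact n)" for n
    proof -
      have "(\<integral>s. norm (?f n s) \<partial>\<nu>) \<le> (\<integral>s. (?k * B) * (C ^ n / fact n) \<partial>\<nu>)"
        by (intro integral_mono integrable_norm int le) auto
      then show ?thesis
        by (simp add: space_nu mult_ac integral_nonneg_AE)
    qed
    then show "summable (\<lambda>n. \<integral>s. norm (?f n s) \<partial>\<nu>)"
      by (intro summable_comparison_test'[where N = 0, OF sums_summable[OF exp_series_sums]]) auto
  qed
  have "(\<Sum>n. ?f n s) = (if s \<le> t then fund \<beta> s ** \<beta> s else 0)" for s
    using bounded_linear.suminf[OF mmul.bounded_linear_left summable_norm_cancel[OF summable_norm_picard[OF \<beta>]], of s "\<beta> s"]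
    by (simp add: fund_def)
  then have "(\<integral>s. (\<Sum>n. ?f n s) \<partial>\<nu>) = prim (\<lambda>s. fund \<beta> s ** \<beta> s) t"
    by (simp add: prim_def)
  then have "(\<lambda>n. picard \<beta> (Suc n) t) sums - prim (\<lambda>s. fund \<beta> s ** \<beta> s) t"
    using sm by (simp add: prim_def)
  \<comment> \<open>The integrated series starts at index 1; the missing term of index 0 is the
    identity matrix.\<close>
  then have "(\<lambda>n. picard \<beta> n t) sums (- prim (\<lambda>s. fund \<beta> s ** \<beta> s) t + picard \<beta> 0 t)"
    by (rule sums_Suc)
  then show "fund \<beta> t = mat 1 - prim (\<lambda>s. fund \<beta> s ** \<beta> s) t"
    by (simp add: fund_def sums_iff)
qed

section \<open>The linear equation: inverse and uniqueness\<close>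

lemma primitive_fund:
  fixes \<beta> :: "real \<Rightarrow> real^'k^'k"
  assumes \<beta>: "bdd_borel \<beta>"
  shows "primitive (fund \<beta>) (\<lambda>s. - (fund \<beta> s ** \<beta> s)) (mat 1)"
  unfolding primitive_def prim_minus
  by (intro conjI allI bdd_borel_minus mmul.bdd_borel_prod bdd_borel_fund \<beta> trans[OF fund_eq[OF \<beta>]]) simp

text \<open>If Z solves dZ = \<beta> Z d\<nu>, its transpose solves the equation of
  \<open>fund\<close> with the coefficient -transpose \<beta>. This gives a candidate for the
  inverse without a second Picard construction.\<close>

definition fund_inv :: "(real \<Rightarrow> real^'k^'k) \<Rightarrow> real \<Rightarrow> real^'k^'k" where
  "fund_inv \<beta> t = transpose (fund (\<lambda>s. - transpose (\<beta> s)) t)"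

lemma primitive_fund_inv:
  fixes \<beta> :: "real \<Rightarrow> real^'k^'k"
  assumes \<beta>: "bdd_borel \<beta>"
  shows "primitive (fund_inv \<beta>) (\<lambda>s. \<beta> s ** fund_inv \<beta> s) (mat 1)"
proof -
  let ?b = "\<lambda>s. - transpose (\<beta> s)"
  have b: "bdd_borel ?b"
    by (intro bdd_borel_minus bdd_borel_bounded_linear[OF bounded_linear_transpose] \<beta>)
  have p: "primitive (fund ?b) (\<lambda>s. - (fund ?b s ** ?b s)) (mat 1)"
    by (rule primitive_fund[OF b])
  have eq: "\<beta> s ** fund_inv \<beta> s = transpose (- (fund ?b s ** ?b s))" for s
    by (simp add: fund_inv_def matrix_transpose_mul mmul.minus_right)
  interpret tr: bounded_linear "transpose :: real^'k^'k \<Rightarrow> _" by (rule bounded_linear_transpose)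
  show ?thesis
    unfolding primitive_def eq
  proof (intro conjI allI)
    have f: "bdd_borel (\<lambda>s. - (fund ?b s ** ?b s))"
      and fund: "fund ?b t = mat 1 + prim (\<lambda>s. - (fund ?b s ** ?b s)) t" for t
      using primitiveD[OF p] by blast+
    show "bdd_borel (\<lambda>s. transpose (- (fund ?b s ** ?b s)))"
      by (rule bdd_borel_bounded_linear[OF bounded_linear_transpose f])
    show "fund_inv \<beta> t = mat 1 + prim (\<lambda>s. transpose (- (fund ?b s ** ?b s))) t" for t
      unfolding fund_inv_def prim_bounded_linear[OF bounded_linear_transpose f]
      using arg_cong[OF fund[of t], of transpose] by (simp only: tr.add transpose_mat)
  qed
qed

lemma norm_fund_inv_le_uniform:
  fixes \<beta> :: "real \<Rightarrow> real^'k^'k"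
  assumes \<beta>: "bdd_borel \<beta>" and B: "\<And>s. norm (\<beta> s) \<le> B"
  shows "norm (fund_inv \<beta> t) \<le> sqrt (real CARD('k)) * exp (B * measure \<nu> UNIV)"
  unfolding fund_inv_def norm_transpose
  by (rule norm_fund_le_uniform)
    (auto simp: norm_transpose B intro!: bdd_borel_minus bdd_borel_bounded_linear[OF bounded_linear_transpose] \<beta>)

lemma fund_inv_measurable:
  fixes \<beta> :: "'w \<Rightarrow> real \<Rightarrow> real^'k^'k"
  assumes [measurable]: "(\<lambda>(s, \<omega>). \<beta> \<omega> s) \<in> borel_measurable (borel \<Otimes>\<^sub>M N)"
  shows "(\<lambda>(t, \<omega>). fund_inv (\<beta> \<omega>) t) \<in> borel_measurable (borel \<Otimes>\<^sub>M N)"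
proof -
  have [measurable]: "(\<lambda>(t, \<omega>). fund (\<lambda>s. - transpose (\<beta> \<omega> s)) t) \<in> borel_measurable (borel \<Otimes>\<^sub>M N)"
    by (rule fund_measurable) measurable
  show ?thesis
    unfolding fund_inv_def by measurable
qed

text \<open>The two terms of the product rule, Y \<beta> Z and -Y \<beta> Z, cancel. Taking Y =
  \<open>fund \<beta>\<close> gives the inverse, an arbitrary Y gives uniqueness.\<close>

lemma mult_fund_inv_const:
  assumes \<beta>: "bdd_borel \<beta>" and Y: "primitive Y (\<lambda>s. - (Y s ** \<beta> s)) c"
  shows "Y t ** fund_inv \<beta> t = c"
proof -
  have "primitive (\<lambda>t. Y t ** fund_inv \<beta> t)
    (\<lambda>s. Y s ** (\<beta> s ** fund_inv \<beta> s) + - (Y s ** \<beta> s) ** fund_inv \<beta> s) (c ** mat 1)"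
    by (rule primitive_prod[OF mmul.sc_bilinear_axioms Y primitive_fund_inv[OF \<beta>]])
  then show ?thesis
    by (simp add: primitive_def mmul.minus_left matrix_mul_assoc prim_def)
qed

lemma fund_mult_fund_inv:
  assumes \<beta>: "bdd_borel \<beta>"
  shows "fund \<beta> t ** fund_inv \<beta> t = mat 1" "fund_inv \<beta> t ** fund \<beta> t = mat 1"
  using mult_fund_inv_const[OF \<beta> primitive_fund[OF \<beta>]] by (auto simp: matrix_left_right_inverse)

text \<open>The constant product is multiplied by \<open>fund \<beta> t\<close> from the right; no
  Gronwall argument is involved.\<close>

lemma fund_unique:
  fixes \<beta> :: "real \<Rightarrow> real^'k^'k"
  assumes \<beta>: "bdd_borel \<beta>" and Y: "primitive Y (\<lambda>s. - (Y s ** \<beta> s)) c"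
  shows "Y t = c ** fund \<beta> t"
  using mult_fund_inv_const[OF assms, of t] fund_mult_fund_inv(2)[OF \<beta>, of t]
  by (metis matrix_mul_assoc matrix_mul_rid)

text \<open>In this product form the group law, invertibility and joint continuity are algebra, and
  r > t is allowed as well. That it sees the coefficient only between r and t, for r \<le> t, is the
  content of \<open>Sig_eq_fund\<close> and \<open>fund_cong\<close>.\<close>

definition Sig :: "(real \<Rightarrow> real^'k^'k) \<Rightarrow> real \<Rightarrow> real \<Rightarrow> real^'k^'k" where
  "Sig \<beta> r t = fund_inv \<beta> r ** fund \<beta> t"

text \<open>The propagator from r, frozen at the identity before r, solves the equation whose
  coefficient is switched off before r, and solutions are unique. Adaptedness, the norm bound and
  the exponential formula all go through this form.\<close>

lemma Sig_eq_fund: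
  assumes \<beta>: "bdd_borel \<beta>" and "r \<le> t"
  shows "Sig \<beta> r t = fund (\<lambda>s. if r \<le> s then \<beta> s else 0) t"
proof -
  \<comment> \<open>The \<open>max\<close> does the freezing: for t < r the value is
    \<open>fund_inv \<beta> r ** fund \<beta> r\<close>, the identity.\<close>
  let ?\<beta> = "\<lambda>s. if r \<le> s then \<beta> s else 0" and ?Y = "\<lambda>t. fund_inv \<beta> r ** fund \<beta> (max r t)"
  let ?f = "\<lambda>s. - (fund_inv \<beta> r ** (fund \<beta> s ** \<beta> s))"
  have f: "bdd_borel ?f"
    by (intro bdd_borel_minus mmul.bdd_borel_prod bdd_borel_const bdd_borel_fund \<beta>)
  have fY: "- (?Y s ** ?\<beta> s) = (if r \<le> s then ?f s else 0)" for s
    by (auto simp: matrix_mul_assoc)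
  have bdd: "bdd_borel (\<lambda>s. if r \<le> s then ?f s else 0)"
    by (rule bdd_borel_if[OF f]) auto
  have "?Y t = mat 1 + prim (\<lambda>s. if r \<le> s then ?f s else 0) t" for t
  proof (cases "t < r")
    case True
    then have "prim (\<lambda>s. if r \<le> s then ?f s else 0) t = prim (\<lambda>s. 0) t"
      by (intro prim_cong) auto
    then show ?thesis
      using True by (simp add: fund_mult_fund_inv[OF \<beta>] prim_def max_def)
  next
    case False
    \<comment> \<open>The cutoff keeps s = r, the difference of indefinite integrals drops it; this
      point is null.\<close>
    have "prim (\<lambda>s. if r \<le> s then ?f s else 0) t = prim ?f t - prim ?f r"
      unfolding prim_diff[OF f leI[OF False]] unfolding prim_def
    proof (rule integral_cong_AE)
      show "AE s in \<nu>. (if s \<le> t then if r \<le> s then ?f s else 0 else 0)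
          = (if r < s \<and> s \<le> t then ?f s else 0)"
        using AE_neq[of r] by eventually_elim auto
    qed (use bdd_borel_measurable[OF f] in measurable)
    also have "\<dots> = fund_inv \<beta> r ** (prim (\<lambda>s. - (fund \<beta> s ** \<beta> s)) t - prim (\<lambda>s. - (fund \<beta> s ** \<beta> s)) r)"
      by (simp add: prim_minus prim_bounded_linear[OF mmul.bounded_linear_right]
          mmul.bdd_borel_prod bdd_borel_fund \<beta> mmul.diff_right mmul.minus_right)
    also have "\<dots> = fund_inv \<beta> r ** fund \<beta> t - fund_inv \<beta> r ** fund \<beta> r"
      by (simp only: primitive_diff[OF primitive_fund[OF \<beta>], symmetric] mmul.diff_right)
    finally show ?thesis
      using False by (simp add: fund_mult_fund_inv[OF \<beta>])
  qed
  then have "primitive ?Y (\<lambda>s. - (?Y s ** ?\<beta> s)) (mat 1)"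
    unfolding fY primitive_def using bdd by blast
  then have "?Y t = mat 1 ** fund ?\<beta> t"
    by (rule fund_unique[OF bdd_borel_if[OF \<beta>], rotated]) auto
  then show ?thesis
    using assms by (simp add: Sig_def max_def)
qed

text \<open>The complement of \<open>Sig_eq_fund\<close> at the right end: each Picard iterate at t
  only integrates over times up to t.\<close>

lemma fund_cong:
  fixes \<beta> \<gamma> :: "real \<Rightarrow> real^'k^'k"
  assumes "\<And>s. s \<le> t \<Longrightarrow> \<beta> s = \<gamma> s"
  shows "fund \<beta> t = fund \<gamma> t"
proof -
  have "s \<le> t \<Longrightarrow> picard \<beta> n s = picard \<gamma> n s" for n s
    using assms by (induction n arbitrary: s) (auto intro!: prim_cong arg_cong2[where f = "(**)"])
  then show ?thesis by (simp add: fund_def)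
qed

text \<open>If the values commute, d(F^(n+1)) = (n+1) F^n dF holds for F =
  -\<open>prim \<beta>\<close> as it does for numbers, so the Picard iterates are the terms of the
  exponential series.\<close>

lemma fund_commuting:
  fixes \<beta> :: "real \<Rightarrow> real^'k^'k"
  assumes \<beta>: "bdd_borel \<beta>" and comm: "\<And>s q. \<beta> s ** \<beta> q = \<beta> q ** \<beta> s"
  shows "fund \<beta> t = matrix_exp (- prim \<beta> t)"
proof -
  let ?F = "\<lambda>t. - prim \<beta> t" and ?f = "\<lambda>s. - \<beta> s"
  have f: "bdd_borel ?f" by (rule bdd_borel_minus[OF \<beta>])
  have F: "primitive ?F ?f 0"
    using f by (simp add: primitive_def prim_minus)
  \<comment> \<open>Commutation with a fixed value passes to the integral, since left and right
    multiplication are bounded linear.\<close>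
  have c1: "prim \<beta> t ** \<beta> q = \<beta> q ** prim \<beta> t" for t q
    by (simp add: comm[of _ q] \<beta> prim_bounded_linear[OF mmul.bounded_linear_left, symmetric]
        prim_bounded_linear[OF mmul.bounded_linear_right, symmetric])
  have c2: "?f q ** mpow (?F t) n = mpow (?F t) n ** ?f q" for t q n
  proof (induction n)
    case (Suc n)
    have "?f q ** mpow (?F t) (Suc n) = (?F t ** ?f q) ** mpow (?F t) n"
      by (simp add: mpow_Suc matrix_mul_assoc mmul.minus_left mmul.minus_right c1)
    also have "\<dots> = mpow (?F t) (Suc n) ** ?f q"
      by (simp only: mpow_Suc matrix_mul_assoc[symmetric] Suc)
    finally show ?case .
  qed (simp add: mpow_0)
  have pw: "primitive (\<lambda>t. mpow (?F t) (Suc n)) (\<lambda>s. real (Suc n) *\<^sub>R (mpow (?F s) n ** ?f s)) 0" for n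
  proof (induction n)
    case 0
    then show ?case using F by (simp add: mpow_Suc mpow_0)
  next
    case (Suc n)
    have "primitive (\<lambda>t. ?F t ** mpow (?F t) (Suc n))
      (\<lambda>s. ?F s ** (real (Suc n) *\<^sub>R (mpow (?F s) n ** ?f s)) + ?f s ** mpow (?F s) (Suc n)) (0 ** (0 :: real^'k^'k))"
      by (rule primitive_prod[OF mmul.sc_bilinear_axioms F Suc])
    \<comment> \<open>Moving the increment to the right of the power merges the two product-rule
      terms into one with factor n+2.\<close>
    moreover have "?F s ** (real (Suc n) *\<^sub>R (mpow (?F s) n ** ?f s)) + ?f s ** mpow (?F s) (Suc n)
      = real (Suc (Suc n)) *\<^sub>R (mpow (?F s) (Suc n) ** ?f s)" for s
      unfolding c2 by (simp only: mmul.scaleR_right mmul.add_right matrix_mul_assoc mpow_Suc of_nat_Suc scaleR_add_left scaleR_one add_ac)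
    ultimately show ?case
      by (simp only: mpow_Suc[symmetric] times0_left)
  qed
  have picard: "picard \<beta> n t = (1 / fact n) *\<^sub>R mpow (?F t) n" for n t
  proof (induction n arbitrary: t)
    case (Suc n)
    have "picard \<beta> (Suc n) t = prim (\<lambda>s. (1 / fact n) *\<^sub>R (mpow (?F s) n ** ?f s)) t"
      by (simp add: Suc prim_minus[symmetric] mmul.scaleR_left mmul.minus_right)
    \<comment> \<open>Writing 1/n! as (n+1)/(n+1)! exposes the density of the next power.\<close>
    also have "\<dots> = prim (\<lambda>s. (1 / fact (Suc n)) *\<^sub>R (real (Suc n) *\<^sub>R (mpow (?F s) n ** ?f s))) t"
      by (intro prim_cong) (simp del: of_nat_Suc)
    also have "\<dots> = (1 / fact (Suc n)) *\<^sub>R prim (\<lambda>s. real (Suc n) *\<^sub>R (mpow (?F s) n ** ?f s)) t"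
      using pw[of n] unfolding primitive_def
      by (intro prim_bounded_linear[OF bounded_linear_scaleR_right]) auto
    also have "\<dots> = (1 / fact (Suc n)) *\<^sub>R mpow (?F t) (Suc n)"
      using pw[of n] by (simp add: primitive_def)
    finally show ?case .
  qed (simp add: mpow_0)
  show ?thesis
    by (simp add: fund_def matrix_exp_def picard mpow_def)
qed

text \<open>Closed at both ends like the integrals over \<open>{r..t}\<close> in problem (M), and 0
  for r > t; for r \<le> t it is an increment of \<open>prim\<close> because {r} is null.\<close>

definition seg :: "(real \<Rightarrow> 'a::{banach, second_countable_topology}) \<Rightarrow> real \<Rightarrow> real \<Rightarrow> 'a" where
  "seg f r t = (\<integral>s. (if r \<le> s \<and> s \<le> t then f s else 0) \<partial>\<nu>)"

lemma seg_eq: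
  assumes f: "bdd_borel f" and "r \<le> t"
  shows "seg f r t = prim f t - prim f r"
  unfolding prim_diff[OF assms] unfolding seg_def
proof (rule integral_cong_AE)
  show "AE s in \<nu>. (if r \<le> s \<and> s \<le> t then f s else 0) = (if r < s \<and> s \<le> t then f s else 0)"
    using AE_neq[of r] by eventually_elim auto
qed (use bdd_borel_measurable[OF f] in measurable)

lemma seg_cong: "(\<And>s. r \<le> s \<Longrightarrow> s \<le> t \<Longrightarrow> f s = g s) \<Longrightarrow> seg f r t = seg g r t"
  unfolding seg_def by (intro LINT_cong) auto

lemma seg_eq_prim: "seg f r t = prim (\<lambda>s. if r \<le> s then f s else 0) t"
  unfolding seg_def prim_def by (intro LINT_cong) auto

lemma seg_diff:
  assumes "bdd_borel f" "bdd_borel g"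
  shows "seg f r t - seg g r t = seg (\<lambda>s. f s - g s) r t"
  unfolding seg_def
  by (subst Bochner_Integration.integral_diff[symmetric])
    (auto intro!: integrable_bdd bdd_borel_if LINT_cong assms)

lemma norm_seg_le_seg:
  assumes f: "bdd_borel f" and \<phi>: "bdd_borel \<phi>" and le: "\<And>s. r \<le> s \<Longrightarrow> s \<le> t \<Longrightarrow> norm (f s) \<le> \<phi> s"
  shows "norm (seg f r t) \<le> seg \<phi> r t"
proof -
  have "norm (seg f r t) \<le> (\<integral>s. norm (if r \<le> s \<and> s \<le> t then f s else 0) \<partial>\<nu>)"
    unfolding seg_def by (rule integral_norm_bound)
  also have "\<dots> \<le> seg \<phi> r t"
    unfolding seg_def using le by (intro integral_mono integrable_norm integrable_bdd bdd_borel_if f \<phi>) auto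
  finally show ?thesis .
qed

lemma Sig_refl:
  shows "bdd_borel \<beta> \<Longrightarrow> Sig \<beta> r r = mat 1"
  by (simp add: Sig_def fund_mult_fund_inv)

lemma Sig_trans:
  assumes "bdd_borel \<beta>"
  shows "Sig \<beta> r s ** Sig \<beta> s t = Sig \<beta> r t"
proof -
  have "Sig \<beta> r s ** Sig \<beta> s t = fund_inv \<beta> r ** (fund \<beta> s ** fund_inv \<beta> s) ** fund \<beta> t"
    by (simp add: Sig_def matrix_mul_assoc)
  then show ?thesis
    by (simp add: Sig_def fund_mult_fund_inv[OF assms])
qed

lemma Sig_inverse:
  assumes "bdd_borel \<beta>"
  shows "invertible (Sig \<beta> r t)" "matrix_inv (Sig \<beta> r t) = Sig \<beta> t r"
proof -
  have *: "Sig \<beta> r t ** Sig \<beta> t r = mat 1" "Sig \<beta> t r ** Sig \<beta> r t = mat 1"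
    by (simp_all add: Sig_trans Sig_refl assms)
  then show i: "invertible (Sig \<beta> r t)"
    unfolding invertible_def by blast
  show "matrix_inv (Sig \<beta> r t) = Sig \<beta> t r"
    \<comment> \<open>\<open>matrix_inv\<close> is a choice operator, so the two-sided inverse has
      to be shown unique.\<close>
    unfolding matrix_inv_def
  proof (rule some_equality)
    fix B assume "Sig \<beta> r t ** B = mat 1 \<and> B ** Sig \<beta> r t = mat 1"
    then show "B = Sig \<beta> t r"
      by (metis *(2) matrix_mul_assoc matrix_mul_lid matrix_mul_rid)
  qed (use * in blast)
qed

lemma Sig_continuous:
  assumes \<beta>: "bdd_borel \<beta>"
  shows "continuous_on A (\<lambda>(r, t). Sig \<beta> r t)"
  unfolding Sig_def case_prod_beta'
  by (intro mmul.continuous_on continuous_intros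
      continuous_on_compose2[OF primitive_continuous[OF primitive_fund_inv[OF \<beta>], of UNIV]]
      continuous_on_compose2[OF primitive_continuous[OF primitive_fund[OF \<beta>], of UNIV]]) auto

text \<open>For the switched-off coefficient the series bound only counts |\<beta>| on [r,t].
  Bounding the two factors of \<open>Sig\<close> separately would cost a factor k and in general a
  larger exponent.\<close>

lemma norm_Sig_le:
  fixes \<beta> :: "real \<Rightarrow> real^'k^'k"
  assumes \<beta>: "bdd_borel \<beta>" and "r \<le> t"
  shows "norm (Sig \<beta> r t) \<le> sqrt (real CARD('k)) * exp (seg (\<lambda>s. norm (\<beta> s)) r t)"
proof -
  have "prim (\<lambda>s. norm (if r \<le> s then \<beta> s else 0)) t = seg (\<lambda>s. norm (\<beta> s)) r t"
    unfolding seg_eq_prim by (intro prim_cong) auto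
  then show ?thesis
    using norm_fund_le[OF bdd_borel_if[OF \<beta>], of "\<lambda>s. r \<le> s" t] by (simp add: Sig_eq_fund[OF assms])
qed

lemma Sig_commuting:
  fixes \<beta> :: "real \<Rightarrow> real^'k^'k"
  assumes \<beta>: "bdd_borel \<beta>" and "r \<le> t" and "\<And>s q. \<beta> s ** \<beta> q = \<beta> q ** \<beta> s"
  shows "Sig \<beta> r t = matrix_exp (- seg \<beta> r t)"
  unfolding Sig_eq_fund[OF \<beta> \<open>r \<le> t\<close>] seg_eq_prim
  by (rule fund_commuting[OF bdd_borel_if[OF \<beta>]]) (auto simp: assms(3))

text \<open>
  Variation of constants for the terminal value problem \<open>dY = (\<alpha> + \<beta> Y) d\<nu>\<close>, \<open>Y\<^sub>T = \<gamma>\<close>.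
\<close>

definition bwd_coeff :: "(real \<Rightarrow> real^'k^'k) \<Rightarrow> (real \<Rightarrow> real^'k) \<Rightarrow> real^'k \<Rightarrow> real \<Rightarrow> real \<Rightarrow> real^'k" where
  "bwd_coeff \<beta> \<alpha> \<gamma> T t = fund \<beta> T *v \<gamma> - prim (\<lambda>s. fund \<beta> s *v \<alpha> s) T + prim (\<lambda>s. fund \<beta> s *v \<alpha> s) t"

definition bwd :: "(real \<Rightarrow> real^'k^'k) \<Rightarrow> (real \<Rightarrow> real^'k) \<Rightarrow> real^'k \<Rightarrow> real \<Rightarrow> real \<Rightarrow> real^'k" where
  "bwd \<beta> \<alpha> \<gamma> T t = fund_inv \<beta> t *v bwd_coeff \<beta> \<alpha> \<gamma> T t"

text \<open>The factor w = \<open>bwd_coeff\<close> satisfies dw = fund \<alpha> d\<nu>. In the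
  product rule for \<open>fund_inv\<close> and w, the term with dw collapses to \<alpha>, and the
  other one is \<beta> times the product.\<close>

lemma primitive_bwd:
  assumes \<beta>: "bdd_borel \<beta>" and \<alpha>: "bdd_borel \<alpha>"
  shows "\<exists>c. primitive (bwd \<beta> \<alpha> \<gamma> T) (\<lambda>s. \<alpha> s + \<beta> s *v bwd \<beta> \<alpha> \<gamma> T s) c"
proof -
  have bwd_coeff: "primitive (bwd_coeff \<beta> \<alpha> \<gamma> T) (\<lambda>s. fund \<beta> s *v \<alpha> s) (fund \<beta> T *v \<gamma> - prim (\<lambda>s. fund \<beta> s *v \<alpha> s) T)"
    by (auto simp: primitive_def bwd_coeff_def intro!: mvmul.bdd_borel_prod bdd_borel_fund assms)
  have "fund_inv \<beta> s *v (fund \<beta> s *v \<alpha> s) + (\<beta> s ** fund_inv \<beta> s) *v bwd_coeff \<beta> \<alpha> \<gamma> T s = \<alpha> s + \<beta> s *v bwd \<beta> \<alpha> \<gamma> T s" for s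
    by (simp add: matrix_vector_mul_assoc fund_mult_fund_inv[OF \<beta>] bwd_def)
  then show ?thesis
    using primitive_prod[OF mvmul.sc_bilinear_axioms primitive_fund_inv[OF \<beta>] bwd_coeff]
    by (auto simp: bwd_def[abs_def])
qed

lemma bwd_continuous:
  assumes "bdd_borel \<beta>" "bdd_borel \<alpha>"
  shows "continuous_on A (bwd \<beta> \<alpha> \<gamma> T)"
  using primitive_bwd[OF assms] primitive_continuous by blast

lemma bwd_seg:
  assumes "bdd_borel \<beta>" "bdd_borel \<alpha>" "r \<le> t"
  shows "bwd \<beta> \<alpha> \<gamma> T t = bwd \<beta> \<alpha> \<gamma> T r + seg (\<lambda>s. \<alpha> s + \<beta> s *v bwd \<beta> \<alpha> \<gamma> T s) r t"
proof -
  obtain c where c: "primitive (bwd \<beta> \<alpha> \<gamma> T) (\<lambda>s. \<alpha> s + \<beta> s *v bwd \<beta> \<alpha> \<gamma> T s) c"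
    using primitive_bwd[OF assms(1,2)] by blast
  show ?thesis
    unfolding seg_eq[OF primitiveD(1)[OF c] assms(3)] primitive_diff[OF c, symmetric] by simp
qed

text \<open>\<open>fund_inv \<beta> t\<close> merges with \<open>fund\<close> at T and at each s
  into propagators starting at t, which is the shape of the representation formula.\<close>

lemma bwd_eq_Sig:
  assumes \<beta>: "bdd_borel \<beta>" and \<alpha>: "bdd_borel \<alpha>" and t: "t \<le> T"
  shows "bwd \<beta> \<alpha> \<gamma> T t = Sig \<beta> t T *v \<gamma> - seg (\<lambda>s. Sig \<beta> t s *v \<alpha> s) t T"
proof -
  let ?f = "\<lambda>s. fund \<beta> s *v \<alpha> s"
  have f: "bdd_borel ?f"
    by (intro mvmul.bdd_borel_prod bdd_borel_fund assms)
  have "seg (\<lambda>s. Sig \<beta> t s *v \<alpha> s) t T = seg (\<lambda>s. fund_inv \<beta> t *v ?f s) t T"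
    by (simp add: Sig_def matrix_vector_mul_assoc)
  also have "\<dots> = prim (\<lambda>s. fund_inv \<beta> t *v ?f s) T - prim (\<lambda>s. fund_inv \<beta> t *v ?f s) t"
    by (rule seg_eq[OF mvmul.bdd_borel_prod[OF bdd_borel_const f] t])
  also have "\<dots> = fund_inv \<beta> t *v (prim ?f T - prim ?f t)"
    by (simp only: prim_bounded_linear[OF mvmul.bounded_linear_right f] mvmul.diff_right)
  finally show ?thesis
    by (simp add: bwd_def bwd_coeff_def Sig_def mvmul.diff_right mvmul.add_right matrix_vector_mul_assoc)
qed

lemma bwd_terminal:
  assumes \<beta>: "bdd_borel \<beta>"
  shows "bwd \<beta> \<alpha> \<gamma> T T = \<gamma>"
  by (simp add: bwd_def bwd_coeff_def matrix_vector_mul_assoc fund_mult_fund_inv[OF \<beta>])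

lemma bwd_measurable:
  fixes \<beta> :: "'w \<Rightarrow> real \<Rightarrow> real^'k^'k" and \<alpha> :: "'w \<Rightarrow> real \<Rightarrow> real^'k"
  assumes [measurable]: "(\<lambda>(s, \<omega>). \<beta> \<omega> s) \<in> borel_measurable (borel \<Otimes>\<^sub>M N)"
    "(\<lambda>(s, \<omega>). \<alpha> \<omega> s) \<in> borel_measurable (borel \<Otimes>\<^sub>M N)" "\<gamma> \<in> borel_measurable N"
  shows "(\<lambda>(t, \<omega>). bwd (\<beta> \<omega>) (\<alpha> \<omega>) (\<gamma> \<omega>) T t) \<in> borel_measurable (borel \<Otimes>\<^sub>M N)"
proof -
  note [measurable] = fund_measurable[OF assms(1)] fund_inv_measurable[OF assms(1)]
  have [measurable]: "(\<lambda>(t, \<omega>). prim (\<lambda>s. fund (\<beta> \<omega>) s *v \<alpha> \<omega> s) t) \<in> borel_measurable (borel \<Otimes>\<^sub>M N)"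
    by (rule prim_measurable) measurable
  have [measurable]: "(\<lambda>\<omega>. prim (\<lambda>s. fund (\<beta> \<omega>) s *v \<alpha> \<omega> s) T) \<in> borel_measurable N"
    unfolding prim_def by measurable
  show ?thesis
    unfolding bwd_def bwd_coeff_def by measurable
qed

text \<open>C is quantified before the coefficients: it depends on \<nu>, k and G only, so that one
  bound serves all paths and times.\<close>

lemma norm_bwd_le:
  "\<exists>C. \<forall>(\<beta> :: real \<Rightarrow> real^'k^'k) (\<alpha> :: real \<Rightarrow> real^'k) (\<gamma> :: real^'k) T t. bdd_borel \<beta> \<longrightarrow> bdd_borel \<alpha> \<longrightarrow> (\<forall>s. norm (\<beta> s) \<le> 1) \<longrightarrow>
     (\<forall>s. norm (\<alpha> s) \<le> 1) \<longrightarrow> norm \<gamma> \<le> G \<longrightarrow> norm (bwd \<beta> \<alpha> \<gamma> T t) \<le> C"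
proof (intro exI allI impI)
  fix \<beta> :: "real \<Rightarrow> real^'k^'k" and \<alpha> :: "real \<Rightarrow> real^'k" and \<gamma> :: "real^'k" and T t
  assume \<beta>: "bdd_borel \<beta>" and \<alpha>: "bdd_borel \<alpha>" and b: "\<forall>s. norm (\<beta> s) \<le> 1"
    and a: "\<forall>s. norm (\<alpha> s) \<le> 1" and g: "norm \<gamma> \<le> G"
  let ?K = "sqrt (real CARD('k)) * exp (1 * measure \<nu> UNIV)" and ?m = "measure \<nu> UNIV"
  have fund: "norm (fund \<beta> t) \<le> ?K" and fund_inv: "norm (fund_inv \<beta> t) \<le> ?K" for t
    using norm_fund_le_uniform[OF \<beta>] norm_fund_inv_le_uniform[OF \<beta>] b by blast+
  have za: "norm (fund \<beta> s *v \<alpha> s) \<le> ?K" for s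
  proof -
    have "norm (fund \<beta> s *v \<alpha> s) \<le> norm (fund \<beta> s) * norm (\<alpha> s)"
      by (rule norm_matrix_vector_mult_le)
    also have "\<dots> \<le> ?K * 1"
      using fund[of s] a by (intro mult_mono) auto
    finally show ?thesis by simp
  qed
  have p: "norm (prim (\<lambda>s. fund \<beta> s *v \<alpha> s) t) \<le> ?K * ?m" for t
  proof -
    have "norm (prim (\<lambda>s. fund \<beta> s *v \<alpha> s) t) \<le> prim (\<lambda>s. norm (fund \<beta> s *v \<alpha> s)) t"
      by (intro prim_norm_le mvmul.bdd_borel_prod bdd_borel_fund \<alpha> \<beta>)
    also have "\<dots> \<le> (\<integral>s. ?K \<partial>\<nu>)"
      unfolding prim_def using za
      by (intro integral_mono integrable_prim bdd_borel_norm mvmul.bdd_borel_prod bdd_borel_fund \<alpha> \<beta>) auto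
    finally show ?thesis by (simp add: space_nu mult_ac)
  qed
  have "norm (fund \<beta> T *v \<gamma>) \<le> ?K * G"
    using fund[of T] g by (intro order_trans[OF norm_matrix_vector_mult_le] mult_mono) auto
  then have bwd_coeff: "norm (bwd_coeff \<beta> \<alpha> \<gamma> T t) \<le> ?K * G + ?K * ?m + ?K * ?m"
    unfolding bwd_coeff_def
    by (intro order_trans[OF norm_triangle_ineq] order_trans[OF add_mono[OF norm_triangle_ineq4 order_refl]]
        add_mono p) 
  show "norm (bwd \<beta> \<alpha> \<gamma> T t) \<le> ?K * (?K * G + ?K * ?m + ?K * ?m)"
    unfolding bwd_def
    using fund_inv[of t] bwd_coeff by (intro order_trans[OF norm_matrix_vector_mult_le] mult_mono) auto
qed

text \<open>Iterating \<open>step\<close> from the constant K gives N s x \<le> K D(s)^n/n!, with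
  D(s) the \<nu>-mass of the times after s up to T. The majorants depend on time alone, so the
  supremum over x never has to be measurable.\<close>

lemma backward_gronwall:
  assumes base: "\<And>s x. r0 \<le> s \<Longrightarrow> s \<le> T \<Longrightarrow> N s x \<le> K"
    and K: "0 \<le> K"
    and step: "\<And>\<phi> s x. bdd_borel \<phi> \<Longrightarrow> (\<And>q y. r0 \<le> q \<Longrightarrow> q \<le> T \<Longrightarrow> N q y \<le> \<phi> q) \<Longrightarrow>
      r0 \<le> s \<Longrightarrow> s \<le> T \<Longrightarrow> N s x \<le> seg \<phi> s T"
    and r: "r0 \<le> r" "r \<le> T"
  shows "N r x \<le> (0 :: real)"
proof -
  define D where "D s = prim (\<lambda>_. 1 :: real) T + prim (\<lambda>_. -1) s" for s
  have D: "primitive D (\<lambda>_. -1) (prim (\<lambda>_. 1) T)"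
    by (simp add: primitive_def D_def bdd_borel_const)
  have DT: "D T = 0"
    by (simp add: D_def prim_minus)
  let ?\<phi> = "\<lambda>n s. K * (D s ^ n / fact n)"
  \<comment> \<open>The power rule covers exponents from 1 on, hence \<open>n - 1\<close>; exponent
    0 is the constant case.\<close>
  have bdd: "bdd_borel (?\<phi> n)" for n
    using bdd_borel_bounded_linear[OF bounded_linear_mult_right[of "K / fact n"], of "\<lambda>s. D s ^ n"]
      primitive_bdd[OF primitive_power[OF D, of "n - 1"]] bdd_borel_const[of "1 :: real"]
    by (cases n) auto
  \<comment> \<open>-D^(n+1)/(n+1) is a primitive of D^n, and it vanishes at T.\<close>
  have seg: "seg (?\<phi> n) s T = ?\<phi> (Suc n) s" if "s \<le> T" for n s
  proof -
    note P = primitive_power[OF D, of n]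
    have "?\<phi> n = (\<lambda>q. (- K / fact (Suc n)) * (real (Suc n) * (D q ^ n * -1)))"
      by (auto simp: divide_simps simp del: of_nat_Suc)
    then have "seg (?\<phi> n) s T = (- K / fact (Suc n)) *
        (prim (\<lambda>q. real (Suc n) * (D q ^ n * -1)) T - prim (\<lambda>q. real (Suc n) * (D q ^ n * -1)) s)"
      unfolding seg_eq[OF bdd that]
      by (simp only: prim_bounded_linear[OF bounded_linear_mult_right primitiveD(1)[OF P]] right_diff_distrib)
    also have "\<dots> = ?\<phi> (Suc n) s"
      unfolding primitive_diff[OF P, symmetric] by (simp add: DT)
    finally show ?thesis .
  qed
  have "r0 \<le> s \<Longrightarrow> s \<le> T \<Longrightarrow> N s x \<le> ?\<phi> n s" for n s x
  proof (induction n arbitrary: s x)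
    case (Suc n)
    then show ?case
      using step[OF bdd[of n], of s x] by (simp only: seg)
  qed (use base in simp)
  then have *: "N r x \<le> ?\<phi> n r" for n
    using r by blast
  have "(\<lambda>n. D r ^ n / fact n) \<longlonglongrightarrow> 0"
    using summable_LIMSEQ_zero[OF summable_exp[of "D r"]] by (simp add: divide_inverse mult.commute)
  then have "(\<lambda>n. ?\<phi> n r) \<longlonglongrightarrow> K * 0"
    by (rule tendsto_mult_left)
  then have "(\<lambda>n. ?\<phi> n r) \<longlonglongrightarrow> 0" by simp
  then show ?thesis
    using * by (intro LIMSEQ_le_const) auto
qed

end

section \<open>Borel sets of a pseudometric\<close>

lemma space_pm_borel [simp]: "space (pm_borel d A) = A"
  unfolding pm_borel_def by (rule space_measure_of) (auto simp: pm_open_def)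

lemma sets_pm_borel: "sets (pm_borel d A) = sigma_sets A {U. pm_open d A U}"
  unfolding pm_borel_def by (rule sets_measure_of) (auto simp: pm_open_def)

text \<open>The extension is a union of balls in A with the radii that witness openness in B. The
  triangle inequality makes it open, and a point of B in such a ball lies in U.\<close>

lemma pm_open_extend:
  assumes d: "pseudometric_on A d" and "B \<subseteq> A" and U: "pm_open d B U"
  shows "\<exists>V. pm_open d A V \<and> V \<inter> B = U"
proof -
  have "\<forall>p\<in>U. \<exists>e>0. \<forall>q\<in>B. d p q < e \<longrightarrow> q \<in> U" and UB: "U \<subseteq> B"
    using U by (auto simp: pm_open_def)
  then obtain e where e: "\<And>p. p \<in> U \<Longrightarrow> 0 < e p" "\<And>p q. p \<in> U \<Longrightarrow> q \<in> B \<Longrightarrow> d p q < e p \<Longrightarrow> q \<in> U"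
    by metis
  let ?V = "{q \<in> A. \<exists>p\<in>U. d p q < e p}"
  have "pm_open d A ?V"
    unfolding pm_open_def
  proof (intro conjI ballI)
    fix q assume "q \<in> ?V"
    then obtain p where p: "p \<in> U" "d p q < e p" "q \<in> A" by blast
    show "\<exists>\<epsilon>>0. \<forall>z\<in>A. d q z < \<epsilon> \<longrightarrow> z \<in> ?V"
    proof (intro exI[of _ "e p - d p q"] conjI ballI impI)
      fix z assume z: "z \<in> A" "d q z < e p - d p q"
      have "d p z \<le> d p q + d q z"
        using d p z UB \<open>B \<subseteq> A\<close> unfolding pseudometric_on_def by blast
      then have "d p z < e p"
        using z by linarith
      then show "z \<in> ?V" using p z by blast
    qed (use p in auto)
  qed auto
  moreover have "?V \<inter> B = U"
  proof -
    have "d p p = 0" if "p \<in> U" for p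
      using d that UB \<open>B \<subseteq> A\<close> unfolding pseudometric_on_def by blast
    then show ?thesis
      using e UB \<open>B \<subseteq> A\<close> by force
  qed
  ultimately show ?thesis by blast
qed

text \<open>The Borel field of the restricted pseudometric lies in the trace of the larger one. This
  lets measurable functions on [0,c] x S be pieced together on [0,T] x S.\<close>

lemma ident_measurable_pm_borel_subset:
  assumes "pseudometric_on A d" "B \<subseteq> A"
  shows "(\<lambda>x. x) \<in> restrict_space (pm_borel d A) B \<rightarrow>\<^sub>M pm_borel d B"
  unfolding pm_borel_def[of d B]
proof (rule measurable_measure_of)
  fix U assume "U \<in> {U. pm_open d B U}"
  then obtain V where V: "pm_open d A V" "V \<inter> B = U"
    using pm_open_extend[OF assms, of U] by blast
  have "V \<in> sets (pm_borel d A)"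
    using V by (auto simp: sets_pm_borel)
  then show "(\<lambda>x. x) -` U \<inter> space (restrict_space (pm_borel d A) B) \<in> sets (restrict_space (pm_borel d A) B)"
    using V assms(2) by (auto simp: sets_restrict_space space_restrict_space)
qed (use assms in \<open>auto simp: pm_open_def space_restrict_space\<close>)

text \<open>The pseudometric topology is coarser than the product topology, so its Borel sets are
  product-Borel, and compositions with paths can be studied in the product Borel field.\<close>

lemma ident_measurable_pm_borel:
  assumes d: "time_state_pseudometric T d" and B: "B \<subseteq> {0..T} \<times> UNIV"
  shows "(\<lambda>x. x) \<in> restrict_space borel B \<rightarrow>\<^sub>M pm_borel d B"
proof -
  let ?A = "{0..T} \<times> UNIV"
  have "(\<lambda>x. x) \<in> restrict_space borel ?A \<rightarrow>\<^sub>M pm_borel d ?A"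
    unfolding pm_borel_def
  proof (rule measurable_measure_of)
    fix U assume "U \<in> {U. pm_open d ?A U}"
    then obtain O' where "open O'" "U = ?A \<inter> O'"
      using d by (auto simp: time_state_pseudometric_def openin_open)
    then have "(\<lambda>x. x) -` U \<inter> space (restrict_space borel ?A) = ?A \<inter> O'" and "O' \<in> sets borel"
      by (auto simp: space_restrict_space)
    then show "(\<lambda>x. x) -` U \<inter> space (restrict_space borel ?A) \<in> sets (restrict_space borel ?A)"
      unfolding sets_restrict_space by blast
  qed (unfold pm_open_def space_restrict_space, blast, simp)
  moreover have "(\<lambda>x. x) \<in> restrict_space borel B \<rightarrow>\<^sub>M restrict_space borel ?A"
    using B by (intro measurable_restrict_space2 measurable_restrict_space1) (auto simp: space_restrict_space)
  ultimately have "(\<lambda>x. x) \<in> restrict_space borel B \<rightarrow>\<^sub>M pm_borel d ?A"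
    using measurable_compose by blast
  then have "(\<lambda>x. x) \<in> restrict_space borel B \<rightarrow>\<^sub>M restrict_space (pm_borel d ?A) B"
    by (intro measurable_restrict_space2) (auto simp: space_restrict_space)
  then show ?thesis
    by (rule measurable_compose)
      (use d B in \<open>auto intro!: ident_measurable_pm_borel_subset simp: time_state_pseudometric_def\<close>)
qed

text \<open>Points at distance zero are contained in the same Borel sets.\<close>

lemma consistent_onI_measurable:
  fixes f :: "'a \<Rightarrow> 'b::t1_space"
  assumes d: "pseudometric_on A d" and f: "f \<in> borel_measurable (pm_borel d A)"
  shows "consistent_on d A f"
  unfolding consistent_on_def
proof (intro ballI impI)
  fix p q assume pq: "p \<in> A" "q \<in> A" "d p q = 0"
  then have qp: "d q p = 0"
    using d unfolding pseudometric_on_def by metis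
  have same: "p \<in> S \<longleftrightarrow> q \<in> S" if "S \<in> sigma_sets A {U. pm_open d A U}" for S
    using that
  proof induction
    case (Basic U)
    then show ?case using pq qp unfolding pm_open_def mem_Collect_eq by metis
  qed (use pq in auto)
  \<comment> \<open>Singletons are closed in a T1 space, so the fibre through p is a Borel set; it
    must contain q as well.\<close>
  have "f -` {f p} \<inter> space (pm_borel d A) \<in> sets (pm_borel d A)"
    using f by (rule measurable_sets) auto
  then show "f p = f q"
    using same[of "f -` {f p} \<inter> A"] pq by (auto simp: sets_pm_borel)
qed

section \<open>The Markov property on the future \<open>\<sigma>\<close>-field\<close>

lemma space_natural_sigma [simp]: "space (natural_sigma M X r t) = space M"
  unfolding natural_sigma_def by (rule space_measure_of) auto

lemma sets_natural_sigma: "sets (natural_sigma M X r t) =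
  sigma_sets (space M) {X s -` B \<inter> space M | s B. s \<in> {r..t} \<and> B \<in> sets borel}"
  unfolding natural_sigma_def by (rule sets_measure_of) auto

lemma measurable_natural_sigma: "s \<in> {r..t} \<Longrightarrow> X s \<in> natural_sigma M X r t \<rightarrow>\<^sub>M borel"
  by (rule measurableI) (auto simp: sets_natural_sigma)

lemma sets_natural_sigma_subset:
  assumes "\<And>s. s \<in> {r..t} \<Longrightarrow> X s \<in> N \<rightarrow>\<^sub>M borel" "space N = space M"
  shows "sets (natural_sigma M X r t) \<subseteq> sets N"
  unfolding sets_natural_sigma assms(2)[symmetric]
proof (rule sets.sigma_sets_subset, clarify)
  fix s and B :: "'b set" assume "s \<in> {r..t}" "B \<in> sets borel"
  then show "X s -` B \<inter> space N \<in> sets N"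
    by (intro measurable_sets[OF assms(1)])
qed

section \<open>Finite-dimensional cylinders\<close>

definition cyl :: "'w measure \<Rightarrow> (real \<Rightarrow> 'w \<Rightarrow> 's) \<Rightarrow> real set \<Rightarrow> (real \<Rightarrow> 's set) \<Rightarrow> 'w set" where
  "cyl M X J B = {\<omega> \<in> space M. \<forall>s\<in>J. X s \<omega> \<in> B s}"

lemma cyl_in_sets:
  assumes "finite J" "J \<subseteq> {r..t}" "\<And>s. B s \<in> sets borel"
  shows "cyl M X J B \<in> sets (natural_sigma M X r t)"
  using assms(1,2)
proof (induction J)
  case empty
  then show ?case
    using sets.top[of "natural_sigma M X r t"] by (simp add: cyl_def)
next
  case (insert j J)
  have "cyl M X (insert j J) B = (X j -` B j \<inter> space (natural_sigma M X r t)) \<inter> cyl M X J B"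
    by (auto simp: cyl_def)
  then show ?case
    using insert assms(3) by (simp only:) (intro sets.Int measurable_sets[OF measurable_natural_sigma], auto)
qed

text \<open>Events at a single time generate the \<sigma>-field but need not be closed under
  intersection. Cylinders over finitely many times are, as uniqueness of measures requires.\<close>

lemma sets_natural_sigma_cyl:
  fixes X :: "real \<Rightarrow> 'w \<Rightarrow> 's::topological_space"
  shows "sets (natural_sigma M X r t) =
    sigma_sets (space M) {cyl M X J B | J B. finite J \<and> J \<subseteq> {r..t} \<and> (\<forall>s. B s \<in> sets borel)}"
    (is "_ = sigma_sets _ ?G")
proof (rule antisym)
  have "{X s -` B \<inter> space M | s B. s \<in> {r..t} \<and> B \<in> sets borel} \<subseteq> ?G"
  proof clarsimp
    fix s and B :: "'s set" assume "r \<le> s" "s \<le> t" "B \<in> sets borel"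
    then show "\<exists>J C. X s -` B \<inter> space M = cyl M X J C \<and> finite J \<and> J \<subseteq> {r..t} \<and> (\<forall>s. C s \<in> sets borel)"
      by (intro exI[of _ "{s}"] exI[of _ "\<lambda>_. B"]) (auto simp: cyl_def)
  qed
  then show "sets (natural_sigma M X r t) \<subseteq> sigma_sets (space M) ?G"
    unfolding sets_natural_sigma by (rule sigma_sets_mono')
  have "?G \<subseteq> sets (natural_sigma M X r t)"
    using cyl_in_sets by blast
  from sets.sigma_sets_subset[OF this]
  show "sigma_sets (space M) ?G \<subseteq> sets (natural_sigma M X r t)"
    by simp
qed

text \<open>Two cylinders are brought to the union of their time sets by padding each with
  \<open>UNIV\<close> where it imposes no condition.\<close>

lemma Int_stable_cyl:
  fixes X :: "real \<Rightarrow> 'w \<Rightarrow> 's::topological_space"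
  shows "Int_stable {cyl M X J B | J B. finite J \<and> J \<subseteq> A \<and> (\<forall>s. B s \<in> sets borel)}"
proof (rule Int_stableI, clarify)
  fix J K and B C :: "real \<Rightarrow> 's set"
  assume a: "finite J" "J \<subseteq> A" "\<forall>s. B s \<in> sets borel" "finite K" "K \<subseteq> A" "\<forall>s. C s \<in> sets borel"
  let ?D = "\<lambda>s. (if s \<in> J then B s else UNIV) \<inter> (if s \<in> K then C s else UNIV)"
  have "cyl M X J B \<inter> cyl M X K C = cyl M X (J \<union> K) ?D"
    by (auto simp: cyl_def)
  moreover have "\<forall>s. ?D s \<in> sets borel"
    using a by auto
  ultimately show "\<exists>L E. cyl M X J B \<inter> cyl M X K C = cyl M X L E \<and> finite L \<and> L \<subseteq> A \<and> (\<forall>s. E s \<in> sets borel)"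
    using a by (intro exI[of _ "J \<union> K"] exI[of _ ?D]) auto
qed

section \<open>Transition kernels and conditioning at one time\<close>

locale markov_setting =
  fixes T :: real
    and d :: "real \<times> 's::{metric_space, second_countable_topology} \<Rightarrow> real \<times> 's \<Rightarrow> real"
    and M :: "'w measure"
    and F :: "real \<Rightarrow> 'w measure"
    and X :: "real \<Rightarrow> 'w \<Rightarrow> 's"
    and P :: "real \<Rightarrow> 's \<Rightarrow> 'w measure"
  assumes pseudo: "time_state_pseudometric T d"
    and time_borel: "(\<lambda>(r, x). r) \<in> borel_measurable (pm_borel d ({0..T} \<times> UNIV))"
    and markov: "markov_process T d M F X P"
    and prog: "progressive T M X"
begin

abbreviation slab :: "real \<Rightarrow> (real \<times> 's) measure" where
  "slab t \<equiv> pm_borel d ({0..t} \<times> UNIV)"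

lemma subalg: "t \<in> {0..T} \<Longrightarrow> subalgebra M (F t)"
  and filtration: "0 \<le> s \<Longrightarrow> s \<le> t \<Longrightarrow> t \<le> T \<Longrightarrow> sets (F s) \<subseteq> sets (F t)"
  and adapted: "t \<in> {0..T} \<Longrightarrow> X t \<in> F t \<rightarrow>\<^sub>M borel"
  and prob: "r \<in> {0..T} \<Longrightarrow> prob_space (P r x)"
  and sets_P: "r \<in> {0..T} \<Longrightarrow> sets (P r x) = sets M"
  and start: "s \<in> {0..T} \<Longrightarrow> AE \<omega> in P s y. \<forall>r\<in>{0..s}. d (r, X r \<omega>) (r, y) = 0"
  and transition: "t \<in> {0..T} \<Longrightarrow> B \<in> sets borel \<Longrightarrow>
        (\<lambda>(s, x). measure (P s x) (X t -` B \<inter> space M)) \<in> borel_measurable (slab t)"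
  and markov_prop: "B \<in> sets borel \<Longrightarrow> 0 \<le> r \<Longrightarrow> r \<le> s \<Longrightarrow> s \<le> t \<Longrightarrow> t \<le> T \<Longrightarrow>
        AE \<omega> in P r x. real_cond_exp (P r x) (F s) (indicator (X t -` B \<inter> space M)) \<omega>
             = measure (P s (X s \<omega>)) (X t -` B \<inter> space M)"
  using markov unfolding markov_process_def by blast+

lemma space_P: "r \<in> {0..T} \<Longrightarrow> space (P r x) = space M"
  using sets_P sets_eq_imp_space_eq by blast

lemma space_F: "t \<in> {0..T} \<Longrightarrow> space (F t) = space M"
  and sets_F: "t \<in> {0..T} \<Longrightarrow> sets (F t) \<subseteq> sets M"
  using subalg by (auto simp: subalgebra_def)

lemma subalg_P: "r \<in> {0..T} \<Longrightarrow> t \<in> {0..T} \<Longrightarrow> subalgebra (P r x) (F t)"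
  using subalg[of t] by (simp add: subalgebra_def space_P sets_P)

lemma measurable_F_P: "r \<in> {0..T} \<Longrightarrow> t \<in> {0..T} \<Longrightarrow> f \<in> F t \<rightarrow>\<^sub>M N \<Longrightarrow> f \<in> P r x \<rightarrow>\<^sub>M N"
  by (rule measurable_from_subalg[OF subalg_P])

lemma X_measurable: "t \<in> {0..T} \<Longrightarrow> X t \<in> M \<rightarrow>\<^sub>M borel"
  by (rule measurable_from_subalg[OF subalg adapted])

lemma time_state_measurable: "r \<in> {0..T} \<Longrightarrow> s \<in> {0..T} \<Longrightarrow> (\<lambda>\<omega>. (s, X s \<omega>)) \<in> P r x \<rightarrow>\<^sub>M borel"
  by (rule measurable_compose[OF measurable_F_P[OF _ _ adapted] borel_measurable_continuous_onI])
    (auto intro!: continuous_intros)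

lemma integrable_P:
  fixes f :: "'w \<Rightarrow> 'b::{banach, second_countable_topology}"
  assumes "r \<in> {0..T}" "f \<in> borel_measurable (P r x)" "\<And>\<omega>. \<omega> \<in> space M \<Longrightarrow> norm (f \<omega>) \<le> C"
  shows "integrable (P r x) f"
proof -
  interpret prob_space "P r x" by (rule prob[OF assms(1)])
  show ?thesis
    using assms by (intro integrable_const_bound[where B = C]) (auto simp: space_P)
qed

lemma norm_expectation_le:
  fixes f :: "'w \<Rightarrow> 'b::{banach, second_countable_topology}"
  assumes "r \<in> {0..T}" "f \<in> borel_measurable (P r x)" "\<And>\<omega>. \<omega> \<in> space M \<Longrightarrow> norm (f \<omega>) \<le> C"
  shows "norm (\<integral>\<omega>. f \<omega> \<partial>P r x) \<le> C"
proof -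
  interpret prob_space "P r x" by (rule prob[OF assms(1)])
  have "norm (\<integral>\<omega>. f \<omega> \<partial>P r x) \<le> (\<integral>\<omega>. norm (f \<omega>) \<partial>P r x)"
    by (rule integral_norm_bound)
  also have "\<dots> \<le> (\<integral>\<omega>. C \<partial>P r x)"
    using assms by (intro integral_mono integrable_norm integrable_P) (auto simp: space_P)
  finally show ?thesis by (simp add: prob_space)
qed

lemma sigma_finite_subalgebra_P:
  assumes "r \<in> {0..T}" "s \<in> {0..T}"
  shows "sigma_finite_subalgebra (P r x) (F s)"
proof -
  interpret prob_space "P r x" by (rule prob[OF assms(1)])
  have "finite_measure_subalgebra (P r x) (F s)"
    by unfold_locales (rule subalg_P[OF assms])
  then interpret finite_measure_subalgebra "P r x" "F s" .
  show ?thesis by unfold_locales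
qed

lemma subalg_natural: "0 \<le> r \<Longrightarrow> t \<le> T \<Longrightarrow> subalgebra M (natural_sigma M X r t)"
  unfolding subalgebra_def
  by (intro conjI sets_natural_sigma_subset X_measurable) auto

lemma subalg_natural_P: "q \<in> {0..T} \<Longrightarrow> 0 \<le> r \<Longrightarrow> t \<le> T \<Longrightarrow> subalgebra (P q x) (natural_sigma M X r t)"
  using subalg_natural[of r t] by (simp add: subalgebra_def space_P sets_P)

text \<open>Bridges the two Borel structures: a function measurable for the pseudometric can be
  evaluated at (s, X s), where X s is measurable for the topology of S.\<close>

lemma slice_measurable:
  assumes "s \<in> {0..t}" "t \<le> T"
  shows "(\<lambda>x. (s, x)) \<in> borel \<rightarrow>\<^sub>M slab t"
proof -
  have "(\<lambda>x::'s. (s, x)) \<in> borel \<rightarrow>\<^sub>M borel"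
    by (intro borel_measurable_continuous_onI continuous_intros)
  then have "(\<lambda>x::'s. (s, x)) \<in> borel \<rightarrow>\<^sub>M restrict_space borel ({0..t} \<times> UNIV)"
    by (rule measurable_restrict_space2[rotated]) (use assms in auto)
  then show ?thesis
    by (rule measurable_compose[OF _ ident_measurable_pm_borel[OF pseudo]]) (use assms in auto)
qed

text \<open>The process axioms give measurability of transition probabilities set by set; as a
  kernel they can be integrated and composed.\<close>

lemma law_measurable:
  assumes t: "t \<in> {0..T}"
  shows "(\<lambda>(s, x). distr (P s x) borel (X t)) \<in> slab t \<rightarrow>\<^sub>M subprob_algebra borel"
  unfolding case_prod_beta'
proof (rule measurable_subprob_algebra)
  fix p :: "real \<times> 's" assume "p \<in> space (slab t)"
  then obtain s x where p: "p = (s, x)" and s: "0 \<le> s" "s \<le> t"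
    by auto
  then interpret prob_space "P s x" using t by (intro prob) auto
  have "X t \<in> P s x \<rightarrow>\<^sub>M borel"
    using s t by (intro measurable_F_P[OF _ t adapted]) auto
  then show "subprob_space (distr (P (fst p) (snd p)) borel (X t))"
    unfolding p by (simp add: prob_space_imp_subprob_space prob_space_distr)
next
  fix p :: "real \<times> 's" 
  show "sets (distr (P (fst p) (snd p)) borel (X t)) = sets borel"
    by simp
next
  fix A :: "'s set" assume A: "A \<in> sets borel"
  have "(\<lambda>p. ennreal (case p of (s, x) \<Rightarrow> measure (P s x) (X t -` A \<inter> space M)))
      \<in> borel_measurable (slab t)"
    using transition[OF t A] by measurable
  then show "(\<lambda>p. emeasure (distr (P (fst p) (snd p)) borel (X t)) A)
      \<in> borel_measurable (slab t)"
  proof (rule measurable_cong[THEN iffD1, rotated], clarsimp)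
    fix s x assume s: "0 \<le> s" "s \<le> t"
    then interpret prob_space "P s x" using t by (intro prob) auto
    have "X t \<in> P s x \<rightarrow>\<^sub>M borel"
      using s t by (intro measurable_F_P[OF _ t adapted]) auto
    then show "ennreal (measure (P s x) (X t -` A \<inter> space M)) = emeasure (distr (P s x) borel (X t)) A"
      using s t by (simp add: emeasure_distr A emeasure_eq_measure space_P)
  qed
qed

lemma nn_law_measurable:
  assumes t: "t \<in> {0..T}" and h: "h \<in> borel_measurable borel"
  shows "(\<lambda>(s, x). \<integral>\<^sup>+\<omega>. h (X t \<omega>) \<partial>P s x) \<in> borel_measurable (slab t)"
proof -
  have "(\<lambda>p. \<integral>\<^sup>+y. h y \<partial>(case p of (s, x) \<Rightarrow> distr (P s x) borel (X t)))
      \<in> borel_measurable (slab t)"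
    by (rule measurable_compose[OF law_measurable[OF t] nn_integral_measurable_subprob_algebra[OF h]])
  then show ?thesis
  proof (rule measurable_cong[THEN iffD1, rotated], clarsimp)
    fix s x assume "0 \<le> s" "s \<le> t"
    then show "(\<integral>\<^sup>+y. h y \<partial>distr (P s x) borel (X t)) = (\<integral>\<^sup>+\<omega>. h (X t \<omega>) \<partial>P s x)"
      using t h by (intro nn_integral_distr measurable_F_P[OF _ t adapted]) auto
  qed
qed

text \<open>Extends the Markov property from events to nonnegative h. Restricting
  \<open>P r x\<close> to G turns the claim into an identity of measures: the law of X t is a
  mixture of its laws under the restarted process. On Borel sets this is the defining property of
  conditional expectation.\<close>

lemma markov_nn:
  assumes r: "0 \<le> r" "r \<le> s" "s \<le> t" "t \<le> T" and G: "G \<in> sets (F s)"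
    and h: "h \<in> borel_measurable borel"
  shows "(\<integral>\<^sup>+\<omega>. indicator G \<omega> * h (X t \<omega>) \<partial>P r x) =
    (\<integral>\<^sup>+\<omega>. indicator G \<omega> * (\<integral>\<^sup>+\<omega>'. h (X t \<omega>') \<partial>P s (X s \<omega>)) \<partial>P r x)"
proof -
  have m: "r \<in> {0..T}" "s \<in> {0..T}" "t \<in> {0..T}" using r by auto
  interpret prob_space "P r x" by (rule prob[OF m(1)])
  interpret sf: sigma_finite_subalgebra "P r x" "F s"
    by (rule sigma_finite_subalgebra_P[OF m(1,2)])
  have [measurable]: "G \<in> sets (P r x)"
    using G sets_F[OF m(2)] sets_P[OF m(1)] by auto
  have Xt [measurable]: "X t \<in> P r x \<rightarrow>\<^sub>M borel" and Xs [measurable]: "X s \<in> P r x \<rightarrow>\<^sub>M borel"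
    using measurable_F_P[OF m(1,3) adapted[OF m(3)]] measurable_F_P[OF m(1,2) adapted[OF m(2)]] by auto
  let ?L = "density (P r x) (indicator G)"
  let ?k = "\<lambda>\<omega>. distr (P s (X s \<omega>)) borel (X t)"
  have "(\<lambda>y. distr (P s y) borel (X t)) \<in> borel \<rightarrow>\<^sub>M subprob_algebra borel"
    using measurable_compose[OF slice_measurable[of s t] law_measurable[OF m(3)]] r by simp
  from measurable_compose[OF Xs this]
  have k0: "?k \<in> P r x \<rightarrow>\<^sub>M subprob_algebra borel" .
  then have k: "?k \<in> ?L \<rightarrow>\<^sub>M subprob_algebra borel" by simp
  have "distr ?L borel (X t) = ?L \<bind> ?k"
  proof (rule measure_eqI)
    show "sets (distr ?L borel (X t)) = sets (?L \<bind> ?k)"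
      by (subst sets_bind[of _ _ borel]) (auto simp: not_empty)
    fix B assume "B \<in> sets (distr ?L borel (X t))"
    then have B [measurable]: "B \<in> sets borel" by simp
    let ?I = "X t -` B \<inter> space M"
    have I [measurable]: "?I \<in> sets (P r x)"
      using measurable_sets[OF Xt B] by (simp add: space_P[OF m(1)])
    have mB: "(\<lambda>\<omega>. measure (P s (X s \<omega>)) ?I) \<in> borel_measurable (P r x)"
      using measurable_compose[OF Xs measurable_compose[OF slice_measurable[of s t] transition[OF m(3) B]]] r
      by simp
    have ek: "emeasure (?k \<omega>) B = ennreal (measure (P s (X s \<omega>)) ?I)" for \<omega>
    proof -
      interpret Q: prob_space "P s (X s \<omega>)" by (rule prob[OF m(2)])
      show ?thesis
        using measurable_F_P[OF m(2,3) adapted[OF m(3)]]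
        by (simp add: emeasure_distr Q.emeasure_eq_measure space_P[OF m(2)])
    qed
    have "emeasure (distr ?L borel (X t)) B = emeasure (P r x) (G \<inter> ?I)"
    proof -
      have "emeasure (distr ?L borel (X t)) B = emeasure ?L ?I"
        by (subst emeasure_distr) (auto simp: space_P[OF m(1)])
      also have "\<dots> = (\<integral>\<^sup>+\<omega>. indicator (G \<inter> ?I) \<omega> \<partial>P r x)"
        unfolding indicator_inter_arith[of G ?I] by (rule emeasure_density) measurable
      also have "\<dots> = emeasure (P r x) (G \<inter> ?I)"
        by (rule nn_integral_indicator) measurable
      finally show ?thesis .
    qed
    also have "\<dots> = ennreal (\<integral>\<omega>\<in>G. indicator ?I \<omega> \<partial>P r x)"
      by (simp add: set_lebesgue_integral_def indicator_inter_arith[symmetric] emeasure_eq_measure sets.Int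
          del: indicator_inter_arith)
    \<comment> \<open>G lies in \<open>F s\<close>, so the indicator may be replaced by its
      conditional expectation.\<close>
    also have "(\<integral>\<omega>\<in>G. indicator ?I \<omega> \<partial>P r x) = (\<integral>\<omega>\<in>G. real_cond_exp (P r x) (F s) (indicator ?I) \<omega> \<partial>P r x)"
      by (rule sf.real_cond_exp_intA[OF _ G]) (simp add: integrable_indicator_iff emeasure_eq_measure)
    also have "\<dots> = (\<integral>\<omega>. indicator G \<omega> * measure (P s (X s \<omega>)) ?I \<partial>P r x)"
      unfolding set_lebesgue_integral_def
    proof (rule integral_cong_AE)
      show "AE \<omega> in P r x. indicator G \<omega> *\<^sub>R real_cond_exp (P r x) (F s) (indicator ?I) \<omega> =
        indicator G \<omega> * measure (P s (X s \<omega>)) ?I"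
        using markov_prop[OF B r] by eventually_elim simp
      show "(\<lambda>\<omega>. indicator G \<omega> *\<^sub>R real_cond_exp (P r x) (F s) (indicator ?I) \<omega>) \<in> borel_measurable (P r x)"
        by measurable
    qed (use mB in measurable)
    also have "ennreal \<dots> = (\<integral>\<^sup>+\<omega>. ennreal (indicator G \<omega> * measure (P s (X s \<omega>)) ?I) \<partial>P r x)"
    proof (rule nn_integral_eq_integral[symmetric])
      show "integrable (P r x) (\<lambda>\<omega>. indicator G \<omega> * measure (P s (X s \<omega>)) ?I)"
        using mB by (intro integrable_P[OF m(1), where C = 1])
          (auto simp: indicator_def intro!: prob_space.prob_le_1 prob m)
    qed auto
    also have "\<dots> = (\<integral>\<^sup>+\<omega>. indicator G \<omega> * emeasure (?k \<omega>) B \<partial>P r x)"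
      unfolding ek by (intro nn_integral_cong) (auto simp: indicator_def)
    also have "\<dots> = (\<integral>\<^sup>+\<omega>. emeasure (?k \<omega>) B \<partial>?L)"
      using measurable_emeasure_kernel[OF k0 B] by (subst nn_integral_density) auto
    also have "\<dots> = emeasure (?L \<bind> ?k) B"
      by (rule emeasure_bind[OF _ k B, symmetric]) (simp add: not_empty)
    finally show "emeasure (distr ?L borel (X t)) B = emeasure (?L \<bind> ?k) B" .
  qed
  then have "(\<integral>\<^sup>+y. h y \<partial>distr ?L borel (X t)) = (\<integral>\<^sup>+\<omega>. \<integral>\<^sup>+y. h y \<partial>?k \<omega> \<partial>?L)"
    by (simp add: nn_integral_bind[OF h k])
  moreover have "(\<integral>\<^sup>+y. h y \<partial>distr ?L borel (X t)) = (\<integral>\<^sup>+\<omega>. indicator G \<omega> * h (X t \<omega>) \<partial>P r x)"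
    using h by (subst nn_integral_distr) (auto simp: nn_integral_density)
  moreover have "(\<integral>\<^sup>+y. h y \<partial>?k \<omega>) = (\<integral>\<^sup>+\<omega>'. h (X t \<omega>') \<partial>P s (X s \<omega>))" for \<omega>
    using h by (intro nn_integral_distr measurable_F_P[OF m(2,3) adapted[OF m(3)]]) auto
  moreover have "(\<lambda>\<omega>. \<integral>\<^sup>+\<omega>'. h (X t \<omega>') \<partial>P s (X s \<omega>)) \<in> borel_measurable (P r x)"
    using measurable_compose[OF Xs measurable_compose[OF slice_measurable[of s t] nn_law_measurable[OF m(3) h]]] r
    by simp
  ultimately show ?thesis
    by (simp add: nn_integral_density)
qed

end

text \<open>The passage opposite to \<open>ident_measurable_pm_borel_subset\<close>: open sets of A
  have open traces on B, so measurable functions on A restrict to B.\<close>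

lemma ident_measurable_pm_borel_mono:
  assumes "B \<subseteq> A"
  shows "(\<lambda>x. x) \<in> pm_borel d B \<rightarrow>\<^sub>M pm_borel d A"
  unfolding pm_borel_def[of d A]
proof (rule measurable_measure_of)
  fix U assume "U \<in> {U. pm_open d A U}"
  then have "pm_open d B (U \<inter> B)"
    using assms unfolding pm_open_def by blast
  then show "(\<lambda>x. x) -` U \<inter> space (pm_borel d B) \<in> sets (pm_borel d B)"
    by (auto simp: sets_pm_borel)
qed (use assms in \<open>auto simp: pm_open_def\<close>)

section \<open>The Markov property for the whole future\<close>

context markov_setting
begin

text \<open>Induction removes the smallest time j: conditioning at j turns the remaining cylinder
  into a function of X j, and one-time conditioning moves this function to s. Measurability is
  proved along with it, since the next step integrates that function.\<close>

lemma cyl_markov: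
  assumes "finite J" "J \<subseteq> {0..T}" and B: "\<And>s. B s \<in> sets borel"
  shows "t \<in> {0..T} \<Longrightarrow> (\<forall>j\<in>J. t \<le> j) \<Longrightarrow>
    (\<lambda>(s, x). emeasure (P s x) (cyl M X J B)) \<in> borel_measurable (slab t) \<and>
    (\<forall>r s x. \<forall>G\<in>sets (F s). 0 \<le> r \<and> r \<le> s \<and> s \<le> t \<longrightarrow>
      emeasure (P r x) (G \<inter> cyl M X J B) =
      (\<integral>\<^sup>+\<omega>. indicator G \<omega> * emeasure (P s (X s \<omega>)) (cyl M X J B) \<partial>P r x))"
  using assms(1,2)
proof (induction J arbitrary: t rule: finite_linorder_min_induct)
  case empty
  have 1: "emeasure (P s x) (cyl M X {} B) = 1" if "s \<in> {0..T}" for s x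
    using prob_space.emeasure_space_1[OF prob[OF that]] by (simp add: cyl_def space_P[OF that])
  have "(\<lambda>(s, x). emeasure (P s x) (cyl M X {} B)) \<in> borel_measurable (slab t)
    \<longleftrightarrow> (\<lambda>_. 1 :: ennreal) \<in> borel_measurable (pm_borel d ({0..t} \<times> (UNIV :: 's set)))"
    using empty by (intro measurable_cong) (auto intro!: 1)
  moreover have "emeasure (P r x) (G \<inter> cyl M X {} B) =
      (\<integral>\<^sup>+\<omega>. indicator G \<omega> * emeasure (P s (X s \<omega>)) (cyl M X {} B) \<partial>P r x)"
    if "G \<in> sets (F s)" "0 \<le> r" "r \<le> s" "s \<le> t" for r s x G
  proof -
    have rs: "r \<in> {0..T}" "s \<in> {0..T}" using that empty by auto
    have "G \<in> sets (P r x)" using that sets_F[OF rs(2)] sets_P[OF rs(1)] by auto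
    moreover from this have "G \<inter> cyl M X {} B = G"
      using sets.sets_into_space[of G "P r x"] by (auto simp: cyl_def space_P[OF rs(1)])
    ultimately show ?thesis
      by (simp add: 1[OF rs(2)])
  qed
  ultimately show ?case by simp
next
  case (insert j J)
  let ?C = "cyl M X J B" and ?D = "X j -` B j \<inter> space M"
  have j: "j \<in> {0..T}" and J: "J \<subseteq> {0..T}" and tj: "t \<le> j"
    using insert by auto
  have IH1: "(\<lambda>(s, x). emeasure (P s x) ?C) \<in> borel_measurable (slab j)"
    and IH2: "\<And>r s x G. G \<in> sets (F s) \<Longrightarrow> 0 \<le> r \<Longrightarrow> r \<le> s \<Longrightarrow> s \<le> j \<Longrightarrow>
      emeasure (P r x) (G \<inter> ?C) = (\<integral>\<^sup>+\<omega>. indicator G \<omega> * emeasure (P s (X s \<omega>)) ?C \<partial>P r x)"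
    using insert.IH[OF j] J insert.hyps(2) by (auto intro: less_imp_le)
  have eq: "cyl M X (insert j J) B = ?D \<inter> ?C"
    by (auto simp: cyl_def)
  \<comment> \<open>The conditional probability, given X j = y, of the condition at j together with
    all later ones.\<close>
  define h where "h y = indicator (B j) y * emeasure (P j y) ?C" for y
  have h: "h \<in> borel_measurable borel"
    using measurable_compose[OF slice_measurable[of j j] IH1] j B[of j] unfolding h_def by simp
  \<comment> \<open>G and the event at j both lie in \<open>F j\<close>, so the induction hypothesis
    applies at time j although G belongs to the earlier time s.\<close>
  have key: "emeasure (P r x) (G \<inter> cyl M X (insert j J) B) = (\<integral>\<^sup>+\<omega>. indicator G \<omega> * h (X j \<omega>) \<partial>P r x)"
    if "G \<in> sets (F s)" "0 \<le> r" "r \<le> s" "s \<le> j" for r s x G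
  proof -
    have rs: "r \<in> {0..T}" "s \<in> {0..T}" using that j by auto
    have "G \<in> sets (F j)" using filtration[of s j] that j by auto
    moreover have "?D \<in> sets (F j)"
      using measurable_sets[OF adapted[OF j] B[of j]] by (simp add: space_F[OF j])
    ultimately have "G \<inter> ?D \<in> sets (F j)" by auto
    from IH2[OF this, of r x] have "emeasure (P r x) (G \<inter> ?D \<inter> ?C)
      = (\<integral>\<^sup>+\<omega>. indicator (G \<inter> ?D) \<omega> * emeasure (P j (X j \<omega>)) ?C \<partial>P r x)"
      using that by simp
    also have "\<dots> = (\<integral>\<^sup>+\<omega>. indicator G \<omega> * h (X j \<omega>) \<partial>P r x)"
      by (intro nn_integral_cong) (auto simp: h_def space_P[OF rs(1)] indicator_def)
    finally show ?thesis by (simp only: eq Int_assoc)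
  qed
  \<comment> \<open>Taking G to be all of Omega expresses the cylinder probability as an expectation
    of h(X j) for every starting point.\<close>
  have cylD: "emeasure (P s y) (cyl M X (insert j J) B) = (\<integral>\<^sup>+\<omega>. h (X j \<omega>) \<partial>P s y)"
    if "0 \<le> s" "s \<le> j" for s y
  proof -
    have s: "s \<in> {0..T}" using that j by auto
    have "space M \<in> sets (F s)"
      using sets.top[of "F s"] by (simp add: space_F[OF s])
    from key[OF this, of s y]
    have "emeasure (P s y) (space M \<inter> cyl M X (insert j J) B) = (\<integral>\<^sup>+\<omega>. indicator (space M) \<omega> * h (X j \<omega>) \<partial>P s y)"
      using that by simp
    also have "\<dots> = (\<integral>\<^sup>+\<omega>. h (X j \<omega>) \<partial>P s y)"
      by (intro nn_integral_cong) (simp add: space_P[OF s])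
    also have "space M \<inter> cyl M X (insert j J) B = cyl M X (insert j J) B"
      by (auto simp: cyl_def)
    finally show ?thesis .
  qed
  have "(\<lambda>(s, x). \<integral>\<^sup>+\<omega>. h (X j \<omega>) \<partial>P s x) \<in> borel_measurable (slab t)"
    by (rule measurable_compose[OF ident_measurable_pm_borel_mono nn_law_measurable[OF j h]])
      (use tj in auto)
  moreover have "(\<lambda>(s, x). emeasure (P s x) (cyl M X (insert j J) B)) \<in> borel_measurable (slab t)
    \<longleftrightarrow> (\<lambda>(s, x). \<integral>\<^sup>+\<omega>. h (X j \<omega>) \<partial>P s x) \<in> borel_measurable (slab t)"
    using tj by (intro measurable_cong) (auto intro!: cylD)
  moreover have "emeasure (P r x) (G \<inter> cyl M X (insert j J) B) =
      (\<integral>\<^sup>+\<omega>. indicator G \<omega> * emeasure (P s (X s \<omega>)) (cyl M X (insert j J) B) \<partial>P r x)"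
    if "G \<in> sets (F s)" "0 \<le> r" "r \<le> s" "s \<le> t" for r s x G
    using that tj j key[of G s r x] markov_nn[of r s j G h x] by (simp add: cylD h)
  ultimately show ?case by blast
qed

abbreviation future :: "real \<Rightarrow> 'w measure" where
  "future t \<equiv> natural_sigma M X t T"

abbreviation cylinders :: "real \<Rightarrow> 'w set set" where
  "cylinders t \<equiv> {cyl M X J B | J B. finite J \<and> J \<subseteq> {t..T} \<and> (\<forall>s. B s \<in> sets borel)}"

lemma cylinders_subset: "cylinders t \<subseteq> Pow (space M)"
  by (auto simp: cyl_def)

lemma space_in_cylinders: "space M \<in> cylinders t"
  by (auto simp: cyl_def intro!: exI[of _ "{}"] exI[of _ "\<lambda>_. UNIV"])

text \<open>The measures are restricted to the future of t because the cylinders generate there;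
  starting times up to t are those for which \<open>cyl_markov\<close> gives measurability.\<close>

lemma kernel_measurable:
  assumes t: "t \<in> {0..T}"
  shows "(\<lambda>(s, x). restr_to_subalg (P s x) (future t)) \<in> slab t \<rightarrow>\<^sub>M subprob_algebra (future t)"
  unfolding case_prod_beta'
proof (rule measurable_subprob_algebra_generated[OF sets_natural_sigma_cyl Int_stable_cyl cylinders_subset])
  fix p :: "real \<times> 's" assume "p \<in> space (slab t)"
  then have s: "fst p \<in> {0..T}" using t by auto
  have sub: "subalgebra (P (fst p) (snd p)) (future t)"
    using t s by (intro subalg_natural_P) auto
  show "subprob_space (restr_to_subalg (P (fst p) (snd p)) (future t))"
    by (intro prob_space_imp_subprob_space prob_space_restr_to_subalg sub prob s)
  show "sets (restr_to_subalg (P (fst p) (snd p)) (future t)) = sets (future t)"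
    by (rule sets_restr_to_subalg[OF sub])
next
  show *: "(\<lambda>p. emeasure (restr_to_subalg (P (fst p) (snd p)) (future t)) A)
      \<in> borel_measurable (slab t)" if "A \<in> cylinders t" for A
  proof -
    have A: "A \<in> sets (future t)"
      using that unfolding sets_natural_sigma_cyl by blast
    from that obtain J B where A': "A = cyl M X J B" and J: "finite J" "J \<subseteq> {t..T}" "\<And>s. B s \<in> sets borel"
      by blast
    have "(\<lambda>p. emeasure (P (fst p) (snd p)) A) \<in> borel_measurable (slab t)"
      using cyl_markov[of J B t] J t unfolding A' by (force simp: case_prod_beta')
    moreover have "emeasure (restr_to_subalg (P (fst p) (snd p)) (future t)) A = emeasure (P (fst p) (snd p)) A"
      if "p \<in> space (slab t)" for p
      using that t by (intro emeasure_restr_to_subalg subalg_natural_P A) auto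
    ultimately show ?thesis
      by (subst measurable_cong) auto
  qed
  show "(\<lambda>p. emeasure (restr_to_subalg (P (fst p) (snd p)) (future t)) (space M))
      \<in> borel_measurable (slab t)"
    by (rule *[OF space_in_cylinders])
qed

lemma expectation_measurable:
  fixes \<Phi> :: "'w \<Rightarrow> 'b::{banach, second_countable_topology}"
  assumes t: "t \<in> {0..T}" and \<Phi>: "\<Phi> \<in> borel_measurable (future t)"
  shows "(\<lambda>(s, x). \<integral>\<omega>. \<Phi> \<omega> \<partial>P s x) \<in> borel_measurable (slab t)"
proof -
  have "(\<lambda>p. \<integral>\<omega>. \<Phi> \<omega> \<partial>(case p of (s, x) \<Rightarrow> restr_to_subalg (P s x) (future t)))
      \<in> borel_measurable (slab t)"
    by (rule measurable_compose[OF kernel_measurable[OF t] integral_measurable_subprob_algebra[OF \<Phi>]])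
  moreover have "(\<integral>\<omega>. \<Phi> \<omega> \<partial>restr_to_subalg (P s x) (future t)) = (\<integral>\<omega>. \<Phi> \<omega> \<partial>P s x)" if "0 \<le> s" "s \<le> t" for s x
    using that t by (intro integral_subalgebra2 subalg_natural_P \<Phi>) auto
  ultimately show ?thesis
    by (subst measurable_cong[where g = "\<lambda>p. \<integral>\<omega>. \<Phi> \<omega> \<partial>(case p of (s, x) \<Rightarrow> restr_to_subalg (P s x) (future t))"]) auto
qed

lemma expectation_measurable_F:
  fixes \<Phi> :: "'w \<Rightarrow> 'b::{banach, second_countable_topology}"
  assumes s: "s \<in> {0..T}" and \<Phi>: "\<Phi> \<in> borel_measurable (future s)"
  shows "(\<lambda>\<omega>. \<integral>\<omega>'. \<Phi> \<omega>' \<partial>P s (X s \<omega>)) \<in> borel_measurable (F s)"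
  using measurable_compose[OF adapted[OF s] measurable_compose[OF slice_measurable[of s s] expectation_measurable[OF s \<Phi>]]] s
  by simp

text \<open>The argument of \<open>markov_nn\<close> with the whole future in place of X t: two
  finite measures agree on cylinders by \<open>cyl_markov\<close>, and these form a generating
  \<pi>-system.\<close>

lemma markov_future_nn:
  assumes r: "0 \<le> r" "r \<le> s" "s \<le> T" and G: "G \<in> sets (F s)"
    and h: "h \<in> borel_measurable (future s)"
  shows "(\<integral>\<^sup>+\<omega>. indicator G \<omega> * h \<omega> \<partial>P r x) =
    (\<integral>\<^sup>+\<omega>. indicator G \<omega> * (\<integral>\<^sup>+\<omega>'. h \<omega>' \<partial>P s (X s \<omega>)) \<partial>P r x)"
proof -
  have m: "r \<in> {0..T}" "s \<in> {0..T}" using r by auto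
  interpret prob_space "P r x" by (rule prob[OF m(1)])
  have [measurable]: "G \<in> sets (P r x)"
    using G sets_F[OF m(2)] sets_P[OF m(1)] by auto
  have Xs [measurable]: "X s \<in> P r x \<rightarrow>\<^sub>M borel"
    by (rule measurable_F_P[OF m(1,2) adapted[OF m(2)]])
  let ?L = "density (P r x) (indicator G)"
  let ?k = "\<lambda>\<omega>. restr_to_subalg (P s (X s \<omega>)) (future s)"
  have subr: "subalgebra (P r x) (future s)" and subs: "subalgebra (P s y) (future s)" for y
    using m r by (auto intro!: subalg_natural_P)
  have subL: "subalgebra ?L (future s)"
    using subr by (simp add: subalgebra_def)
  have "(\<lambda>y. restr_to_subalg (P s y) (future s)) \<in> borel \<rightarrow>\<^sub>M subprob_algebra (future s)"
    using measurable_compose[OF slice_measurable[of s s] kernel_measurable[OF m(2)]] r by simp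
  from measurable_compose[OF Xs this]
  have k0: "?k \<in> P r x \<rightarrow>\<^sub>M subprob_algebra (future s)" .
  then have k: "?k \<in> ?L \<rightarrow>\<^sub>M subprob_algebra (future s)" by simp
  have "restr_to_subalg ?L (future s) = ?L \<bind> ?k"
  proof (rule measure_eqI_generator_eq[OF Int_stable_cyl cylinders_subset,
        where A = "\<lambda>_. space M"])
    show "sets (restr_to_subalg ?L (future s)) = sigma_sets (space M) (cylinders s)"
      unfolding sets_restr_to_subalg[OF subL] sets_natural_sigma_cyl ..
    show "sets (?L \<bind> ?k) = sigma_sets (space M) (cylinders s)"
      unfolding sets_natural_sigma_cyl[symmetric]
      by (rule sets_bind) (auto simp: not_empty intro!: sets_restr_to_subalg subs)
    show "emeasure (restr_to_subalg ?L (future s)) (space M) \<noteq> \<infinity>" for i :: nat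
    proof -
      have "emeasure (restr_to_subalg ?L (future s)) (space M) = emeasure ?L (space M)"
        using sets.top[of "future s"] by (intro emeasure_restr_to_subalg subL) simp
      also have "\<dots> = (\<integral>\<^sup>+\<omega>. indicator G \<omega> * indicator (space M) \<omega> \<partial>P r x)"
        using sets.top[of "P r x"] by (intro emeasure_density) (auto simp: space_P[OF m(1)])
      also have "\<dots> = (\<integral>\<^sup>+\<omega>. indicator G \<omega> \<partial>P r x)"
        by (intro nn_integral_cong) (simp add: space_P[OF m(1)])
      also have "\<dots> = emeasure (P r x) G"
        by (rule nn_integral_indicator) measurable
      finally show ?thesis by (simp add: emeasure_eq_measure)
    qed
    fix C assume "C \<in> cylinders s"
    then obtain J B where C: "C = cyl M X J B" and J: "finite J" "J \<subseteq> {s..T}" "\<And>s. B s \<in> sets borel"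
      by blast
    have CN: "C \<in> sets (future s)"
      unfolding C by (rule cyl_in_sets[OF J])
    have CP [measurable]: "C \<in> sets (P r x)"
      using CN subr by (auto simp: subalgebra_def)
    have "emeasure (restr_to_subalg ?L (future s)) C = emeasure ?L C"
      by (rule emeasure_restr_to_subalg[OF subL CN])
    also have "\<dots> = (\<integral>\<^sup>+\<omega>. indicator (G \<inter> C) \<omega> \<partial>P r x)"
      unfolding indicator_inter_arith[of G C] by (rule emeasure_density) measurable
    also have "\<dots> = emeasure (P r x) (G \<inter> C)"
      by (rule nn_integral_indicator) measurable
    also have "\<dots> = (\<integral>\<^sup>+\<omega>. indicator G \<omega> * emeasure (P s (X s \<omega>)) C \<partial>P r x)"
      using cyl_markov[of J B s] J m r G unfolding C by (force)
    also have "\<dots> = (\<integral>\<^sup>+\<omega>. indicator G \<omega> * emeasure (?k \<omega>) C \<partial>P r x)"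
      by (simp add: emeasure_restr_to_subalg[OF subs CN])
    also have "\<dots> = (\<integral>\<^sup>+\<omega>. emeasure (?k \<omega>) C \<partial>?L)"
      using measurable_emeasure_kernel[OF k0 CN] by (subst nn_integral_density) auto
    also have "\<dots> = emeasure (?L \<bind> ?k) C"
      by (rule emeasure_bind[OF _ k CN, symmetric]) (simp add: not_empty)
    finally show "emeasure (restr_to_subalg ?L (future s)) C = emeasure (?L \<bind> ?k) C" .
  qed (use space_in_cylinders in auto)
  then have "(\<integral>\<^sup>+\<omega>. h \<omega> \<partial>restr_to_subalg ?L (future s)) = (\<integral>\<^sup>+\<omega>. \<integral>\<^sup>+\<omega>'. h \<omega>' \<partial>?k \<omega> \<partial>?L)"
    by (simp add: nn_integral_bind[OF h k])
  moreover have "(\<integral>\<^sup>+\<omega>. h \<omega> \<partial>restr_to_subalg ?L (future s)) = (\<integral>\<^sup>+\<omega>. indicator G \<omega> * h \<omega> \<partial>P r x)"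
    unfolding nn_integral_subalgebra2[OF subL h]
    using measurable_from_subalg[OF subr h] by (simp add: nn_integral_density)
  moreover have "(\<lambda>\<omega>. \<integral>\<^sup>+\<omega>'. h \<omega>' \<partial>?k \<omega>) \<in> borel_measurable (P r x)"
    by (rule measurable_compose[OF k0 nn_integral_measurable_subprob_algebra[OF h]])
  ultimately show ?thesis
    by (simp add: nn_integral_density nn_integral_subalgebra2[OF subs h])
qed

text \<open>The expectation under the restarted process is a version of the conditional expectation
  of \<Phi> given \<open>F s\<close>, so a bounded weight known at time s can be carried
  along.\<close>

lemma markov_future:
  fixes \<Phi> h :: "'w \<Rightarrow> real"
  assumes r: "0 \<le> r" "r \<le> s" "s \<le> T"
    and \<Phi>: "\<Phi> \<in> borel_measurable (future s)" "\<And>\<omega>. \<omega> \<in> space M \<Longrightarrow> \<bar>\<Phi> \<omega>\<bar> \<le> C"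
    and h: "h \<in> borel_measurable (F s)" "\<And>\<omega>. \<omega> \<in> space M \<Longrightarrow> \<bar>h \<omega>\<bar> \<le> K"
  shows "(\<integral>\<omega>. h \<omega> * \<Phi> \<omega> \<partial>P r x) = (\<integral>\<omega>. h \<omega> * (\<integral>\<omega>'. \<Phi> \<omega>' \<partial>P s (X s \<omega>)) \<partial>P r x)"
proof -
  have m: "r \<in> {0..T}" "s \<in> {0..T}" using r by auto
  interpret prob_space "P r x" by (rule prob[OF m(1)])
  interpret sf: sigma_finite_subalgebra "P r x" "F s"
    by (rule sigma_finite_subalgebra_P[OF m(1,2)])
  have subr: "subalgebra (P q y) (future s)" if "q \<in> {0..T}" for q y
    using that m r by (auto intro!: subalg_natural_P)
  have mP [measurable]: "\<Phi> \<in> borel_measurable (P q y)" if "q \<in> {0..T}" for q y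
    by (rule measurable_from_subalg[OF subr[OF that] \<Phi>(1)])
  have [measurable]: "\<Phi> \<in> borel_measurable (P r x)" by (rule mP[OF m(1)])
  have int: "integrable (P q y) \<Phi>" if "q \<in> {0..T}" for q y
    using \<Phi>(2) by (intro integrable_P mP that) auto
  let ?E = "\<lambda>\<omega>. \<integral>\<omega>'. \<Phi> \<omega>' \<partial>P s (X s \<omega>)"
  have mE: "?E \<in> borel_measurable (F s)"
    by (rule expectation_measurable_F[OF m(2) \<Phi>(1)])
  then have mEP [measurable]: "?E \<in> borel_measurable (P r x)"
    by (rule measurable_F_P[OF m])
  have Ebd: "\<bar>?E \<omega>\<bar> \<le> C" for \<omega>
    using norm_expectation_le[OF m(2) mP[OF m(2)], of C] \<Phi>(2) by simp
  then have Eint: "integrable (P r x) ?E"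
    by (intro integrable_P[OF m(1) mEP, where C = C]) simp
  have "AE \<omega> in P r x. real_cond_exp (P r x) (F s) \<Phi> \<omega> = ?E \<omega>"
  proof (rule sf.real_cond_exp_charact[OF _ int[OF m(1)] Eint mE])
    fix G assume G: "G \<in> sets (F s)"
    have GP [measurable]: "G \<in> sets (P r x)"
      using G sets_F[OF m(2)] sets_P[OF m(1)] by auto
    \<comment> \<open>Adding C makes the integrand nonnegative, which converts Bochner integrals
      into the integrals of \<open>markov_future_nn\<close>.\<close>
    have shift: "(\<integral>\<omega>\<in>G. f \<omega> \<partial>P r x) + C * measure (P r x) G
        = enn2real (\<integral>\<^sup>+\<omega>. indicator G \<omega> * ennreal (f \<omega> + C) \<partial>P r x)"
      if f: "f \<in> borel_measurable (P r x)" "\<And>\<omega>. \<omega> \<in> space M \<Longrightarrow> \<bar>f \<omega>\<bar> \<le> C" for f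
    proof -
      have fi: "integrable (P r x) f"
        using f by (intro integrable_P[OF m(1)]) auto
      have "(\<integral>\<omega>\<in>G. f \<omega> \<partial>P r x) + C * measure (P r x) G = (\<integral>\<omega>. indicator G \<omega> * f \<omega> + indicator G \<omega> * C \<partial>P r x)"
        using integrable_mult_indicator[OF GP fi]
        by (subst Bochner_Integration.integral_add)
          (auto simp: set_lebesgue_integral_def mult.commute emeasure_eq_measure integrable_indicator_iff
            intro!: integrable_mult_left)
      also have "\<dots> = (\<integral>\<omega>. indicator G \<omega> * (f \<omega> + C) \<partial>P r x)"
        by (simp add: distrib_left)
      also have "\<dots> = enn2real (\<integral>\<^sup>+\<omega>. ennreal (indicator G \<omega> * (f \<omega> + C)) \<partial>P r x)"
      proof (rule integral_eq_nn_integral)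
        show "AE \<omega> in P r x. 0 \<le> indicator G \<omega> * (f \<omega> + C)"
          using f(2) space_P[OF m(1)] by (intro AE_I2) (force simp: indicator_def abs_le_iff)
      qed (use f in measurable)
      also have "(\<integral>\<^sup>+\<omega>. ennreal (indicator G \<omega> * (f \<omega> + C)) \<partial>P r x) = (\<integral>\<^sup>+\<omega>. indicator G \<omega> * ennreal (f \<omega> + C) \<partial>P r x)"
        by (intro nn_integral_cong) (auto simp: indicator_def)
      finally show ?thesis .
    qed
    have e: "(\<integral>\<^sup>+\<omega>'. ennreal (\<Phi> \<omega>' + C) \<partial>P s y) = ennreal ((\<integral>\<omega>'. \<Phi> \<omega>' \<partial>P s y) + C)" for y
    proof -
      interpret Q: prob_space "P s y" by (rule prob[OF m(2)])
      have "(\<integral>\<^sup>+\<omega>'. ennreal (\<Phi> \<omega>' + C) \<partial>P s y) = ennreal (\<integral>\<omega>'. \<Phi> \<omega>' + C \<partial>P s y)"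
      proof (rule nn_integral_eq_integral)
        show "AE \<omega>' in P s y. 0 \<le> \<Phi> \<omega>' + C"
          using \<Phi>(2) space_P[OF m(2)] by (intro AE_I2) (force simp: abs_le_iff)
      qed (use int[OF m(2)] in auto)
      then show ?thesis
        using int[OF m(2), of y] by (simp add: Q.prob_space)
    qed
    have "(\<integral>\<omega>\<in>G. \<Phi> \<omega> \<partial>P r x) + C * measure (P r x) G = (\<integral>\<omega>\<in>G. ?E \<omega> \<partial>P r x) + C * measure (P r x) G"
      using markov_future_nn[OF r G, of "\<lambda>\<omega>. ennreal (\<Phi> \<omega> + C)" x] \<Phi>(1)
      by (simp only: shift[OF mP[OF m(1)] \<Phi>(2)] shift[OF mEP Ebd] e) measurable
    then show "(\<integral>\<omega>\<in>G. \<Phi> \<omega> \<partial>P r x) = (\<integral>\<omega>\<in>G. ?E \<omega> \<partial>P r x)" by simp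
  qed
  then have AE: "AE \<omega> in P r x. h \<omega> * real_cond_exp (P r x) (F s) \<Phi> \<omega> = h \<omega> * ?E \<omega>"
    by eventually_elim simp
  have hP [measurable]: "h \<in> borel_measurable (P r x)"
    by (rule measurable_F_P[OF m h(1)])
  have "integrable (P r x) (\<lambda>\<omega>. h \<omega> * \<Phi> \<omega>)"
  proof (rule integrable_P[OF m(1)])
    show "norm (h \<omega> * \<Phi> \<omega>) \<le> K * C" if "\<omega> \<in> space M" for \<omega>
      using h(2)[OF that] \<Phi>(2)[OF that]
      by (auto simp: abs_mult intro!: mult_mono intro: order_trans[OF abs_ge_zero])
  qed measurable
  from sf.real_cond_exp_intg(2)[OF this h(1)]
  have "(\<integral>\<omega>. h \<omega> * \<Phi> \<omega> \<partial>P r x) = (\<integral>\<omega>. h \<omega> * real_cond_exp (P r x) (F s) \<Phi> \<omega> \<partial>P r x)"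
    by simp
  also have "\<dots> = (\<integral>\<omega>. h \<omega> * ?E \<omega> \<partial>P r x)"
    by (rule integral_cong_AE[OF _ _ AE]) measurable
  finally show ?thesis .
qed

end

section \<open>Dependence on the future and exchange with expectations\<close>

context diffuse_measure
begin

text \<open>By \<open>bwd_eq_Sig\<close> only propagators and inhomogeneity on [t,T] enter.
  Truncated to this interval, coefficients along a path are measurable for the future \<sigma>-field
  of t.\<close>

lemma bwd_future:
  assumes \<beta>: "bdd_borel \<beta>" and \<alpha>: "bdd_borel \<alpha>" and t: "t \<le> T"
  shows "bwd \<beta> \<alpha> \<gamma> T t =
    bwd (\<lambda>s. if t \<le> s \<and> s \<le> T then \<beta> s else 0) (\<lambda>s. if t \<le> s \<and> s \<le> T then \<alpha> s else 0) \<gamma> T t"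
proof -
  let ?\<beta> = "\<lambda>s. if t \<le> s \<and> s \<le> T then \<beta> s else 0" and ?\<alpha> = "\<lambda>s. if t \<le> s \<and> s \<le> T then \<alpha> s else 0"
  have b: "bdd_borel ?\<beta>" and a: "bdd_borel ?\<alpha>"
    by (rule bdd_borel_if[OF \<beta>], measurable) (rule bdd_borel_if[OF \<alpha>], measurable)
  have "Sig \<beta> t s = Sig ?\<beta> t s" if "t \<le> s" "s \<le> T" for s
    unfolding Sig_eq_fund[OF \<beta> that(1)] Sig_eq_fund[OF b that(1)] using that by (intro fund_cong) auto
  then show ?thesis
    unfolding bwd_eq_Sig[OF \<beta> \<alpha> t] bwd_eq_Sig[OF b a t]
    using t by (auto intro!: seg_cong arg_cong2[where f = "(-)"])
qed

lemma integral_seg_swap: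
  fixes k :: "real \<Rightarrow> 'w \<Rightarrow> 'b::{banach, second_countable_topology}"
  assumes "prob_space N" and k: "(\<lambda>(s, \<omega>). k s \<omega>) \<in> borel_measurable (borel \<Otimes>\<^sub>M N)"
    and bd: "\<And>s \<omega>. \<omega> \<in> space N \<Longrightarrow> norm (k s \<omega>) \<le> K"
  shows "(\<lambda>\<omega>. seg (\<lambda>s. k s \<omega>) r t) \<in> borel_measurable N"
    and "(\<integral>\<omega>. seg (\<lambda>s. k s \<omega>) r t \<partial>N) = seg (\<lambda>s. \<integral>\<omega>. k s \<omega> \<partial>N) r t"
proof -
  interpret N: prob_space N by fact
  interpret PS: pair_sigma_finite \<nu> N ..
  interpret PF: finite_measure "\<nu> \<Otimes>\<^sub>M N"
    by (rule finite_measure_pair_measure) unfold_locales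
  note k [measurable]
  have [measurable]: "(\<lambda>(s, \<omega>). if r \<le> s \<and> s \<le> t then k s \<omega> else 0) \<in> borel_measurable (borel \<Otimes>\<^sub>M N)"
    by measurable
  show "(\<lambda>\<omega>. seg (\<lambda>s. k s \<omega>) r t) \<in> borel_measurable N"
    unfolding seg_def by measurable
  obtain \<omega>0 where "\<omega>0 \<in> space N"
    using N.not_empty by blast
  then have K: "0 \<le> K"
    using bd[of \<omega>0 0] norm_ge_zero order_trans by blast
  have "integrable (\<nu> \<Otimes>\<^sub>M N) (\<lambda>(s, \<omega>). if r \<le> s \<and> s \<le> t then k s \<omega> else 0)"
  proof (rule PF.integrable_const_bound[where B = K])
    show "AE x in \<nu> \<Otimes>\<^sub>M N. norm (case x of (s, \<omega>) \<Rightarrow> if r \<le> s \<and> s \<le> t then k s \<omega> else 0) \<le> K"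
      using bd K by (intro AE_I2) (auto simp: space_pair_measure)
    show "(\<lambda>(s, \<omega>). if r \<le> s \<and> s \<le> t then k s \<omega> else 0) \<in> borel_measurable (\<nu> \<Otimes>\<^sub>M N)"
      by measurable
  qed
  from PS.Fubini_integral[OF this]
  have "(\<integral>\<omega>. seg (\<lambda>s. k s \<omega>) r t \<partial>N) = (\<integral>s. (\<integral>\<omega>. (if r \<le> s \<and> s \<le> t then k s \<omega> else 0) \<partial>N) \<partial>\<nu>)"
    by (simp add: seg_def)
  also have "\<dots> = seg (\<lambda>s. \<integral>\<omega>. k s \<omega> \<partial>N) r t"
    unfolding seg_def by (intro LINT_cong) auto
  finally show "(\<integral>\<omega>. seg (\<lambda>s. k s \<omega>) r t \<partial>N) = seg (\<lambda>s. \<integral>\<omega>. k s \<omega> \<partial>N) r t" .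
qed

lemma norm_seg_le:
  assumes "\<And>s. norm (f s) \<le> K"
  shows "norm (seg f r t) \<le> K * measure \<nu> UNIV"
proof (cases "integrable \<nu> (\<lambda>s. if r \<le> s \<and> s \<le> t then f s else 0)")
  case True
  have K: "0 \<le> K"
    using assms[of 0] norm_ge_zero order_trans by blast
  have "norm (seg f r t) \<le> (\<integral>s. norm (if r \<le> s \<and> s \<le> t then f s else 0) \<partial>\<nu>)"
    unfolding seg_def by (rule integral_norm_bound)
  also have "\<dots> \<le> (\<integral>s. K \<partial>\<nu>)"
    using True K assms by (intro integral_mono integrable_norm) auto
  finally show ?thesis by (simp add: space_nu mult.commute)
next
  \<comment> \<open>A Bochner integral that does not exist has value 0, so the bound survives
    without measurability of f.\<close>
  case False
  have "0 \<le> K"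
    using assms[of 0] norm_ge_zero order_trans by blast
  then show ?thesis
    using False by (simp add: seg_def not_integrable_integral_eq)
qed

end

section \<open>Path functionals\<close>

context markov_setting
begin

lemma path_measurable:
  fixes \<phi> :: "real \<times> 's \<Rightarrow> 'b::{banach, second_countable_topology}"
  assumes \<phi>: "\<phi> \<in> borel_measurable borel" and r: "0 \<le> r" "r \<le> t" "t \<le> T"
  shows "(\<lambda>(s, \<omega>). if r \<le> s \<and> s \<le> t then \<phi> (s, X s \<omega>) else 0)
    \<in> borel_measurable (borel \<Otimes>\<^sub>M natural_sigma M X r t)"
proof -
  \<comment> \<open>Clamping time to [r,t] gives a map on all real s that uses the path on this
    interval only, where progressive measurability applies.\<close>
  let ?N = "natural_sigma M X r t" and ?p = "\<lambda>s. max r (min s t)"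
  have "?p \<in> borel \<rightarrow>\<^sub>M restrict_space borel {r..t}"
    using r by (intro measurable_restrict_space2) auto
  then have "(\<lambda>x. (?p (fst x), snd x)) \<in> borel \<Otimes>\<^sub>M ?N \<rightarrow>\<^sub>M restrict_space borel {r..t} \<Otimes>\<^sub>M ?N"
    by (intro measurable_Pair measurable_compose[OF measurable_fst]) auto
  moreover have "(\<lambda>(s, \<omega>). X s \<omega>) \<in> restrict_space borel {r..t} \<Otimes>\<^sub>M ?N \<rightarrow>\<^sub>M borel"
    using prog r unfolding progressive_def by blast
  ultimately have [measurable]: "(\<lambda>x. X (?p (fst x)) (snd x)) \<in> borel \<Otimes>\<^sub>M ?N \<rightarrow>\<^sub>M borel"
    using measurable_compose by fastforce
  have "(\<lambda>x. (fst x, X (?p (fst x)) (snd x))) \<in> borel \<Otimes>\<^sub>M ?N \<rightarrow>\<^sub>M borel \<Otimes>\<^sub>M borel"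
    by measurable
  then have "(\<lambda>x. (fst x, X (?p (fst x)) (snd x))) \<in> borel \<Otimes>\<^sub>M ?N \<rightarrow>\<^sub>M borel"
    by (simp add: borel_prod)
  from measurable_compose[OF this \<phi>]
  have [measurable]: "(\<lambda>x. \<phi> (fst x, X (?p (fst x)) (snd x))) \<in> borel_measurable (borel \<Otimes>\<^sub>M ?N)" .
  have "(\<lambda>x. if r \<le> fst x \<and> fst x \<le> t then \<phi> (fst x, X (?p (fst x)) (snd x)) else 0)
      \<in> borel_measurable (borel \<Otimes>\<^sub>M ?N)"
    by measurable
  also have "(\<lambda>x. if r \<le> fst x \<and> fst x \<le> t then \<phi> (fst x, X (?p (fst x)) (snd x)) else 0)
      = (\<lambda>(s, \<omega>). if r \<le> s \<and> s \<le> t then \<phi> (s, X s \<omega>) else 0)"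
    by (auto simp: fun_eq_iff)
  finally show ?thesis .
qed

lemma extend_borel:
  fixes v :: "real \<times> 's \<Rightarrow> 'b::{banach, second_countable_topology}"
  assumes v: "v \<in> borel_measurable (pm_borel d (I \<times> UNIV))" and I: "I \<subseteq> {0..T}" "I \<in> sets borel"
  shows "(\<lambda>p. if fst p \<in> I then v p else 0) \<in> borel_measurable borel"
proof -
  have "(\<lambda>x. x) \<in> restrict_space borel (I \<times> UNIV) \<rightarrow>\<^sub>M pm_borel d (I \<times> UNIV)"
    using I by (intro ident_measurable_pm_borel[OF pseudo]) auto
  from measurable_compose[OF this v]
  have "v \<in> borel_measurable (restrict_space borel (I \<times> UNIV))" by simp
  moreover have "I \<times> UNIV \<in> sets (borel :: (real \<times> 's) measure)"
    unfolding borel_prod[symmetric] using I by auto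
  ultimately have "(\<lambda>p. indicator (I \<times> UNIV) p *\<^sub>R v p) \<in> borel_measurable borel"
    by (simp add: borel_measurable_restrict_space_iff)
  also have "(\<lambda>p. indicator (I \<times> UNIV) p *\<^sub>R v p) = (\<lambda>p. if fst p \<in> I then v p else 0)"
    by (auto simp: fun_eq_iff indicator_def)
  finally show ?thesis .
qed

text \<open>Entrywise reduction to the scalar case, with an entry of B as the weight and a
  coordinate of \<Phi> as the future functional.\<close>

lemma markov_future_matrix:
  fixes \<Phi> :: "'w \<Rightarrow> real^'k" and B :: "'w \<Rightarrow> real^'k^'k"
  assumes r: "0 \<le> r" "r \<le> s" "s \<le> T"
    and \<Phi>: "\<Phi> \<in> borel_measurable (future s)" "\<And>\<omega>. \<omega> \<in> space M \<Longrightarrow> norm (\<Phi> \<omega>) \<le> C"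
    and B: "B \<in> borel_measurable (F s)" "\<And>\<omega>. \<omega> \<in> space M \<Longrightarrow> norm (B \<omega>) \<le> K"
  shows "(\<integral>\<omega>. B \<omega> *v \<Phi> \<omega> \<partial>P r x) = (\<integral>\<omega>. B \<omega> *v (\<integral>\<omega>'. \<Phi> \<omega>' \<partial>P s (X s \<omega>)) \<partial>P r x)"
proof -
  have m: "r \<in> {0..T}" "s \<in> {0..T}" using r by auto
  have mnth: "(\<lambda>\<omega>. f \<omega> $ i) \<in> borel_measurable N" if "f \<in> borel_measurable N"
    for f :: "'w \<Rightarrow> real^'k" and i N
    by (rule measurable_compose[OF that borel_measurable_continuous_onI]) (intro continuous_intros)
  have mnth2: "(\<lambda>\<omega>. f \<omega> $ i $ j) \<in> borel_measurable N" if "f \<in> borel_measurable N"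
    for f :: "'w \<Rightarrow> real^'k^'k" and i j N
    by (rule measurable_compose[OF that borel_measurable_continuous_onI]) (intro continuous_intros)
  let ?E = "\<lambda>\<omega>. \<integral>\<omega>'. \<Phi> \<omega>' \<partial>P s (X s \<omega>)"
  have mE: "?E \<in> borel_measurable (P r x)"
    by (rule measurable_F_P[OF m expectation_measurable_F[OF m(2) \<Phi>(1)]])
  have mB: "B \<in> borel_measurable (P r x)"
    by (rule measurable_F_P[OF m B(1)])
  have subs: "subalgebra (P q y) (future s)" if "q \<in> {0..T}" for q y
    using that m by (auto intro!: subalg_natural_P)
  have m\<Phi>: "\<Phi> \<in> borel_measurable (P q y)" if "q \<in> {0..T}" for q y
    by (rule measurable_from_subalg[OF subs[OF that] \<Phi>(1)])
  have \<Phi>int: "integrable (P s y) \<Phi>" for y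
    by (rule integrable_P[OF m(2) m\<Phi>[OF m(2)] \<Phi>(2)])
  have Ebd: "norm (?E \<omega>) \<le> C" for \<omega>
    by (rule norm_expectation_le[OF m(2) m\<Phi>[OF m(2)] \<Phi>(2)])
  have nth_le: "\<bar>(v :: real^'k) $ i\<bar> \<le> c" if "norm v \<le> c" for v i c
    using component_le_norm_cart[of v i] that by simp
  have nth2_le: "\<bar>(A :: real^'k^'k) $ i $ j\<bar> \<le> c" if "norm A \<le> c" for A i j c
    using component_le_norm_cart[of "A $ i" j] Finite_Cartesian_Product.norm_nth_le[of A i] that by simp
  have int: "integrable (P r x) (\<lambda>\<omega>. B \<omega> *v f \<omega>)" "integrable (P r x) (\<lambda>\<omega>. B \<omega> $ i $ j * f \<omega> $ j)"
    if f: "f \<in> borel_measurable (P r x)" "\<And>\<omega>. \<omega> \<in> space M \<Longrightarrow> norm (f \<omega>) \<le> C" for f i j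
  proof -
    have C: "0 \<le> C" "0 \<le> K" if "\<omega> \<in> space M" for \<omega>
      using order_trans[OF norm_ge_zero f(2)[OF that]] order_trans[OF norm_ge_zero B(2)[OF that]] by auto
    show "integrable (P r x) (\<lambda>\<omega>. B \<omega> *v f \<omega>)"
      using B(2) f(2) C
      by (intro integrable_P[OF m(1), where C = "K * C"] mvmul.borel_measurable_prod mB f(1)
          order_trans[OF norm_matrix_vector_mult_le] mult_mono) auto
    show "integrable (P r x) (\<lambda>\<omega>. B \<omega> $ i $ j * f \<omega> $ j)"
      using nth2_le[OF B(2)] nth_le[OF f(2)] C
      by (intro integrable_P[OF m(1), where C = "K * C"] borel_measurable_times mnth mnth2 mB f(1))
        (auto simp: abs_mult intro!: mult_mono)
  qed
  have comp: "(\<integral>\<omega>. B \<omega> *v f \<omega> \<partial>P r x) $ i = (\<Sum>j\<in>UNIV. \<integral>\<omega>. B \<omega> $ i $ j * f \<omega> $ j \<partial>P r x)"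
    if f: "f \<in> borel_measurable (P r x)" "\<And>\<omega>. \<omega> \<in> space M \<Longrightarrow> norm (f \<omega>) \<le> C" for f i
  proof -
    have "(\<integral>\<omega>. B \<omega> *v f \<omega> \<partial>P r x) $ i = (\<integral>\<omega>. (B \<omega> *v f \<omega>) $ i \<partial>P r x)"
      by (rule integral_bounded_linear[OF bounded_linear_vec_nth int(1)[OF f], symmetric])
    also have "\<dots> = (\<Sum>j\<in>UNIV. \<integral>\<omega>. B \<omega> $ i $ j * f \<omega> $ j \<partial>P r x)"
      unfolding matrix_vector_mult_def
      by (simp add: Bochner_Integration.integral_sum int(2)[OF f])
    finally show ?thesis .
  qed
  have "(\<integral>\<omega>. B \<omega> $ i $ j * \<Phi> \<omega> $ j \<partial>P r x) = (\<integral>\<omega>. B \<omega> $ i $ j * ?E \<omega> $ j \<partial>P r x)" for i j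
  proof -
    have "(\<integral>\<omega>. B \<omega> $ i $ j * \<Phi> \<omega> $ j \<partial>P r x)
        = (\<integral>\<omega>. B \<omega> $ i $ j * (\<integral>\<omega>'. \<Phi> \<omega>' $ j \<partial>P s (X s \<omega>)) \<partial>P r x)"
      by (rule markov_future[OF r mnth[OF \<Phi>(1)] nth_le[OF \<Phi>(2)] mnth2[OF B(1)] nth2_le[OF B(2)]])
    also have "(\<lambda>\<omega>. \<integral>\<omega>'. \<Phi> \<omega>' $ j \<partial>P s (X s \<omega>)) = (\<lambda>\<omega>. ?E \<omega> $ j)"
      by (intro ext integral_bounded_linear[OF bounded_linear_vec_nth \<Phi>int])
    finally show ?thesis by (simp add: fun_eq_iff)
  qed
  then show ?thesis
    by (simp add: vec_eq_iff comp[OF m\<Phi>[OF m(1)] \<Phi>(2)] comp[OF mE Ebd])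
qed

end

section \<open>Linear problems with respect to a finite measure\<close>

text \<open>Here a and b are densities with respect to \<nu>, already rescaled to norm at most 1. As
  they vanish outside [0,T], their integrals from minus infinity effectively start at 0.\<close>

locale linear_setting = markov_setting T d M F X P + diffuse_measure \<nu>
  for T :: real
    and d :: "real \<times> 's::{metric_space, second_countable_topology} \<Rightarrow> real \<times> 's \<Rightarrow> real"
    and M :: "'w measure"
    and F :: "real \<Rightarrow> 'w measure"
    and X :: "real \<Rightarrow> 'w \<Rightarrow> 's"
    and P :: "real \<Rightarrow> 's \<Rightarrow> 'w measure"
    and \<nu> :: "real measure" +
  fixes a :: "real \<times> 's \<Rightarrow> real^'k"
    and b :: "real \<times> 's \<Rightarrow> real^'k^'k"
    and g :: "'s \<Rightarrow> real^'k"
  assumes T_pos: "0 < T"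
    and a_borel: "a \<in> borel_measurable borel" and a_le: "\<And>p. norm (a p) \<le> 1"
    and a_outside: "\<And>s y. s \<notin> {0..T} \<Longrightarrow> a (s, y) = 0"
    and b_borel: "b \<in> borel_measurable borel" and b_le: "\<And>p. norm (b p) \<le> 1"
    and b_outside: "\<And>s y. s \<notin> {0..T} \<Longrightarrow> b (s, y) = 0"
    and g_borel: "g \<in> borel_measurable borel" and g_bounded: "bounded (range g)"
    and g_consistent: "\<And>x y. d (T, x) (T, y) = 0 \<Longrightarrow> g x = g y"
begin

section \<open>The pathwise solution and its expectation\<close>

definition apath :: "'w \<Rightarrow> real \<Rightarrow> real^'k" where
  "apath \<omega> s = a (s, X s \<omega>)"

definition bpath :: "'w \<Rightarrow> real \<Rightarrow> real^'k^'k" where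
  "bpath \<omega> s = b (s, X s \<omega>)"

definition Ypath :: "'w \<Rightarrow> real \<Rightarrow> real^'k" where
  "Ypath \<omega> = bwd (bpath \<omega>) (apath \<omega>) (g (X T \<omega>)) T"

definition u :: "real \<times> 's \<Rightarrow> real^'k" where
  "u = (\<lambda>(r, x). \<integral>\<omega>. Ypath \<omega> r \<partial>P r x)"

lemma T_mem: "T \<in> {0..T}" "0 \<in> {0..T}"
  using T_pos by auto

lemma apath_measurable: "0 \<le> r \<Longrightarrow> r \<le> T \<Longrightarrow>
    (\<lambda>(s, \<omega>). if r \<le> s \<and> s \<le> T then apath \<omega> s else 0) \<in> borel_measurable (borel \<Otimes>\<^sub>M future r)"
  and bpath_measurable: "0 \<le> r \<Longrightarrow> r \<le> T \<Longrightarrow>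
    (\<lambda>(s, \<omega>). if r \<le> s \<and> s \<le> T then bpath \<omega> s else 0) \<in> borel_measurable (borel \<Otimes>\<^sub>M future r)"
  unfolding apath_def bpath_def
  by (rule path_measurable[OF a_borel]; simp) (rule path_measurable[OF b_borel]; simp)

lemma apath_measurable0: "(\<lambda>(s, \<omega>). apath \<omega> s) \<in> borel_measurable (borel \<Otimes>\<^sub>M future 0)"
  and bpath_measurable0: "(\<lambda>(s, \<omega>). bpath \<omega> s) \<in> borel_measurable (borel \<Otimes>\<^sub>M future 0)"
proof -
  have "(if 0 \<le> s \<and> s \<le> T then apath \<omega> s else 0) = apath \<omega> s"
    "(if 0 \<le> s \<and> s \<le> T then bpath \<omega> s else 0) = bpath \<omega> s" for s \<omega>
    using a_outside[of s "X s \<omega>"] b_outside[of s "X s \<omega>"] by (auto simp: apath_def bpath_def)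
  then show "(\<lambda>(s, \<omega>). apath \<omega> s) \<in> borel_measurable (borel \<Otimes>\<^sub>M future 0)"
    "(\<lambda>(s, \<omega>). bpath \<omega> s) \<in> borel_measurable (borel \<Otimes>\<^sub>M future 0)"
    using apath_measurable[of 0] bpath_measurable[of 0] T_pos by simp_all
qed

lemma section_measurable:
  assumes "(\<lambda>(s, \<omega>). k \<omega> s) \<in> borel_measurable (borel \<Otimes>\<^sub>M N)" "\<omega> \<in> space N"
  shows "k \<omega> \<in> borel_measurable borel"
  using measurable_compose[OF measurable_Pair2'[OF assms(2), of borel] assms(1)] by simp

text \<open>Sections of a jointly measurable function are measurable, so the path calculus applies
  to every outcome and not merely to almost every one.\<close>

lemma bdd_borel_apath: "\<omega> \<in> space M \<Longrightarrow> bdd_borel (apath \<omega>)"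
  by (rule bdd_borelI[where K = 1], rule section_measurable[OF apath_measurable0])
    (auto simp: apath_def a_le)

lemma bdd_borel_bpath: "\<omega> \<in> space M \<Longrightarrow> bdd_borel (bpath \<omega>)"
  by (rule bdd_borelI[where K = 1], rule section_measurable[OF bpath_measurable0])
    (auto simp: bpath_def b_le)

lemma gT_measurable: "t \<le> T \<Longrightarrow> (\<lambda>\<omega>. g (X T \<omega>)) \<in> borel_measurable (future t)"
  by (rule measurable_compose[OF measurable_natural_sigma g_borel]) auto

lemma Ypath_measurable: "(\<lambda>(t, \<omega>). Ypath \<omega> t) \<in> borel_measurable (borel \<Otimes>\<^sub>M future 0)"
  unfolding Ypath_def
  using T_pos by (intro bwd_measurable bpath_measurable0 apath_measurable0 gT_measurable) auto

text \<open>\<open>bwd_future\<close> replaces the coefficients by their parts on [t,T], whose joint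
  measurability involves the future \<sigma>-field of t alone.\<close>

lemma Ypath_future:
  assumes t: "t \<in> {0..T}"
  shows "(\<lambda>\<omega>. Ypath \<omega> t) \<in> borel_measurable (future t)"
proof -
  let ?b = "\<lambda>\<omega> s. if t \<le> s \<and> s \<le> T then bpath \<omega> s else 0"
    and ?a = "\<lambda>\<omega> s. if t \<le> s \<and> s \<le> T then apath \<omega> s else 0"
  have "(\<lambda>(q, \<omega>). bwd (?b \<omega>) (?a \<omega>) (g (X T \<omega>)) T q) \<in> borel_measurable (borel \<Otimes>\<^sub>M future t)"
    using t by (intro bwd_measurable bpath_measurable apath_measurable gT_measurable) auto
  from measurable_compose[OF measurable_Pair1' this, of t]
  have "(\<lambda>\<omega>. bwd (?b \<omega>) (?a \<omega>) (g (X T \<omega>)) T t) \<in> borel_measurable (future t)"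
    by simp
  also have "?this \<longleftrightarrow> ?thesis"
    using t by (intro measurable_cong)
      (auto simp: Ypath_def intro!: bwd_future[symmetric] bdd_borel_apath bdd_borel_bpath)
  finally show ?thesis .
qed

lemma Ypath_bound: "\<exists>C\<ge>0. \<forall>\<omega>\<in>space M. \<forall>t. norm (Ypath \<omega> t) \<le> C"
proof -
  obtain G where G: "\<And>y. norm (g y) \<le> G"
    using g_bounded by (auto simp: bounded_iff)
  obtain C where C: "\<And>(\<beta> :: real \<Rightarrow> real^'k^'k) \<alpha> \<gamma> T t. bdd_borel \<beta> \<Longrightarrow> bdd_borel \<alpha> \<Longrightarrow>
      (\<forall>s. norm (\<beta> s) \<le> 1) \<Longrightarrow> (\<forall>s. norm (\<alpha> s) \<le> 1) \<Longrightarrow> norm \<gamma> \<le> G \<Longrightarrow> norm (bwd \<beta> \<alpha> \<gamma> T t) \<le> C"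
    using norm_bwd_le[of G] by blast
  have "norm (Ypath \<omega> t) \<le> C" if "\<omega> \<in> space M" for \<omega> t
    unfolding Ypath_def using that G a_le b_le
    by (intro C bdd_borel_apath bdd_borel_bpath) (auto simp: apath_def bpath_def)
  then show ?thesis
    by (intro exI[of _ "max C 0"]) (auto intro: max.coboundedI1)
qed

definition Ybound :: real where
  "Ybound = (SOME C. 0 \<le> C \<and> (\<forall>\<omega>\<in>space M. \<forall>t. norm (Ypath \<omega> t) \<le> C))"

lemma Ybound: "0 \<le> Ybound" "\<omega> \<in> space M \<Longrightarrow> norm (Ypath \<omega> t) \<le> Ybound"
  using someI_ex[OF Ypath_bound] unfolding Ybound_def by auto

lemma Ypath_measurable_P:
  assumes "r \<in> {0..T}"
  shows "(\<lambda>(t, \<omega>). Ypath \<omega> t) \<in> borel_measurable (borel \<Otimes>\<^sub>M P r x)"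
proof -
  have "(\<lambda>\<omega>. \<omega>) \<in> P r x \<rightarrow>\<^sub>M future 0"
    using T_pos by (intro measurable_from_subalg[OF subalg_natural_P[OF assms, of 0 T x]]) auto
  then have "(\<lambda>p. (fst p, snd p)) \<in> borel \<Otimes>\<^sub>M P r x \<rightarrow>\<^sub>M borel \<Otimes>\<^sub>M future 0"
    by (intro measurable_Pair measurable_fst measurable_compose[OF measurable_snd])
  from measurable_compose[OF this Ypath_measurable] show ?thesis
    by (simp add: case_prod_beta')
qed

lemma Ypath_measurable_P':
  assumes "r \<in> {0..T}"
  shows "(\<lambda>\<omega>. Ypath \<omega> t) \<in> borel_measurable (P r x)"
  using measurable_compose[OF measurable_Pair1'[of t borel] Ypath_measurable_P[OF assms, of x]] by simp

lemma Ypath_integrable: "r \<in> {0..T} \<Longrightarrow> integrable (P r x) (\<lambda>\<omega>. Ypath \<omega> t)"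
  by (rule integrable_P[OF _ Ypath_measurable_P' Ybound(2)])

lemma u_bound: "r \<in> {0..T} \<Longrightarrow> norm (u (r, x)) \<le> Ybound"
  unfolding u_def by (simp add: norm_expectation_le[OF _ Ypath_measurable_P' Ybound(2)])

text \<open>Under \<open>P T x\<close> the point (T, X T) is almost surely at distance 0 from (T,
  x). It need not equal it; consistency of g closes the gap.\<close>

lemma u_terminal: "u (T, x) = g x"
proof -
  interpret prob_space "P T x" by (rule prob[OF T_mem(1)])
  have "u (T, x) = (\<integral>\<omega>. g (X T \<omega>) \<partial>P T x)"
    unfolding u_def using space_P[OF T_mem(1)]
    by (auto intro!: LINT_cong bwd_terminal bdd_borel_bpath simp: Ypath_def)
  also have "\<dots> = (\<integral>\<omega>. g x \<partial>P T x)"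
  proof (rule integral_cong_AE)
    show "AE \<omega> in P T x. g (X T \<omega>) = g x"
      using start[OF T_mem(1), of x] by eventually_elim (use T_pos in \<open>auto intro: g_consistent\<close>)
    show "(\<lambda>\<omega>. g (X T \<omega>)) \<in> borel_measurable (P T x)"
      by (rule measurable_compose[OF measurable_F_P[OF T_mem(1) T_mem(1) adapted[OF T_mem(1)]] g_borel])
  qed auto
  finally show ?thesis by (simp add: prob_space)
qed

text \<open>
  For fixed \<open>q\<close> the map \<open>(r, x) \<mapsto> E\<^sub>r\<^sub>,\<^sub>x[Y\<^sub>q]\<close> is measurable on \<open>[0,q] \<times> S\<close> only, as \<open>Y\<^sub>q\<close> depends on the
  future of \<open>q\<close>. Hence \<open>r\<close> is approximated by grid points from the right, and \<open>Y\<close> is continuous in time.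
\<close>

lemma u_measurable: "u \<in> borel_measurable (slab T)"
proof -
  let ?A = "{0..T} \<times> (UNIV :: 's set)"
  \<comment> \<open>A grid of mesh 1/(n+1), clipped so that rounding up never exceeds T.\<close>
  define q where "q n i = min T (real_of_int i / real (Suc n))" for n :: nat and i :: int
  have fst_meas: "fst \<in> borel_measurable (pm_borel d ?A)"
    using time_borel by (simp add: case_prod_beta')
  \<comment> \<open>The condition on \<open>fst p\<close> confines p to [0,c] x S, where the
    expectation at the fixed time c is measurable. Negative c occur because the grid is indexed by
    all integers.\<close>
  have piece: "(\<lambda>p. if fst p \<le> c then \<integral>\<omega>. Ypath \<omega> c \<partial>P (fst p) (snd p) else 0)
      \<in> borel_measurable (pm_borel d ?A)" if "c \<le> T" for c
  proof (cases "0 \<le> c")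
    case False
    then have "(\<lambda>p. if fst p \<le> c then \<integral>\<omega>. Ypath \<omega> c \<partial>P (fst p) (snd p) else 0)
        \<in> borel_measurable (pm_borel d ?A) \<longleftrightarrow> (\<lambda>_. 0 :: real^'k) \<in> borel_measurable (pm_borel d ?A)"
      by (intro measurable_cong) auto
    then show ?thesis by simp
  next
    case True
    have eq: "(\<lambda>x. x) \<in> restrict_space (pm_borel d ?A) {p. fst p \<le> c} \<rightarrow>\<^sub>M restrict_space (pm_borel d ?A) ({0..c} \<times> UNIV)"
      by (intro measurable_restrict_space2 measurable_restrict_space1) (auto simp: space_restrict_space)
    have m: "(\<lambda>p. \<integral>\<omega>. Ypath \<omega> c \<partial>P (fst p) (snd p)) \<in> borel_measurable (slab c)"
      using expectation_measurable[OF _ Ypath_future, of c] True that by (simp add: case_prod_beta')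
    have "(\<lambda>p. \<integral>\<omega>. Ypath \<omega> c \<partial>P (fst p) (snd p))
        \<in> borel_measurable (restrict_space (pm_borel d ?A) ({0..c} \<times> UNIV))"
      by (rule measurable_compose[OF ident_measurable_pm_borel_subset m])
        (use pseudo that in \<open>auto simp: time_state_pseudometric_def\<close>)
    note measurable_compose[OF eq this]
    moreover have "{p \<in> space (pm_borel d ?A). fst p \<le> c} \<in> sets (pm_borel d ?A)"
      using fst_meas by measurable
    ultimately show ?thesis
      by (subst measurable_If_restrict_space_iff) auto
  qed
  \<comment> \<open>Since r is rounded up, the condition is true on the whole domain; it is there to
    give each piece the form just treated.\<close>
  define v where "v n p = (if fst p \<le> q n \<lceil>fst p * real (Suc n)\<rceil>
      then \<integral>\<omega>. Ypath \<omega> (q n \<lceil>fst p * real (Suc n)\<rceil>) \<partial>P (fst p) (snd p) else 0)" for n p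
  have "v n \<in> borel_measurable (pm_borel d ?A)" for n
    unfolding v_def[abs_def]
  \<comment> \<open>Time is measurable by \<open>time_borel\<close>, hence so is the index of its
    grid point, which takes countably many values.\<close>
  proof (rule measurable_compose_countable'[where I = UNIV
        and f = "\<lambda>i p. if fst p \<le> q n i then \<integral>\<omega>. Ypath \<omega> (q n i) \<partial>P (fst p) (snd p) else 0"
        and g = "\<lambda>p. \<lceil>fst p * real (Suc n)\<rceil>"])
    show "(\<lambda>p. \<lceil>fst p * real (Suc n)\<rceil>) \<in> pm_borel d ?A \<rightarrow>\<^sub>M count_space UNIV"
      using fst_meas by measurable
    show "(\<lambda>p. if fst p \<le> q n i then \<integral>\<omega>. Ypath \<omega> (q n i) \<partial>P (fst p) (snd p) else 0)
        \<in> borel_measurable (pm_borel d ?A)" for i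
      by (rule piece) (simp add: q_def)
  qed simp
  then show ?thesis
  proof (rule borel_measurable_LIMSEQ_metric)
    fix p assume "p \<in> space (pm_borel d ?A)"
    then obtain r x where p: "p = (r, x)" and r: "r \<in> {0..T}" by auto
    let ?q = "\<lambda>n. q n \<lceil>r * real (Suc n)\<rceil>"
    have le: "r \<le> ?q n" "?q n \<le> r + inverse (real (Suc n))" for n
    proof -
      have "r * real (Suc n) \<le> real_of_int \<lceil>r * real (Suc n)\<rceil>"
        by (rule le_of_int_ceiling)
      then show "r \<le> ?q n"
        using r by (simp add: q_def pos_le_divide_eq)
      have "real_of_int \<lceil>r * real (Suc n)\<rceil> \<le> r * real (Suc n) + 1"
        by linarith
      then have "real_of_int \<lceil>r * real (Suc n)\<rceil> / real (Suc n) \<le> (r * real (Suc n) + 1) / real (Suc n)"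
        by (rule divide_right_mono) simp
      also have "\<dots> = r + inverse (real (Suc n))"
        by (simp add: add_divide_distrib inverse_eq_divide del: of_nat_Suc)
      finally show "?q n \<le> r + inverse (real (Suc n))"
        by (simp add: q_def)
    qed
    have "(\<lambda>n. r + inverse (real (Suc n))) \<longlonglongrightarrow> r + 0"
      by (intro tendsto_intros LIMSEQ_inverse_real_of_nat)
    then have q: "?q \<longlonglongrightarrow> r"
      using le by (intro tendsto_sandwich[of "\<lambda>_. r" ?q sequentially "\<lambda>n. r + inverse (real (Suc n))"]) auto
    interpret prob_space "P r x" by (rule prob[OF r])
    have "(\<lambda>n. \<integral>\<omega>. Ypath \<omega> (?q n) \<partial>P r x) \<longlonglongrightarrow> (\<integral>\<omega>. Ypath \<omega> r \<partial>P r x)"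
    proof (rule integral_dominated_convergence[where w = "\<lambda>_. Ybound"])
      show "AE \<omega> in P r x. (\<lambda>n. Ypath \<omega> (?q n)) \<longlonglongrightarrow> Ypath \<omega> r"
      proof (intro AE_I2)
        fix \<omega> assume "\<omega> \<in> space (P r x)"
        then have "\<omega> \<in> space M" using space_P[OF r] by simp
        then have "continuous_on UNIV (Ypath \<omega>)"
          unfolding Ypath_def by (intro bwd_continuous bdd_borel_bpath bdd_borel_apath)
        then show "(\<lambda>n. Ypath \<omega> (?q n)) \<longlonglongrightarrow> Ypath \<omega> r"
          using q by (intro continuous_on_tendsto_compose[of UNIV "Ypath \<omega>"]) auto
      qed
      show "AE \<omega> in P r x. norm (Ypath \<omega> (?q n)) \<le> Ybound" for n
        using Ybound(2) space_P[OF r] by auto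
    qed (use Ypath_integrable[OF r] in auto)
    then show "(\<lambda>n. v n p) \<longlonglongrightarrow> u p"
      using le(1) by (simp add: v_def p u_def)
  qed
qed

section \<open>The integral equation for the expectation\<close>

definition u0 :: "real \<times> 's \<Rightarrow> real^'k" where
  "u0 p = (if fst p \<in> {0..T} then u p else 0)"

lemma u0_borel: "u0 \<in> borel_measurable borel"
  unfolding u0_def by (rule extend_borel[OF u_measurable]) auto

lemma u0_bound: "norm (u0 p) \<le> Ybound"
  using u_bound[of "fst p" "snd p"] Ybound(1) by (auto simp: u0_def)

lemma path_measurable_P:
  fixes \<phi> :: "real \<times> 's \<Rightarrow> 'b::{banach, second_countable_topology}"
  assumes \<phi>: "\<phi> \<in> borel_measurable borel" and r: "q \<in> {0..T}" "0 \<le> r" "r \<le> t" "t \<le> T"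
  shows "(\<lambda>(s, \<omega>). if r \<le> s \<and> s \<le> t then \<phi> (s, X s \<omega>) else 0) \<in> borel_measurable (borel \<Otimes>\<^sub>M P q x)"
proof -
  have "(\<lambda>\<omega>. \<omega>) \<in> P q x \<rightarrow>\<^sub>M natural_sigma M X r t"
    using r by (intro measurable_from_subalg[OF subalg_natural_P[OF r(1), of r t x]]) auto
  then have "(\<lambda>p. (fst p, snd p)) \<in> borel \<Otimes>\<^sub>M P q x \<rightarrow>\<^sub>M borel \<Otimes>\<^sub>M natural_sigma M X r t"
    by (intro measurable_Pair measurable_fst measurable_compose[OF measurable_snd])
  from measurable_compose[OF this path_measurable[OF \<phi> r(2-4)]] show ?thesis
    by (simp add: case_prod_beta')
qed

definition rhs :: "(real \<times> 's \<Rightarrow> real^'k) \<Rightarrow> 'w \<Rightarrow> real \<Rightarrow> real^'k" where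
  "rhs v \<omega> s = a (s, X s \<omega>) + b (s, X s \<omega>) *v v (s, X s \<omega>)"

lemma rhs_measurable:
  assumes v: "v \<in> borel_measurable borel" and r: "q \<in> {0..T}" "0 \<le> r" "r \<le> t" "t \<le> T"
  shows "(\<lambda>(s, \<omega>). if r \<le> s \<and> s \<le> t then rhs v \<omega> s else 0) \<in> borel_measurable (borel \<Otimes>\<^sub>M P q x)"
  unfolding rhs_def
  by (rule path_measurable_P[OF _ r, of "\<lambda>p. a p + b p *v v p"])
    (intro borel_measurable_add mvmul.borel_measurable_prod a_borel b_borel v)

lemma norm_affine_le:
  assumes "norm w \<le> C"
  shows "norm (a p + b p *v w) \<le> 1 + C"
proof -
  have "norm (b p *v w) \<le> 1 * C"
    using assms b_le[of p] by (intro order_trans[OF norm_matrix_vector_mult_le] mult_mono) auto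
  then show ?thesis
    using a_le[of p] by (intro order_trans[OF norm_triangle_ineq] add_mono) auto
qed

lemma bdd_borel_rhs:
  assumes v: "v \<in> borel_measurable borel" "\<And>p. norm (v p) \<le> C" and \<omega>: "\<omega> \<in> space M"
  shows "bdd_borel (rhs v \<omega>)"
proof (rule bdd_borelI)
  have "(\<lambda>p. a p + b p *v v p) \<in> borel_measurable borel"
    by (intro borel_measurable_add mvmul.borel_measurable_prod a_borel b_borel v)
  then have "(\<lambda>(s, \<omega>). if 0 \<le> s \<and> s \<le> T then rhs v \<omega> s else 0) \<in> borel_measurable (borel \<Otimes>\<^sub>M future 0)"
    unfolding rhs_def using T_pos by (intro path_measurable) auto
  from section_measurable[OF this] \<omega>
  have "(\<lambda>s. if 0 \<le> s \<and> s \<le> T then rhs v \<omega> s else 0) \<in> borel_measurable borel" by simp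
  also have "(\<lambda>s. if 0 \<le> s \<and> s \<le> T then rhs v \<omega> s else 0) = rhs v \<omega>"
    using a_outside b_outside by (auto simp: fun_eq_iff rhs_def)
  finally show "rhs v \<omega> \<in> borel_measurable borel" .
  show "norm (rhs v \<omega> s) \<le> 1 + C" for s
    unfolding rhs_def by (rule norm_affine_le[OF v(2)])
qed

lemma u_markov:
  assumes "0 \<le> r" "r \<le> t" "t \<le> T"
  shows "(\<integral>\<omega>. u (t, X t \<omega>) \<partial>P r x) = (\<integral>\<omega>. Ypath \<omega> t \<partial>P r x)"
  using markov_future_matrix[OF assms Ypath_future Ybound(2), of "\<lambda>_. mat 1" "norm (mat 1 :: real^'k^'k)" x] assms
  by (simp add: u_def)

text \<open>b(s, X s) is known at time s, so conditioning acts on Y alone.\<close>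

lemma u_markov_b:
  assumes s: "0 \<le> r" "r \<le> s" "s \<le> T"
  shows "(\<integral>\<omega>. b (s, X s \<omega>) *v u (s, X s \<omega>) \<partial>P r x) = (\<integral>\<omega>. b (s, X s \<omega>) *v Ypath \<omega> s \<partial>P r x)"
proof -
  have "(\<lambda>y::'s. (s, y)) \<in> borel \<rightarrow>\<^sub>M borel"
    by (intro borel_measurable_continuous_onI continuous_intros)
  then have "(\<lambda>y. b (s, y)) \<in> borel_measurable borel"
    by (rule measurable_compose[OF _ b_borel])
  from measurable_compose[OF adapted this, of s]
  have "(\<lambda>\<omega>. b (s, X s \<omega>)) \<in> borel_measurable (F s)" using s by auto
  from markov_future_matrix[OF s Ypath_future Ybound(2) this b_le, of x] s show ?thesis
    by (simp add: u_def)
qed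

text \<open>The expectation of the pathwise equation. After exchanging expectation and time
  integral, the Markov property at each fixed s replaces Y at time s by u(s, X s).\<close>

lemma u_equation:
  assumes r: "0 \<le> r" "r \<le> t" "t \<le> T"
  shows "(\<integral>\<omega>. u (t, X t \<omega>) \<partial>P r x) = u (r, x) + (\<integral>\<omega>. seg (rhs u0 \<omega>) r t \<partial>P r x)"
proof -
  have rT: "r \<in> {0..T}" using r by auto
  interpret prob_space "P r x" by (rule prob[OF rT])
  \<comment> \<open>The first integrand contains the pathwise solution, the second one its
    conditional expectation u; it is their expectations that agree.\<close>
  let ?k1 = "\<lambda>s \<omega>. if r \<le> s \<and> s \<le> t then apath \<omega> s + bpath \<omega> s *v Ypath \<omega> s else 0"
    and ?k2 = "\<lambda>s \<omega>. if r \<le> s \<and> s \<le> t then rhs u0 \<omega> s else 0"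
  note [measurable] = path_measurable_P[OF a_borel rT r, of x] path_measurable_P[OF b_borel rT r, of x]
    Ypath_measurable_P[OF rT, of x]
  have "(\<lambda>(s, \<omega>). (if r \<le> s \<and> s \<le> t then a (s, X s \<omega>) else 0) +
      (if r \<le> s \<and> s \<le> t then b (s, X s \<omega>) else 0) *v Ypath \<omega> s) \<in> borel_measurable (borel \<Otimes>\<^sub>M P r x)"
    by measurable
  also have "(\<lambda>(s, \<omega>). (if r \<le> s \<and> s \<le> t then a (s, X s \<omega>) else 0) +
      (if r \<le> s \<and> s \<le> t then b (s, X s \<omega>) else 0) *v Ypath \<omega> s) = (\<lambda>(s, \<omega>). ?k1 s \<omega>)"
    by (auto simp: fun_eq_iff apath_def bpath_def)
  finally have k1: "(\<lambda>(s, \<omega>). ?k1 s \<omega>) \<in> borel_measurable (borel \<Otimes>\<^sub>M P r x)" .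
  have k2: "(\<lambda>(s, \<omega>). ?k2 s \<omega>) \<in> borel_measurable (borel \<Otimes>\<^sub>M P r x)"
    by (rule rhs_measurable[OF u0_borel rT r])
  have bd1: "norm (?k1 s \<omega>) \<le> 1 + Ybound" if "\<omega> \<in> space (P r x)" for s \<omega>
    using norm_affine_le[OF Ybound(2), of \<omega>] that Ybound(1) by (auto simp: space_P[OF rT] apath_def bpath_def)
  have bd2: "norm (?k2 s \<omega>) \<le> 1 + Ybound" for s \<omega>
    using norm_affine_le[OF u0_bound] Ybound(1) by (auto simp: rhs_def)
  have sec: "(\<lambda>\<omega>. k s \<omega>) \<in> borel_measurable (P r x)"
    if "(\<lambda>(s, \<omega>). k s \<omega>) \<in> borel_measurable (borel \<Otimes>\<^sub>M P r x)" for k :: "real \<Rightarrow> 'w \<Rightarrow> real^'k" and s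
    using measurable_compose[OF measurable_Pair1'[of s borel] that] by simp
  have inner: "(\<integral>\<omega>. ?k1 s \<omega> \<partial>P r x) = (\<integral>\<omega>. ?k2 s \<omega> \<partial>P r x)" for s
  proof (cases "r \<le> s \<and> s \<le> t")
    case True
    then have s: "r \<le> s" "s \<le> T" and sT: "s \<in> {0..T}" using r by auto
    note slice = time_state_measurable[OF rT sT]
    have ia: "integrable (P r x) (\<lambda>\<omega>. a (s, X s \<omega>))"
      by (rule integrable_P[OF rT measurable_compose[OF slice a_borel] a_le])
    have bv: "norm (b p *v w) \<le> Ybound" if "norm w \<le> Ybound" for w p
      using that b_le[of p] by (intro order_trans[OF norm_matrix_vector_mult_le mult_mono[of _ 1 _ Ybound, simplified]]) auto
    have ib: "integrable (P r x) (\<lambda>\<omega>. b (s, X s \<omega>) *v Ypath \<omega> s)"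
      by (rule integrable_P[OF rT mvmul.borel_measurable_prod[OF measurable_compose[OF slice b_borel]
          Ypath_measurable_P'[OF rT]] bv[OF Ybound(2)]])
    have iu: "integrable (P r x) (\<lambda>\<omega>. b (s, X s \<omega>) *v u0 (s, X s \<omega>))"
      by (rule integrable_P[OF rT mvmul.borel_measurable_prod[OF measurable_compose[OF slice b_borel]
          measurable_compose[OF slice u0_borel]] bv[OF u0_bound]])
    have "(\<integral>\<omega>. b (s, X s \<omega>) *v u0 (s, X s \<omega>) \<partial>P r x) = (\<integral>\<omega>. b (s, X s \<omega>) *v Ypath \<omega> s \<partial>P r x)"
      using u_markov_b[OF r(1) s, of x] sT by (simp add: u0_def)
    then show ?thesis
      using True by (simp add: rhs_def apath_def bpath_def Bochner_Integration.integral_add[OF ia ib]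
          Bochner_Integration.integral_add[OF ia iu])
  qed auto
  have seg_k: "seg (\<lambda>s. if r \<le> s \<and> s \<le> t then f s else 0) r t = seg f r t" for f :: "real \<Rightarrow> real^'k"
    by (rule seg_cong) simp
  let ?S1 = "\<lambda>\<omega>. seg (\<lambda>s. ?k1 s \<omega>) r t" and ?S2 = "\<lambda>\<omega>. seg (\<lambda>s. ?k2 s \<omega>) r t"
  note sw1 = integral_seg_swap[OF prob_space_axioms k1 bd1]
  have "(\<integral>\<omega>. u (t, X t \<omega>) \<partial>P r x) = (\<integral>\<omega>. Ypath \<omega> t \<partial>P r x)"
    by (rule u_markov[OF r])
  also have "\<dots> = (\<integral>\<omega>. Ypath \<omega> r + ?S1 \<omega> \<partial>P r x)"
  proof (intro LINT_cong refl)
    fix \<omega> assume "\<omega> \<in> space (P r x)"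
    then have "\<omega> \<in> space M" by (simp add: space_P[OF rT])
    then show "Ypath \<omega> t = Ypath \<omega> r + ?S1 \<omega>"
      unfolding seg_k Ypath_def by (intro bwd_seg bdd_borel_apath bdd_borel_bpath r)
  qed
  also have "\<dots> = u (r, x) + (\<integral>\<omega>. ?S1 \<omega> \<partial>P r x)"
  proof -
    have "integrable (P r x) ?S1"
    proof (rule integrable_P[OF rT sw1(1)])
      show "norm (?S1 \<omega>) \<le> (1 + Ybound) * measure \<nu> UNIV" if "\<omega> \<in> space M" for \<omega>
        using that by (intro norm_seg_le bd1) (simp add: space_P[OF rT])
    qed
    then show ?thesis
      by (subst Bochner_Integration.integral_add) (auto simp: u_def Ypath_integrable[OF rT])
  qed
  also have "(\<integral>\<omega>. ?S1 \<omega> \<partial>P r x) = (\<integral>\<omega>. ?S2 \<omega> \<partial>P r x)"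
  proof -
    have "(\<integral>\<omega>. ?S1 \<omega> \<partial>P r x) = seg (\<lambda>s. \<integral>\<omega>. ?k1 s \<omega> \<partial>P r x) r t"
      by (rule sw1(2))
    also have "\<dots> = seg (\<lambda>s. \<integral>\<omega>. ?k2 s \<omega> \<partial>P r x) r t"
      by (simp only: inner)
    also have "\<dots> = (\<integral>\<omega>. ?S2 \<omega> \<partial>P r x)"
      by (rule integral_seg_swap(2)[OF prob_space_axioms k2 bd2, symmetric])
    finally show ?thesis .
  qed
  finally show ?thesis unfolding seg_k .
qed

text \<open>Subtracting the two equations cancels g and a and leaves the integral of b (v - u);
  since |b| \<le> 1, this is the Gronwall step with weight one.\<close>

lemma solution_unique:
  assumes r0: "0 \<le> r0" and v: "v \<in> borel_measurable borel" and K: "\<And>p. norm (v p) \<le> K"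
    and eq: "\<And>r x. r0 \<le> r \<Longrightarrow> r \<le> T \<Longrightarrow>
      (\<integral>\<omega>. g (X T \<omega>) \<partial>P r x) = v (r, x) + (\<integral>\<omega>. seg (rhs v \<omega>) r T \<partial>P r x)"
    and r: "r0 \<le> r" "r \<le> T"
  shows "v (r, x) = u (r, x)"
proof -
  let ?N = "\<lambda>s x. norm (v (s, x) - u0 (s, x))"
  have K0: "0 \<le> K"
    using K[of undefined] norm_ge_zero order_trans by blast
  have step: "?N s x \<le> seg \<phi> s T"
    if \<phi>: "bdd_borel \<phi>" and le: "\<And>q y. r0 \<le> q \<Longrightarrow> q \<le> T \<Longrightarrow> ?N q y \<le> \<phi> q"
      and s: "r0 \<le> s" "s \<le> T" for \<phi> s x
  proof -
    have sT: "s \<in> {0..T}" "0 \<le> s" using s r0 by auto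
    interpret prob_space "P s x" by (rule prob[OF sT(1)])
    have k: "(\<lambda>(q, \<omega>). if s \<le> q \<and> q \<le> T then rhs w \<omega> q else 0) \<in> borel_measurable (borel \<Otimes>\<^sub>M P s x)"
      if "w \<in> borel_measurable borel" for w
      by (rule rhs_measurable[OF that sT s(2)]) simp
    have seg_k: "seg (\<lambda>q. if s \<le> q \<and> q \<le> T then f q else 0) s T = seg f s T" for f :: "real \<Rightarrow> real^'k"
      by (rule seg_cong) simp
    have bd: "norm (if s \<le> q \<and> q \<le> T then rhs w \<omega> q else 0) \<le> 1 + C"
      if "\<And>p. norm (w p) \<le> C" for w q \<omega> C
      using norm_affine_le[OF that] that[of undefined] order_trans[OF norm_ge_zero that[of undefined]]
      by (auto simp: rhs_def)
    have int: "integrable (P s x) (\<lambda>\<omega>. seg (rhs w \<omega>) s T)"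
      if w: "w \<in> borel_measurable borel" "\<And>p. norm (w p) \<le> C" for w C
    proof (rule integrable_P[OF sT(1)])
      show "norm (seg (rhs w \<omega>) s T) \<le> (1 + C) * measure \<nu> UNIV" for \<omega>
        using norm_affine_le[OF w(2)] by (intro norm_seg_le) (simp add: rhs_def)
      show "(\<lambda>\<omega>. seg (rhs w \<omega>) s T) \<in> borel_measurable (P s x)"
        using integral_seg_swap(1)[OF prob_space_axioms k[OF w(1)] bd[OF w(2)], of s T] unfolding seg_k .
    qed
    have "(\<integral>\<omega>. u (T, X T \<omega>) \<partial>P s x) = u (s, x) + (\<integral>\<omega>. seg (rhs u0 \<omega>) s T \<partial>P s x)"
      using u_equation[of s T x] sT s by simp
    then have eu: "(\<integral>\<omega>. g (X T \<omega>) \<partial>P s x) = u0 (s, x) + (\<integral>\<omega>. seg (rhs u0 \<omega>) s T \<partial>P s x)"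
      using sT by (simp add: u_terminal u0_def)
    have "v (s, x) - u0 (s, x) = (\<integral>\<omega>. seg (rhs u0 \<omega>) s T - seg (rhs v \<omega>) s T \<partial>P s x)"
      using eu eq[OF s, of x]
      by (simp add: Bochner_Integration.integral_diff[OF int[OF u0_borel u0_bound] int[OF v K]] algebra_simps)
    moreover have "norm \<dots> \<le> seg \<phi> s T"
    proof (rule norm_expectation_le[OF sT(1)])
      show "(\<lambda>\<omega>. seg (rhs u0 \<omega>) s T - seg (rhs v \<omega>) s T) \<in> borel_measurable (P s x)"
        by (intro borel_measurable_diff borel_measurable_integrable int[OF u0_borel u0_bound] int[OF v K])
      fix \<omega> assume \<omega>: "\<omega> \<in> space M"
      note bdd = bdd_borel_rhs[OF u0_borel u0_bound \<omega>] bdd_borel_rhs[OF v K \<omega>]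
      show "norm (seg (rhs u0 \<omega>) s T - seg (rhs v \<omega>) s T) \<le> seg \<phi> s T"
        unfolding seg_diff[OF bdd]
      proof (rule norm_seg_le_seg[OF _ \<phi>])
        show "bdd_borel (\<lambda>q. rhs u0 \<omega> q - rhs v \<omega> q)"
          using bdd_borel_add[OF bdd(1) bdd_borel_minus[OF bdd(2)]] by simp
        fix q assume q: "s \<le> q" "q \<le> T"
        let ?p = "(q, X q \<omega>)"
        have "norm (rhs u0 \<omega> q - rhs v \<omega> q) = norm (b ?p *v (u0 ?p - v ?p))"
          by (simp add: rhs_def mvmul.diff_right)
        also have "\<dots> \<le> 1 * ?N q (X q \<omega>)"
          using b_le[of ?p]
          by (intro order_trans[OF norm_matrix_vector_mult_le] mult_mono) (auto simp: norm_minus_commute)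
        also have "\<dots> \<le> \<phi> q"
          using le[of q "X q \<omega>"] q s by simp
        finally show "norm (rhs u0 \<omega> q - rhs v \<omega> q) \<le> \<phi> q" .
      qed
    qed
    ultimately show ?thesis by simp
  qed
  have "?N s x \<le> K + Ybound" for s x
    by (intro order_trans[OF norm_triangle_ineq4] add_mono K u0_bound)
  then have "?N r x \<le> 0"
    using backward_gronwall[of r0 T ?N "K + Ybound" r x] step K0 Ybound(1) r by auto
  then show ?thesis
    using r r0 by (simp add: u0_def)
qed

text \<open>\<open>Sig_eq_fund\<close> and \<open>fund_cong\<close> exhibit the propagator as the
  fundamental matrix of the coefficient cut to [r,t], and \<open>fund_measurable\<close> applies to
  that.\<close>

lemma Sig_measurable:
  assumes r: "0 \<le> r" "r \<le> t" "t \<le> T"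
  shows "(\<lambda>\<omega>. Sig (bpath \<omega>) r t) \<in> borel_measurable (natural_sigma M X r t)"
proof -
  let ?b = "\<lambda>\<omega> s. if r \<le> s \<and> s \<le> t then b (s, X s \<omega>) else 0"
  have "(\<lambda>(q, \<omega>). fund (?b \<omega>) q) \<in> borel_measurable (borel \<Otimes>\<^sub>M natural_sigma M X r t)"
    by (rule fund_measurable[OF path_measurable[OF b_borel r]])
  from measurable_compose[OF measurable_Pair1' this, of t]
  have "(\<lambda>\<omega>. fund (?b \<omega>) t) \<in> borel_measurable (natural_sigma M X r t)" by simp
  also have "?this \<longleftrightarrow> ?thesis"
  proof (rule measurable_cong)
    fix \<omega> assume "\<omega> \<in> space (natural_sigma M X r t)"
    then have "Sig (bpath \<omega>) r t = fund (\<lambda>s. if r \<le> s then bpath \<omega> s else 0) t"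
      by (intro Sig_eq_fund bdd_borel_bpath r) simp
    also have "\<dots> = fund (?b \<omega>) t"
      by (intro fund_cong) (simp add: bpath_def)
    finally show "fund (?b \<omega>) t = Sig (bpath \<omega>) r t" ..
  qed
  finally show ?thesis .
qed

text \<open>The interface to problem (M): along every path, integrals of f against \<mu> are
  integrals of \<open>rhs\<close> against \<nu>. It is stated for total bounded Borel v, for which
  composition with paths is measurable.\<close>

definition represents :: "real measure \<Rightarrow> (real \<Rightarrow> 's \<Rightarrow> real^'k \<Rightarrow> real^'k) \<Rightarrow> bool" where
  "represents \<mu> f \<longleftrightarrow> (\<forall>r t \<omega> v. 0 \<le> r \<longrightarrow> r \<le> t \<longrightarrow> t \<le> T \<longrightarrow> \<omega> \<in> space M \<longrightarrow>
     v \<in> borel_measurable borel \<longrightarrow> bounded (range v) \<longrightarrow>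
     set_integrable \<mu> {r..t} (\<lambda>s. f s (X s \<omega>) (v (s, X s \<omega>))) \<and>
     (LINT s:{r..t}|\<mu>. f s (X s \<omega>) (v (s, X s \<omega>))) = seg (rhs v \<omega>) r t \<and>
     (LINT s:{r..t}|\<mu>. norm (f s (X s \<omega>) (v (s, X s \<omega>)))) = seg (\<lambda>s. norm (rhs v \<omega> s)) r t)"

text \<open>A solution is only known on its own interval; on [r,t] it may be replaced by a total
  bounded Borel function.\<close>

lemma representsD:
  assumes "represents \<mu> f" "0 \<le> r" "r \<le> t" "t \<le> T" "\<omega> \<in> space M"
    and v0: "v0 \<in> borel_measurable borel" "bounded (range v0)"
    and eq: "\<And>s y. s \<in> {r..t} \<Longrightarrow> v (s, y) = v0 (s, y)"
  shows "set_integrable \<mu> {r..t} (\<lambda>s. f s (X s \<omega>) (v (s, X s \<omega>)))"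
    and "(LINT s:{r..t}|\<mu>. f s (X s \<omega>) (v (s, X s \<omega>))) = seg (rhs v0 \<omega>) r t"
    and "(LINT s:{r..t}|\<mu>. norm (f s (X s \<omega>) (v (s, X s \<omega>)))) = seg (\<lambda>s. norm (rhs v0 \<omega> s)) r t"
proof -
  have *: "indicator {r..t} s *\<^sub>R f s (X s \<omega>) (v (s, X s \<omega>)) = indicator {r..t} s *\<^sub>R f s (X s \<omega>) (v0 (s, X s \<omega>))"
    "indicator {r..t} s *\<^sub>R norm (f s (X s \<omega>) (v (s, X s \<omega>))) = indicator {r..t} s *\<^sub>R norm (f s (X s \<omega>) (v0 (s, X s \<omega>)))"
    for s
    using eq[of s "X s \<omega>"] by (auto simp: indicator_def)
  show "set_integrable \<mu> {r..t} (\<lambda>s. f s (X s \<omega>) (v (s, X s \<omega>)))"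
    and "(LINT s:{r..t}|\<mu>. f s (X s \<omega>) (v (s, X s \<omega>))) = seg (rhs v0 \<omega>) r t"
    and "(LINT s:{r..t}|\<mu>. norm (f s (X s \<omega>) (v (s, X s \<omega>)))) = seg (\<lambda>s. norm (rhs v0 \<omega> s)) r t"
    using assms(1-5) v0 unfolding represents_def set_integrable_def set_lebesgue_integral_def *
    by blast+
qed

lemma u0_bounded: "bounded (range u0)"
  using u0_bound by (auto simp: bounded_iff)

lemma u_solution:
  assumes rep: "represents \<mu> f"
  shows "admissible_solution_M T d \<mu> M X P UNIV f g {0..T} u"
  unfolding admissible_solution_M_def solution_M_def
proof (intro conjI ballI allI impI)
  show "admissible_interval T {0..T}"
    using T_pos by (auto simp: admissible_interval_def)
  show "consistent_on d ({0..T} \<times> UNIV) u"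
    using pseudo u_measurable by (intro consistent_onI_measurable) (auto simp: time_state_pseudometric_def)
  show "u \<in> borel_measurable (slab T)"
    by (rule u_measurable)
  show "u (T, x) = g x" for x
    by (rule u_terminal)
  show "compact (closure (u ` ({r..T} \<times> UNIV)))" if "r \<in> {0..T}" for r
  proof -
    have "bounded (u ` ({r..T} \<times> UNIV))"
      using that u_bound unfolding bounded_iff by (intro exI[of _ Ybound]) auto
    then show ?thesis by simp
  qed
next
  fix r t :: real and x assume r: "r \<in> {0..T}" and t: "t \<in> {0..T}" and rt: "r \<le> t"
  interpret prob_space "P r x" by (rule prob[OF r])
  have uu0: "u (s, y) = u0 (s, y)" if "s \<in> {r..t}" for s y
    using that r t by (simp add: u0_def)
  have r': "0 \<le> r" "t \<le> T" using r t by auto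
  note R = representsD[OF rep r'(1) rt r'(2) _ u0_borel u0_bounded uu0]
  have "integrable (P r x) (\<lambda>\<omega>. u0 (t, X t \<omega>))"
    by (rule integrable_P[OF r measurable_compose[OF time_state_measurable[OF r t] u0_borel] u0_bound])
  then show "integrable (P r x) (\<lambda>\<omega>. norm (u (t, X t \<omega>)))"
    using rt by (simp add: uu0)
  show "set_integrable \<mu> {r..t} (\<lambda>s. f s (X s \<omega>) (u (s, X s \<omega>)))" if "\<omega> \<in> space M" for \<omega>
    by (rule R(1)[OF that])
  have bd: "norm (rhs u0 \<omega> s) \<le> 1 + Ybound" for \<omega> s
    using norm_affine_le[OF u0_bound] by (simp add: rhs_def)
  have "(\<lambda>(s, \<omega>). norm (if r \<le> s \<and> s \<le> t then rhs u0 \<omega> s else 0)) \<in> borel_measurable (borel \<Otimes>\<^sub>M P r x)"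
    using rhs_measurable[OF u0_borel r r'(1) rt r'(2)] by measurable
  then have "(\<lambda>\<omega>. seg (\<lambda>s. norm (if r \<le> s \<and> s \<le> t then rhs u0 \<omega> s else 0)) r t) \<in> borel_measurable (P r x)"
    by (rule integral_seg_swap(1)[OF prob_space_axioms _ ]) (use bd Ybound(1) in auto)
  also have "(\<lambda>\<omega>. seg (\<lambda>s. norm (if r \<le> s \<and> s \<le> t then rhs u0 \<omega> s else 0)) r t)
      = (\<lambda>\<omega>. seg (\<lambda>s. norm (rhs u0 \<omega> s)) r t)"
    by (intro ext seg_cong) simp
  finally have m: "(\<lambda>\<omega>. seg (\<lambda>s. norm (rhs u0 \<omega> s)) r t) \<in> borel_measurable (P r x)" .
  have "norm (seg (\<lambda>s. norm (rhs u0 \<omega> s)) r t) \<le> (1 + Ybound) * measure \<nu> UNIV" for \<omega>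
    using bd by (intro norm_seg_le) simp
  then have "integrable (P r x) (\<lambda>\<omega>. seg (\<lambda>s. norm (rhs u0 \<omega> s)) r t)"
    by (rule integrable_P[OF r m])
  also have "?this \<longleftrightarrow> integrable (P r x) (\<lambda>\<omega>. LINT s:{r..t}|\<mu>. norm (f s (X s \<omega>) (u (s, X s \<omega>))))"
    by (intro Bochner_Integration.integrable_cong refl R(3)[symmetric]) (simp add: space_P[OF r])
  finally show "integrable (P r x) (\<lambda>\<omega>. LINT s:{r..t}|\<mu>. norm (f s (X s \<omega>) (u (s, X s \<omega>))))" .
  have "(\<integral>\<omega>. seg (rhs u0 \<omega>) r t \<partial>P r x) = (LINT \<omega>|P r x. (LINT s:{r..t}|\<mu>. f s (X s \<omega>) (u (s, X s \<omega>))))"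
    by (intro LINT_cong refl R(2)[symmetric]) (simp add: space_P[OF r])
  then show "(LINT \<omega>|P r x. u (t, X t \<omega>)) =
      u (r, x) + (LINT \<omega>|P r x. (LINT s:{r..t}|\<mu>. f s (X s \<omega>) (u (s, X s \<omega>))))"
    using u_equation[OF r'(1) rt r'(2), of x] by simp
qed auto

lemma admissible_interval_subset:
  assumes "admissible_interval T J"
  shows "J \<subseteq> {0..T}" "J \<in> sets borel" "r \<in> J \<Longrightarrow> {r..T} \<subseteq> J" "T \<in> J"
  using assms by (auto simp: admissible_interval_def)

text \<open>Relative compactness of the values on [r,T] gives a bound there, so v cut off to [r,T]
  falls under \<open>solution_unique\<close> with left end r. The bound may depend on r, which
  covers intervals open on the left.\<close>

lemma admissible_solution_eq_u:
  assumes rep: "represents \<mu> f"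
    and sol: "admissible_solution_M T d \<mu> M X P UNIV f g J v" and r: "r \<in> J"
  shows "v (r, x) = u (r, x)"
proof -
  have J: "admissible_interval T J"
    and vm: "v \<in> borel_measurable (pm_borel d (J \<times> UNIV))"
    and vT: "\<And>x. v (T, x) = g x"
    and veq: "\<And>q t x. q \<in> J \<Longrightarrow> t \<in> J \<Longrightarrow> q \<le> t \<Longrightarrow> (LINT \<omega>|P q x. v (t, X t \<omega>)) =
      v (q, x) + (LINT \<omega>|P q x. (LINT s:{q..t}|\<mu>. f s (X s \<omega>) (v (s, X s \<omega>))))"
    and comp: "\<And>q. q \<in> J \<Longrightarrow> compact (closure (v ` ({q..T} \<times> UNIV)))"
    using sol unfolding admissible_solution_M_def solution_M_def by blast+
  note J' = admissible_interval_subset[OF J]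
  have r': "0 \<le> r" "r \<le> T" and rJ: "{r..T} \<subseteq> J" using J'(1,3) r by auto
  have "bounded (v ` ({r..T} \<times> UNIV))"
    using comp[OF r] by simp
  then obtain K where K: "\<And>s y. s \<in> {r..T} \<Longrightarrow> norm (v (s, y)) \<le> K"
    by (force simp: bounded_iff)
  define v0 where "v0 p = (if fst p \<in> {r..T} then v p else 0)" for p
  have v0_borel: "v0 \<in> borel_measurable borel"
  proof -
    have "{r..T} \<times> UNIV \<in> sets (borel :: (real \<times> 's) measure)"
      unfolding borel_prod[symmetric] by auto
    from borel_measurable_scaleR[OF borel_measurable_indicator[OF this] extend_borel[OF vm J'(1,2)]]
    have "(\<lambda>p. indicator ({r..T} \<times> UNIV) p *\<^sub>R (if fst p \<in> J then v p else 0)) \<in> borel_measurable borel" .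
    also have "(\<lambda>p. indicator ({r..T} \<times> UNIV) p *\<^sub>R (if fst p \<in> J then v p else 0)) = v0"
      using rJ by (auto simp: v0_def fun_eq_iff indicator_def)
    finally show ?thesis .
  qed
  have "norm (v (r, undefined)) \<le> K"
    using r' by (intro K) auto
  then have "0 \<le> K"
    using norm_ge_zero order_trans by blast
  then have v0_le: "norm (v0 p) \<le> K" for p
    using K[of "fst p" "snd p"] by (auto simp: v0_def)
  then have v0_bdd: "bounded (range v0)"
    by (auto simp: bounded_iff)
  have "v0 (r, x) = u (r, x)"
  proof (rule solution_unique[OF r'(1) v0_borel v0_le])
    fix q x assume q: "r \<le> q" "q \<le> T"
    then have qT: "q \<in> {0..T}" and qJ: "q \<in> J" using r' rJ by auto
    have "v (s, y) = v0 (s, y)" if "s \<in> {q..T}" for s y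
      using that q by (simp add: v0_def)
    note R = representsD(2)[OF rep _ q(2) order_refl _ v0_borel v0_bdd this]
    have "(LINT \<omega>|P q x. (LINT s:{q..T}|\<mu>. f s (X s \<omega>) (v (s, X s \<omega>)))) = (\<integral>\<omega>. seg (rhs v0 \<omega>) q T \<partial>P q x)"
      using qT by (intro LINT_cong refl R) (simp_all add: space_P[OF qT])
    then show "(\<integral>\<omega>. g (X T \<omega>) \<partial>P q x) = v0 (q, x) + (\<integral>\<omega>. seg (rhs v0 \<omega>) q T \<partial>P q x)"
      using veq[OF qJ J'(4) q(2), of x] q by (simp add: vT v0_def)
  qed (use r' in auto)
  then show ?thesis
    using r' by (simp add: v0_def)
qed

lemma u_nonextendible:
  assumes rep: "represents \<mu> f"
  shows "nonextendible_admissible_solution_M T d \<mu> M X P UNIV f g {0..T} u"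
  unfolding nonextendible_admissible_solution_M_def extendible_M_def
  using u_solution[OF rep] admissible_interval_subset(1)
  by (auto simp: admissible_solution_M_def solution_M_def)

text \<open>Any admissible solution agrees with u, so on a smaller interval u itself would extend
  it.\<close>

lemma nonextendible_unique:
  assumes rep: "represents \<mu> f"
    and sol: "nonextendible_admissible_solution_M T d \<mu> M X P UNIV f g J v"
  shows "J = {0..T}" "\<forall>p\<in>J \<times> UNIV. v p = u p"
proof -
  have adm: "admissible_solution_M T d \<mu> M X P UNIV f g J v"
    using sol by (simp add: nonextendible_admissible_solution_M_def)
  show vu: "\<forall>p\<in>J \<times> UNIV. v p = u p"
    using admissible_solution_eq_u[OF rep adm] by auto
  have "J \<subseteq> {0..T}"
    using adm admissible_interval_subset(1) by (auto simp: admissible_solution_M_def solution_M_def)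
  moreover have "\<not> J \<subset> {0..T}"
    using sol vu u_solution[OF rep]
    unfolding nonextendible_admissible_solution_M_def extendible_M_def by blast
  ultimately show "J = {0..T}" by blast
qed

lemma u_eq_Sig:
  assumes r: "r \<in> {0..T}"
  shows "u (r, x) = (\<integral>\<omega>. Sig (bpath \<omega>) r T *v g (X T \<omega>) \<partial>P r x)
    - (\<integral>\<omega>. seg (\<lambda>s. Sig (bpath \<omega>) r s *v apath \<omega> s) r T \<partial>P r x)"
proof -
  interpret prob_space "P r x" by (rule prob[OF r])
  let ?A = "\<lambda>\<omega>. Sig (bpath \<omega>) r T *v g (X T \<omega>)"
    and ?B = "\<lambda>\<omega>. seg (\<lambda>s. Sig (bpath \<omega>) r s *v apath \<omega> s) r T"
  obtain G where G: "\<And>y. norm (g y) \<le> G"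
    using g_bounded by (auto simp: bounded_iff)
  have bwd: "Ypath \<omega> r = ?A \<omega> - ?B \<omega>" if "\<omega> \<in> space M" for \<omega>
    unfolding Ypath_def using r that by (intro bwd_eq_Sig bdd_borel_bpath bdd_borel_apath) auto
  have sub: "subalgebra (P r x) (future r)"
    using r by (intro subalg_natural_P) auto
  have iA: "integrable (P r x) ?A"
  proof (rule integrable_P[OF r])
    let ?K = "sqrt (real CARD('k)) * exp (1 * measure \<nu> UNIV)"
    fix \<omega> assume "\<omega> \<in> space M"
    then have bp: "bdd_borel (bpath \<omega>)" by (rule bdd_borel_bpath)
    have "norm (Sig (bpath \<omega>) r T) \<le> norm (fund_inv (bpath \<omega>) r) * norm (fund (bpath \<omega>) T)"
      unfolding Sig_def by (rule norm_matrix_mult_le)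
    also have "\<dots> \<le> ?K * ?K"
      using b_le by (intro mult_mono norm_fund_inv_le_uniform norm_fund_le_uniform bp) (auto simp: bpath_def)
    finally show "norm (?A \<omega>) \<le> ?K * ?K * G"
      using G by (intro order_trans[OF norm_matrix_vector_mult_le] mult_mono) auto
  qed (use r in \<open>auto intro!: mvmul.borel_measurable_prod measurable_from_subalg[OF sub] Sig_measurable gT_measurable\<close>)
  \<comment> \<open>Integrability of the second summand is inherited from the first one and from Y,
    without a direct bound.\<close>
  have "integrable (P r x) (\<lambda>\<omega>. ?A \<omega> - Ypath \<omega> r)"
    by (intro Bochner_Integration.integrable_diff iA Ypath_integrable r)
  also have "?this \<longleftrightarrow> integrable (P r x) ?B"
    using bwd by (intro Bochner_Integration.integrable_cong) (auto simp: space_P[OF r])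
  finally have iB: "integrable (P r x) ?B" .
  have "u (r, x) = (\<integral>\<omega>. ?A \<omega> - ?B \<omega> \<partial>P r x)"
    using bwd by (auto simp: u_def space_P[OF r] intro!: LINT_cong)
  also have "\<dots> = (\<integral>\<omega>. ?A \<omega> \<partial>P r x) - (\<integral>\<omega>. ?B \<omega> \<partial>P r x)"
    by (rule Bochner_Integration.integral_diff[OF iA iB])
  finally show ?thesis .
qed

end

section \<open>Change of measure\<close>

text \<open>A point of positive mass would be an atom, its only subsets being itself and the empty
  set.\<close>

lemma atomless_singleton:
  assumes "borel_measure_on T \<mu>" "atomless \<mu>"
  shows "emeasure \<mu> {x} = 0"
proof (rule ccontr)
  assume "emeasure \<mu> {x} \<noteq> 0"
  moreover from this have "{x} \<in> sets \<mu>"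
    using emeasure_notin_sets by blast
  moreover have "emeasure \<mu> B = 0 \<or> emeasure \<mu> ({x} - B) = 0" if "B \<subseteq> {x}" for B
    using that by (cases "B = {}") (auto simp: subset_singleton_iff)
  ultimately have "measure_atom \<mu> {x}"
    by (simp add: measure_atom_def zero_less_iff_neq_zero)
  with assms(2) show False
    by (auto simp: atomless_def)
qed

text \<open>
  \<open>\<mu>\<close> need not be \<open>\<sigma>\<close>-finite, but \<open>c \<mu>\<close> is a finite measure when \<open>c\<close> is integrable, and a dominated
  map has a density with respect to it.
\<close>

definition weighted :: "real measure \<Rightarrow> (real \<Rightarrow> real) \<Rightarrow> real measure" where
  "weighted \<mu> c = distr (density \<mu> (\<lambda>s. ennreal (c s))) borel (\<lambda>s. s)"

context
  fixes T :: real and \<mu> :: "real measure" and c :: "real \<Rightarrow> real"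
  assumes mu: "borel_measure_on T \<mu>" "atomless \<mu>"
    and c: "integrable \<mu> c" "\<forall>s\<in>{0..T}. 0 \<le> c s"
begin

lemma space_mu: "space \<mu> = {0..T}"
proof -
  have "sets \<mu> = sets (restrict_space borel {0..T})"
    using mu(1) by (simp add: borel_measure_on_def)
  from sets_eq_imp_space_eq[OF this] show ?thesis
    by (simp add: space_restrict_space)
qed

lemma measurable_mu:
  assumes "f \<in> borel \<rightarrow>\<^sub>M N"
  shows "f \<in> \<mu> \<rightarrow>\<^sub>M N"
proof -
  have "sets \<mu> = sets (restrict_space borel {0..T})"
    using mu(1) by (simp add: borel_measure_on_def)
  then have "\<mu> \<rightarrow>\<^sub>M N = restrict_space borel {0..T} \<rightarrow>\<^sub>M N"
    by (rule measurable_cong_sets) simp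
  then show ?thesis
    using assms by (simp add: measurable_restrict_space1)
qed

text \<open>The total mass is the integral of c. Points of [0,T] are null by absolute continuity
  with respect to \<mu>, and other points have empty preimage.\<close>

lemma diffuse_weighted: "diffuse_measure (weighted \<mu> c)"
proof (intro diffuse_measure.intro diffuse_measure_axioms.intro finite_measureI)
  have id: "(\<lambda>s. s) \<in> density \<mu> (\<lambda>s. ennreal (c s)) \<rightarrow>\<^sub>M borel"
    using measurable_mu[of "\<lambda>s. s" borel] by simp
  have cm [measurable]: "c \<in> borel_measurable \<mu>"
    using c(1) by simp
  have "emeasure (weighted \<mu> c) (space (weighted \<mu> c)) = (\<integral>\<^sup>+s. ennreal (c s) \<partial>\<mu>)"
    using sets.top[of \<mu>]
    by (simp add: weighted_def emeasure_distr[OF id] emeasure_density cong: nn_integral_cong)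
  also have "\<dots> = ennreal (\<integral>s. c s \<partial>\<mu>)"
    using c by (intro nn_integral_eq_integral) (auto simp: space_mu)
  finally show "emeasure (weighted \<mu> c) (space (weighted \<mu> c)) \<noteq> \<infinity>"
    by simp
  show "sets (weighted \<mu> c) = sets borel"
    by (simp add: weighted_def)
  fix x
  have "emeasure (weighted \<mu> c) {x} = emeasure (density \<mu> (\<lambda>s. ennreal (c s))) ({x} \<inter> {0..T})"
    unfolding weighted_def by (subst emeasure_distr[OF id]) (auto simp: space_mu)
  also have "\<dots> = 0"
  proof (cases "x \<in> {0..T}")
    case True
    then have "{x} \<in> sets \<mu>"
      using mu(1) by (auto simp: borel_measure_on_def sets_restrict_space_iff)
    then have "{x} \<in> null_sets \<mu>"
      using atomless_singleton[OF mu] by auto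
    moreover have "absolutely_continuous \<mu> (density \<mu> (\<lambda>s. ennreal (c s)))"
      by (intro absolutely_continuousI_density) measurable
    ultimately show ?thesis
      using True by (auto simp: absolutely_continuous_def)
  qed auto
  finally show "emeasure (weighted \<mu> c) {x} = 0" .
qed

text \<open>The factor c is absorbed into the measure by integration against a density, which is
  legitimate for arbitrary \<mu>. Integrability of \<phi> is a conclusion, coming from boundedness
  of \<phi>' and finiteness of the weighted measure.\<close>

lemma weighted_integral:
  fixes \<phi> \<phi>' :: "real \<Rightarrow> 'b::{banach, second_countable_topology}"
  assumes r: "0 \<le> r" "t \<le> T" and \<phi>': "bdd_borel \<phi>'" and \<phi>: "\<phi> \<in> borel_measurable \<mu>"
    and eq: "AE s in \<mu>. \<phi> s = c s *\<^sub>R \<phi>' s"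
  shows "set_integrable \<mu> {r..t} \<phi>"
    and "(LINT s:{r..t}|\<mu>. \<phi> s) = diffuse_measure.seg (weighted \<mu> c) \<phi>' r t"
proof -
  interpret diffuse_measure "weighted \<mu> c" by (rule diffuse_weighted)
  let ?h = "\<lambda>s. if r \<le> s \<and> s \<le> t then \<phi>' s else 0"
  have h: "bdd_borel ?h"
    by (rule bdd_borel_if[OF \<phi>']) measurable
  have id: "(\<lambda>s. s) \<in> density \<mu> (\<lambda>s. ennreal (c s)) \<rightarrow>\<^sub>M borel"
    using measurable_mu[of "\<lambda>s. s" borel] by simp
  have hm: "?h \<in> borel_measurable borel"
    by (rule bdd_borel_measurable[OF h])
  have cm: "c \<in> borel_measurable \<mu>" and cpos: "AE s in \<mu>. 0 \<le> c s"
    using c by (auto simp: space_mu)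
  have hmu: "?h \<in> borel_measurable \<mu>"
    by (rule measurable_mu[OF hm])
  have rt: "{r..t} \<in> sets \<mu>"
    using mu(1) r by (auto simp: borel_measure_on_def sets_restrict_space_iff)
  have ae: "AE s in \<mu>. c s *\<^sub>R ?h s = indicator {r..t} s *\<^sub>R \<phi> s"
    using eq by eventually_elim (auto simp: indicator_def)
  have m: "(\<lambda>s. indicator {r..t} s *\<^sub>R \<phi> s) \<in> borel_measurable \<mu>"
    by (intro borel_measurable_scaleR borel_measurable_indicator rt \<phi>)
  have m': "(\<lambda>s. c s *\<^sub>R ?h s) \<in> borel_measurable \<mu>"
    by (intro borel_measurable_scaleR cm hmu)
  have "integrable (weighted \<mu> c) ?h"
    by (rule integrable_bdd[OF h])
  then have "integrable \<mu> (\<lambda>s. c s *\<^sub>R ?h s)"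
    unfolding weighted_def integrable_distr_eq[OF id hm]
    by (simp only: integrable_density[OF hmu cm cpos])
  then show "set_integrable \<mu> {r..t} \<phi>"
    unfolding set_integrable_def using integrable_cong_AE[OF m' m ae] by blast
  have "diffuse_measure.seg (weighted \<mu> c) \<phi>' r t = (\<integral>s. c s *\<^sub>R ?h s \<partial>\<mu>)"
    unfolding seg_def unfolding weighted_def integral_distr[OF id hm]
    by (rule integral_density[OF hmu cm cpos])
  also have "\<dots> = (LINT s:{r..t}|\<mu>. \<phi> s)"
    unfolding set_lebesgue_integral_def by (rule integral_cong_AE[OF m' m ae])
  finally show "(LINT s:{r..t}|\<mu>. \<phi> s) = diffuse_measure.seg (weighted \<mu> c) \<phi>' r t" ..
qed

end

theorem proposition2p11:
  fixes T :: real
    and \<mu> :: "real measure"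
    and d :: "real \<times> 's::{metric_space, second_countable_topology} \<Rightarrow> real \<times> 's \<Rightarrow> real"
    and M :: "'w measure"
    and F :: "real \<Rightarrow> 'w measure"
    and X :: "real \<Rightarrow> 'w \<Rightarrow> 's"
    and P :: "real \<Rightarrow> 's \<Rightarrow> 'w measure"
    and f :: "real \<Rightarrow> 's \<Rightarrow> real^'k \<Rightarrow> real^'k"
    and g :: "'s \<Rightarrow> real^'k"
    and a :: "real \<times> 's \<Rightarrow> real^'k"
    and b :: "real \<times> 's \<Rightarrow> real^'k^'k"
  assumes T_pos: "0 < T"
    and mu: "borel_measure_on T \<mu>" "atomless \<mu>"
    and d: "time_state_pseudometric T d"
    and time_borel: "(\<lambda>(r, x). r) \<in> borel_measurable (pm_borel d ({0..T} \<times> UNIV))"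
    and markov: "markov_process T d M F X P" "progressive T M X"
    and g_borel: "g \<in> borel_measurable borel" "bounded (range g)"
    and g_consistent: "\<forall>x y. d (T, x) (T, y) = 0 \<longrightarrow> g x = g y"
    and a: "a \<in> borel_measurable (pm_borel d ({0..T} \<times> UNIV))" "dominated T \<mu> a"
    and b: "b \<in> borel_measurable (pm_borel d ({0..T} \<times> UNIV))" "dominated T \<mu> b"
    and f: "\<forall>t\<in>{0..T}. \<forall>x w. f t x w = a (t, x) + b (t, x) *v w"
  shows "\<exists>I\<^sub>g u\<^sub>g.
     nonextendible_admissible_solution_M T d \<mu> M X P UNIV f g I\<^sub>g u\<^sub>g \<and>
     (\<forall>J v. nonextendible_admissible_solution_M T d \<mu> M X P UNIV f g J v \<longrightarrow>
              J = I\<^sub>g \<and> (\<forall>p\<in>J \<times> UNIV. v p = u\<^sub>g p)) \<and>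
     I\<^sub>g = {0..T} \<and>
     (\<exists>\<Sigma> :: real \<Rightarrow> real \<Rightarrow> 'w \<Rightarrow> real^'k^'k.
       (\<forall>r\<in>{0..T}. \<forall>x.
          u\<^sub>g (r, x) =
            (LINT \<omega>|P r x. \<Sigma> r T \<omega> *v g (X T \<omega>)) -
            (LINT \<omega>|P r x. (LINT t:{r..T}|\<mu>. \<Sigma> r t \<omega> *v a (t, X t \<omega>)))) \<and>
       (\<forall>r t. 0 \<le> r \<and> r \<le> t \<and> t \<le> T \<longrightarrow>
          \<Sigma> r t \<in> borel_measurable (natural_sigma M X r t) \<and>
          (\<forall>\<omega>\<in>space M.
             norm (\<Sigma> r t \<omega>) \<le> sqrt (real CARD('k)) *
               exp (LINT s:{r..t}|\<mu>. norm (b (s, X s \<omega>))))) \<and>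
       (\<forall>\<omega>\<in>space M. continuous_on ({0..T} \<times> {0..T}) (\<lambda>(r, t). \<Sigma> r t \<omega>)) \<and>
       (\<forall>\<omega>\<in>space M. \<forall>r\<in>{0..T}. \<forall>s\<in>{0..T}. \<forall>t\<in>{0..T}.
          \<Sigma> r r \<omega> = mat 1 \<and>
          \<Sigma> r s \<omega> ** \<Sigma> s t \<omega> = \<Sigma> r t \<omega> \<and>
          invertible (\<Sigma> r t \<omega>) \<and> matrix_inv (\<Sigma> r t \<omega>) = \<Sigma> t r \<omega>) \<and>
       ((\<forall>p\<in>{0..T} \<times> UNIV. \<forall>q\<in>{0..T} \<times> UNIV. b p ** b q = b q ** b p) \<longrightarrow>
          (\<forall>r t. 0 \<le> r \<and> r \<le> t \<and> t \<le> T \<longrightarrow>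
             (\<forall>\<omega>\<in>space M.
                \<Sigma> r t \<omega> = matrix_exp (- (LINT s:{r..t}|\<mu>. b (s, X s \<omega>)))))))"
proof -
  interpret MS: markov_setting T d M F X P
    by (rule markov_setting.intro[OF d time_borel markov])
  obtain abar where abar: "integrable \<mu> abar" "\<forall>s\<in>{0..T}. 0 \<le> abar s" "AE s in \<mu>. \<forall>y. norm (a (s, y)) \<le> abar s"
    using a(2) unfolding dominated_def by blast
  obtain bbar where bbar: "integrable \<mu> bbar" "\<forall>s\<in>{0..T}. 0 \<le> bbar s" "AE s in \<mu>. \<forall>y. norm (b (s, y)) \<le> bbar s"
    using b(2) unfolding dominated_def by blast
  \<comment> \<open>One weight for both coefficients: the sum dominates each of them.\<close>
  define c where "c s = abar s + bbar s" for s
  have c: "integrable \<mu> c" "\<forall>s\<in>{0..T}. 0 \<le> c s"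
    using abar bbar by (auto simp: c_def[abs_def])
  note space_mu = space_mu[OF mu c] and measurable_mu = measurable_mu[OF mu c]
  have "AE s in \<mu>. \<forall>y. norm (a (s, y)) \<le> c s \<and> norm (b (s, y)) \<le> c s"
    using abar(3) bbar(3) AE_space
  proof eventually_elim
    case (elim s)
    have "s \<in> {0..T}"
      using elim(3) by (simp only: space_mu)
    then have "0 \<le> abar s" "0 \<le> bbar s"
      using abar(2) bbar(2) by blast+
    then show ?case
      using elim(1,2) unfolding c_def
      by (intro allI conjI; metis add.commute add_increasing)
  qed
  \<comment> \<open>The bounds hold for all states at once outside a single null set of times, so
    that off N they can be used pointwise.\<close>
  then obtain N where N: "N \<in> null_sets \<mu>"
    and "{s \<in> space \<mu>. \<not> (\<forall>y. norm (a (s, y)) \<le> c s \<and> norm (b (s, y)) \<le> c s)} \<subseteq> N"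
    unfolding eventually_ae_filter by blast
  then have good: "norm (a (s, y)) \<le> c s \<and> norm (b (s, y)) \<le> c s" if "s \<in> {0..T} - N" for s y
    using that unfolding space_mu by blast
  \<comment> \<open>Measurability of c is known on [0,T]; extended by 0 it is Borel on the
    line.\<close>
  let ?c0 = "\<lambda>s. indicator {0..T} s *\<^sub>R c s"
  have c0: "?c0 \<in> borel_measurable borel"
  proof -
    have "sets \<mu> = sets (restrict_space borel {0..T})"
      using mu(1) by (simp add: borel_measure_on_def)
    then have "c \<in> borel_measurable (restrict_space borel {0..T})"
      using borel_measurable_integrable[OF c(1)] measurable_cong_sets[of \<mu> "restrict_space borel {0..T}" borel borel] by blast
    then show ?thesis
      by (subst (asm) borel_measurable_restrict_space_iff) auto
  qed
  have N_borel: "N \<in> sets borel"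
    using N mu(1) by (auto simp: borel_measure_on_def sets_restrict_space_iff null_sets_def)
  \<comment> \<open>This is 1/c at times of [0,T] off N where c is positive, and 0 elsewhere. If c
    vanishes at a time off N, then so do a and b by domination, and multiplying the rescaled
    coefficients by c still recovers them.\<close>
  define \<kappa> where "\<kappa> s = (if s \<in> {0..T} \<and> s \<notin> N \<and> 0 < ?c0 s then 1 / ?c0 s else 0)" for s
  have [measurable]: "\<kappa> \<in> borel_measurable borel"
    unfolding \<kappa>_def[abs_def] using c0 N_borel by measurable
  have \<kappa>f: "(\<lambda>p :: real \<times> 's. \<kappa> (fst p)) \<in> borel_measurable borel"
    using measurable_compose[OF measurable_fst, of \<kappa> borel borel "borel :: 's measure"] by (simp add: borel_prod)
  define a' where "a' p = \<kappa> (fst p) *\<^sub>R (if fst p \<in> {0..T} then a p else 0)" for p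
  define b' where "b' p = \<kappa> (fst p) *\<^sub>R (if fst p \<in> {0..T} then b p else 0)" for p
  have a'_borel: "a' \<in> borel_measurable borel" and b'_borel: "b' \<in> borel_measurable borel"
    unfolding a'_def[abs_def] b'_def[abs_def]
    by (intro borel_measurable_scaleR \<kappa>f MS.extend_borel a(1) b(1); simp)+
  have a'_le: "norm (a' p) \<le> 1" and b'_le: "norm (b' p) \<le> 1" for p
    using good[of "fst p" "snd p"] by (auto simp: a'_def b'_def \<kappa>_def divide_le_eq)
  have a'_eq: "a (s, y) = c s *\<^sub>R a' (s, y)" and b'_eq: "b (s, y) = c s *\<^sub>R b' (s, y)"
    if "s \<in> {0..T}" "s \<notin> N" for s y
    using good[of s y] that bspec[OF c(2), of s] by (cases "c s = 0"; auto simp: a'_def b'_def \<kappa>_def)+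
  have notN: "AE s in \<mu>. s \<in> {0..T} \<and> s \<notin> N"
    using AE_not_in[OF N] AE_space by eventually_elim (simp add: space_mu)
  let ?\<nu> = "weighted \<mu> c"
  interpret L: linear_setting T d M F X P ?\<nu> a' b' g
    using T_pos a'_borel a'_le b'_borel b'_le g_borel g_consistent MS.markov_setting_axioms diffuse_weighted[OF mu c]
    by (intro linear_setting.intro linear_setting_axioms.intro) (auto simp: a'_def b'_def)
  note WI = weighted_integral[OF mu c]
  have path: "(\<lambda>s. \<phi> (s, X s \<omega>)) \<in> borel_measurable \<mu>"
    if \<phi>: "(\<lambda>p. if fst p \<in> {0..T} then \<phi> p else 0) \<in> borel_measurable borel" and \<omega>: "\<omega> \<in> space M"
    for \<phi> :: "real \<times> 's \<Rightarrow> 'e::{banach, second_countable_topology}" and \<omega>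
  proof -
    have "(\<lambda>(s, \<omega>). if 0 \<le> s \<and> s \<le> T then (if fst (s, X s \<omega>) \<in> {0..T} then \<phi> (s, X s \<omega>) else 0) else 0)
        \<in> borel_measurable (borel \<Otimes>\<^sub>M natural_sigma M X 0 T)"
      using T_pos by (intro MS.path_measurable[OF \<phi>]) auto
    from measurable_compose[OF measurable_Pair2' this, of \<omega>] \<omega>
    have "(\<lambda>s. if 0 \<le> s \<and> s \<le> T then (if fst (s, X s \<omega>) \<in> {0..T} then \<phi> (s, X s \<omega>) else 0) else 0) \<in> borel_measurable borel"
      by simp
    from measurable_mu[OF this] show ?thesis
      by (rule measurable_cong[THEN iffD1, rotated]) (simp add: space_mu)
  qed
  have a_path: "(\<lambda>s. a (s, X s \<omega>)) \<in> borel_measurable \<mu>" and b_path: "(\<lambda>s. b (s, X s \<omega>)) \<in> borel_measurable \<mu>"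
    if "\<omega> \<in> space M" for \<omega>
    using that by (auto intro!: path MS.extend_borel a(1) b(1))
  have rep: "L.represents \<mu> f"
    unfolding L.represents_def
  proof (intro allI impI)
    fix r t \<omega> and v :: "real \<times> 's \<Rightarrow> real^'k"
    assume r: "0 \<le> r" "r \<le> t" "t \<le> T" and \<omega>: "\<omega> \<in> space M"
      and v: "v \<in> borel_measurable borel" "bounded (range v)"
    let ?\<phi> = "\<lambda>s. a (s, X s \<omega>) + b (s, X s \<omega>) *v v (s, X s \<omega>)"
    obtain K where K: "\<And>p. norm (v p) \<le> K"
      using v(2) by (auto simp: bounded_iff)
    have "(\<lambda>p. if fst p \<in> {0..T} then v p else 0) = (\<lambda>p. indicator ({0..T} \<times> UNIV) p *\<^sub>R v p)"
      by (auto simp: fun_eq_iff indicator_def)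
    moreover have "{0..T} \<times> UNIV \<in> sets (borel :: (real \<times> 's) measure)"
      unfolding borel_prod[symmetric] by auto
    ultimately have "(\<lambda>p. if fst p \<in> {0..T} then v p else 0) \<in> borel_measurable borel"
      using v(1) by (auto intro!: borel_measurable_scaleR borel_measurable_indicator)
    then have v_path: "(\<lambda>s. v (s, X s \<omega>)) \<in> borel_measurable \<mu>"
      by (rule path[OF _ \<omega>])
    have \<phi>: "?\<phi> \<in> borel_measurable \<mu>"
      by (intro borel_measurable_add mvmul.borel_measurable_prod a_path b_path v_path \<omega>)
    have \<phi>_eq: "AE s in \<mu>. ?\<phi> s = c s *\<^sub>R L.rhs v \<omega> s"
      using notN
    proof eventually_elim
      case (elim s)
      then show ?case
        by (simp add: a'_eq b'_eq L.rhs_def scaleR_add_right mvmul.scaleR_left)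
    qed
    then have n\<phi>_eq: "AE s in \<mu>. norm (?\<phi> s) = c s *\<^sub>R norm (L.rhs v \<omega> s)"
      using notN by eventually_elim (use c(2) in simp)
    have rhs: "bdd_borel (L.rhs v \<omega>)"
      by (rule L.bdd_borel_rhs[OF v(1) K \<omega>])
    \<comment> \<open>The affine form of f is given for times in [0,T]; the indicator keeps s in
      that range.\<close>
    have sets: "(\<lambda>s. indicator {r..t} s *\<^sub>R f s (X s \<omega>) (v (s, X s \<omega>))) = (\<lambda>s. indicator {r..t} s *\<^sub>R ?\<phi> s)"
      "(\<lambda>s. indicator {r..t} s *\<^sub>R norm (f s (X s \<omega>) (v (s, X s \<omega>)))) = (\<lambda>s. indicator {r..t} s *\<^sub>R norm (?\<phi> s))"
      using f r by (auto simp: fun_eq_iff indicator_def)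
    show "set_integrable \<mu> {r..t} (\<lambda>s. f s (X s \<omega>) (v (s, X s \<omega>))) \<and>
      (LINT s:{r..t}|\<mu>. f s (X s \<omega>) (v (s, X s \<omega>))) = L.seg (L.rhs v \<omega>) r t \<and>
      (LINT s:{r..t}|\<mu>. norm (f s (X s \<omega>) (v (s, X s \<omega>)))) = L.seg (\<lambda>s. norm (L.rhs v \<omega> s)) r t"
      using WI[OF r(1,3) rhs \<phi> \<phi>_eq] WI(2)[OF r(1,3) bdd_borel_norm[OF rhs] measurable_compose[OF \<phi> borel_measurable_norm] n\<phi>_eq]
      unfolding set_integrable_def set_lebesgue_integral_def sets by blast
  qed
  define \<Sigma> where "\<Sigma> r t \<omega> = L.Sig (L.bpath \<omega>) r t" for r t \<omega>
  note bp = L.bdd_borel_bpath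
  show ?thesis
  proof (intro exI[of _ "{0..T}"] exI[of _ L.u] exI[of _ \<Sigma>] conjI allI impI ballI)
    show "nonextendible_admissible_solution_M T d \<mu> M X P UNIV f g {0..T} L.u"
      by (rule L.u_nonextendible[OF rep])
    show "J = {0..T}" if "nonextendible_admissible_solution_M T d \<mu> M X P UNIV f g J v" for J v
      by (rule L.nonextendible_unique(1)[OF rep that])
    show "v p = L.u p" if "nonextendible_admissible_solution_M T d \<mu> M X P UNIV f g J v" "p \<in> J \<times> UNIV" for J v p
      using L.nonextendible_unique(2)[OF rep that(1)] that(2) by blast
    show "L.u (r, x) = (LINT \<omega>|P r x. \<Sigma> r T \<omega> *v g (X T \<omega>)) -
        (LINT \<omega>|P r x. (LINT t:{r..T}|\<mu>. \<Sigma> r t \<omega> *v a (t, X t \<omega>)))"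
      if r: "r \<in> {0..T}" for r x
    proof -
      have "(LINT t:{r..T}|\<mu>. \<Sigma> r t \<omega> *v a (t, X t \<omega>)) = L.seg (\<lambda>s. \<Sigma> r s \<omega> *v L.apath \<omega> s) r T"
        if \<omega>: "\<omega> \<in> space M" for \<omega>
      proof (rule WI(2))
        have b: "bdd_borel (\<lambda>s. \<Sigma> r s \<omega>)"
          unfolding \<Sigma>_def L.Sig_def
          by (intro mmul.bdd_borel_prod bdd_borel_const L.bdd_borel_fund L.bdd_borel_bpath \<omega>)
        then show "bdd_borel (\<lambda>s. \<Sigma> r s \<omega> *v L.apath \<omega> s)"
          by (rule mvmul.bdd_borel_prod[OF _ L.bdd_borel_apath[OF \<omega>]])
        show "(\<lambda>t. \<Sigma> r t \<omega> *v a (t, X t \<omega>)) \<in> borel_measurable \<mu>"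
          by (rule mvmul.borel_measurable_prod[OF measurable_mu[OF bdd_borel_measurable[OF b]] a_path[OF \<omega>]])
        \<comment> \<open>The factor c passes from the inhomogeneity to the measure, while the
          propagator stays the same.\<close>
        show "AE s in \<mu>. \<Sigma> r s \<omega> *v a (s, X s \<omega>) = c s *\<^sub>R (\<Sigma> r s \<omega> *v L.apath \<omega> s)"
          using notN
        proof eventually_elim
          case (elim s)
          then show ?case
            by (simp add: a'_eq L.apath_def mvmul.scaleR_right)
        qed
      qed (use r in auto)
      then have "(LINT \<omega>|P r x. (LINT t:{r..T}|\<mu>. \<Sigma> r t \<omega> *v a (t, X t \<omega>)))
          = (LINT \<omega>|P r x. L.seg (\<lambda>s. \<Sigma> r s \<omega> *v L.apath \<omega> s) r T)"
        by (intro LINT_cong) (auto simp: MS.space_P[OF r])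
      then show ?thesis
        using L.u_eq_Sig[OF r, of x] by (simp add: \<Sigma>_def)
    qed
    show "\<Sigma> r t \<in> borel_measurable (natural_sigma M X r t)" if "0 \<le> r \<and> r \<le> t \<and> t \<le> T" for r t
      using L.Sig_measurable[of r t] that by (simp add: \<Sigma>_def[abs_def])
    show "norm (\<Sigma> r t \<omega>) \<le> sqrt (real CARD('k)) * exp (LINT s:{r..t}|\<mu>. norm (b (s, X s \<omega>)))"
      if rt: "0 \<le> r \<and> r \<le> t \<and> t \<le> T" and \<omega>: "\<omega> \<in> space M" for r t \<omega>
    proof -
      have r: "0 \<le> r" "r \<le> t" "t \<le> T" using rt by auto
      have "AE s in \<mu>. norm (b (s, X s \<omega>)) = c s *\<^sub>R norm (L.bpath \<omega> s)"
        using notN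
      proof eventually_elim
        case (elim s)
        then show ?case using bspec[OF c(2), of s] by (simp add: b'_eq L.bpath_def)
      qed
      from WI(2)[OF r(1,3) bdd_borel_norm[OF L.bdd_borel_bpath[OF \<omega>]] measurable_compose[OF b_path[OF \<omega>] borel_measurable_norm] this]
      show ?thesis
        using L.norm_Sig_le[OF L.bdd_borel_bpath[OF \<omega>] r(2)] by (simp add: \<Sigma>_def)
    qed
    show "continuous_on ({0..T} \<times> {0..T}) (\<lambda>(r, t). \<Sigma> r t \<omega>)" if "\<omega> \<in> space M" for \<omega>
      unfolding \<Sigma>_def by (rule L.Sig_continuous[OF bp[OF that]])
    show "\<Sigma> r r \<omega> = mat 1" if "\<omega> \<in> space M" for r \<omega>
      unfolding \<Sigma>_def by (rule L.Sig_refl[OF bp[OF that]])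
    show "\<Sigma> r s \<omega> ** \<Sigma> s t \<omega> = \<Sigma> r t \<omega>" if "\<omega> \<in> space M" for r s t \<omega>
      unfolding \<Sigma>_def by (rule L.Sig_trans[OF bp[OF that]])
    show "invertible (\<Sigma> r t \<omega>)" "matrix_inv (\<Sigma> r t \<omega>) = \<Sigma> t r \<omega>" if "\<omega> \<in> space M" for r t \<omega>
      unfolding \<Sigma>_def by (rule L.Sig_inverse[OF bp[OF that]])+
    show "\<Sigma> r t \<omega> = matrix_exp (- (LINT s:{r..t}|\<mu>. b (s, X s \<omega>)))"
      if comm: "\<forall>p\<in>{0..T} \<times> UNIV. \<forall>q\<in>{0..T} \<times> UNIV. b p ** b q = b q ** b p"
        and rt: "0 \<le> r \<and> r \<le> t \<and> t \<le> T" and \<omega>: "\<omega> \<in> space M" for r t \<omega>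
    proof -
      have r: "0 \<le> r" "r \<le> t" "t \<le> T" using rt by auto
      have "AE s in \<mu>. b (s, X s \<omega>) = c s *\<^sub>R L.bpath \<omega> s"
        using notN
      proof eventually_elim
        case (elim s)
        then show ?case by (simp add: b'_eq L.bpath_def)
      qed
      note WI(2)[OF r(1,3) L.bdd_borel_bpath[OF \<omega>] b_path[OF \<omega>] this]
      \<comment> \<open>Commutation is assumed on [0,T] x S; at other times the rescaled coefficient
        is 0 and commutes trivially.\<close>
      moreover have "L.bpath \<omega> s ** L.bpath \<omega> q = L.bpath \<omega> q ** L.bpath \<omega> s" for s q
        using comm by (simp add: L.bpath_def b'_def mmul.scaleR_left mmul.scaleR_right mult.commute)
      ultimately show ?thesis
        using L.Sig_commuting[OF L.bdd_borel_bpath[OF \<omega>] r(2)] by (simp add: \<Sigma>_def)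
    qed
  qed simp
qed

end
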